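(* Suppose $u=(\rho,m):\mathbb{R}^+\times\mathbb{R}\to\mathbb{R}^2$ is a bounded entropy solution to the isentropic Euler equations with $\gamma=3$ and further suppose $\operatorname{ess\,inf}\rho>0$. Then, for any Lipschitz curve $h:[0,T]\to\mathbb{R}$, for each of $g_1=\lambda_2$ or $g_1=-\lambda_1$, $$\lim_{n\to\infty}\int_0^T\ \operatorname*{ess\,sup}_{-\frac1n<y<\frac1n}\left[g_1(t,h(t)+y)-\max(g_1^+(t),g_1^-(t))\right]_+\,dt=0.$$ Moreover, for any sequence $r_n\to0^+$ and any $0<\varepsilon<1$, for $g_2=\rho$, $\lambda_2$, or $-\lambda_1$, $$\lim_{n\to\infty}\int_0^T\ \operatorname*{ess\,sup}_{\varepsilon r_n<y<r_n}\left(\left[g_2(t,h(t)+y)-g_2^+(t)\right]_++\left[g_2(t,h(t)-y)-g_2^-(t)\right]_+\right)dt=0.$$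
   Context: The isentropic Euler equations with $\gamma=3$, for $(t,x)\in\mathbb{R}^+\times\mathbb{R}$, are $$\rho_t+m_x=0,\qquad m_t+\left(\frac{m^2}{\rho}+\frac{\rho^3}{12}\right)_x=0,$$ with unknown $u=(\rho,m)$ and flux $f(\rho,m)=(m,\,m^2/\rho+\rho^3/12)$. A bounded entropy solution is a measurable $u=(\rho,m)$ with $\rho,\ m/\rho\in L^\infty(\mathbb{R}^+\times\mathbb{R})$ which satisfies the system in the sense of distributions and satisfies $\eta(u)_t+q(u)_x\le 0$ in the sense of distributions for every pair $(\eta,q)$ of functions of the state $(\rho,m)$ such that $\eta$ is convex, $\eta,q\in C(\mathbb{R}^+\times\mathbb{R})$ and $q'=\eta' f'$. The Riemann invariants are $\lambda_1(\rho,m)=\frac m\rho-\frac\rho2$ and $\lambda_2(\rho,m)=\frac m\rho+\frac\rho2$. For a function $g$ of the state, $g(t,x)=g(u(t,x))$ and $g^\pm(t)=g(u^\pm(t))$, where $u^\pm\in L^\infty([0,T];\mathbb{R}^2)$ are the strong traces of $u$ along $h$, i.e. $$\lim_{k\to\infty}\operatorname*{ess\,sup}_{y\in(0,1/k)}\int_0^T |u(t,h(t)+y)-u^+(t)|+|u(t,h(t)-y)-u^-(t)|\,dt=0$$ (such traces exist for every bounded entropy solution and every Lipschitz $h$). $[s]_+=\max(s,0)$. *)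

theory Defs
  imports "HOL-Analysis.Analysis" "HOL-Probability.Essential_Supremum"
begin

text \<open>
  Points of space-time are pairs \<open>(t, x)\<close>, states are pairs \<open>(\<rho>, m)\<close>. Functions are total in HOL;
  only their values on \<open>spacetime\<close> resp. \<open>states\<close> matter. The states form the open half plane on
  which the flux is defined.
\<close>

definition spacetime :: "(real \<times> real) set" where
  "spacetime = {0<..} \<times> UNIV"

definition states :: "(real \<times> real) set" where
  "states = {0<..} \<times> UNIV"

definition flux :: "real \<times> real \<Rightarrow> real \<times> real" where
  "flux = (\<lambda>(\<rho>, m). (m, m\<^sup>2 / \<rho> + \<rho> ^ 3 / 12))"

definition lambda1 :: "real \<times> real \<Rightarrow> real" where
  "lambda1 = (\<lambda>(\<rho>, m). m / \<rho> - \<rho> / 2)"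

definition lambda2 :: "real \<times> real \<Rightarrow> real" where
  "lambda2 = (\<lambda>(\<rho>, m). m / \<rho> + \<rho> / 2)"

definition pos_part :: "real \<Rightarrow> real" where
  "pos_part s = max s 0"

subsection \<open>Essential bounds\<close>

definition Linfty :: "'a measure \<Rightarrow> ('a \<Rightarrow> 'b::real_normed_vector) set" where
  "Linfty M = {f. f \<in> borel_measurable M \<and> (\<exists>C. AE x in M. norm (f x) \<le> C)}"

definition essinf :: "'a measure \<Rightarrow> ('a \<Rightarrow> real) \<Rightarrow> ereal" where
  "essinf M f = - esssup M (\<lambda>x. - ereal (f x))"

subsection \<open>Distributional equations on space-time\<close>

fun C_upto :: "nat \<Rightarrow> (real \<times> real \<Rightarrow> real) \<Rightarrow> bool" where
  "C_upto 0 \<phi> \<longleftrightarrow> continuous_on UNIV \<phi>"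
| "C_upto (Suc k) \<phi> \<longleftrightarrow>
     (\<exists>\<phi>\<^sub>t \<phi>\<^sub>x. (\<forall>z. (\<phi> has_derivative (\<lambda>v. \<phi>\<^sub>t z * fst v + \<phi>\<^sub>x z * snd v)) (at z)) \<and>
        C_upto k \<phi>\<^sub>t \<and> C_upto k \<phi>\<^sub>x)"

definition test_functions :: "(real \<times> real \<Rightarrow> real) set" where
  "test_functions =
     {\<phi>. (\<forall>k. C_upto k \<phi>) \<and> (\<exists>K. compact K \<and> K \<subseteq> spacetime \<and> (\<forall>z. z \<notin> K \<longrightarrow> \<phi> z = 0))}"

text \<open>The action of the distribution \<open>A\<^sub>t + B\<^sub>x\<close> on a test function.\<close>

definition div_action ::
  "(real \<times> real \<Rightarrow> real) \<Rightarrow> (real \<times> real \<Rightarrow> real) \<Rightarrow> (real \<times> real \<Rightarrow> real) \<Rightarrow> real" where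
  "div_action A B \<phi> =
     - (LINT z|lebesgue_on spacetime.
          A z * frechet_derivative \<phi> (at z) (1, 0) + B z * frechet_derivative \<phi> (at z) (0, 1))"

definition distr_div_eq_0 :: "(real \<times> real \<Rightarrow> real) \<Rightarrow> (real \<times> real \<Rightarrow> real) \<Rightarrow> bool" where
  "distr_div_eq_0 A B \<longleftrightarrow> (\<forall>\<phi>\<in>test_functions. div_action A B \<phi> = 0)"

definition distr_div_le_0 :: "(real \<times> real \<Rightarrow> real) \<Rightarrow> (real \<times> real \<Rightarrow> real) \<Rightarrow> bool" where
  "distr_div_le_0 A B \<longleftrightarrow> (\<forall>\<phi>\<in>test_functions. (\<forall>z. 0 \<le> \<phi> z) \<longrightarrow> div_action A B \<phi> \<le> 0)"

subsection \<open>Bounded entropy solutions\<close>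

text \<open>
  The relation \<open>q' = \<eta>' f'\<close> is read classically, at every state: the derivative of \<open>q\<close> is the row
  vector \<open>\<eta>'\<close> times the Jacobian of \<open>f\<close>, i.e. a composition of linear maps.
\<close>

definition entropy_pair :: "(real \<times> real \<Rightarrow> real) \<Rightarrow> (real \<times> real \<Rightarrow> real) \<Rightarrow> bool" where
  "entropy_pair \<eta> q \<longleftrightarrow>
     convex_on states \<eta> \<and> continuous_on states \<eta> \<and> continuous_on states q \<and>
     (\<forall>w\<in>states. \<exists>D\<eta> Df. (\<eta> has_derivative D\<eta>) (at w) \<and> (flux has_derivative Df) (at w) \<and>
        (q has_derivative (D\<eta> \<circ> Df)) (at w))"

definition bounded_entropy_solution :: "(real \<times> real \<Rightarrow> real \<times> real) \<Rightarrow> bool" where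
  "bounded_entropy_solution u \<longleftrightarrow>
     u \<in> borel_measurable (lebesgue_on spacetime) \<and>
     (AE z in lebesgue_on spacetime. u z \<in> states) \<and>
     (\<lambda>z. fst (u z)) \<in> Linfty (lebesgue_on spacetime) \<and>
     (\<lambda>z. snd (u z) / fst (u z)) \<in> Linfty (lebesgue_on spacetime) \<and>
     distr_div_eq_0 (\<lambda>z. fst (u z)) (\<lambda>z. fst (flux (u z))) \<and>
     distr_div_eq_0 (\<lambda>z. snd (u z)) (\<lambda>z. snd (flux (u z))) \<and>
     (\<forall>\<eta> q. entropy_pair \<eta> q \<longrightarrow> distr_div_le_0 (\<lambda>z. \<eta> (u z)) (\<lambda>z. q (u z)))"

subsection \<open>Strong traces along a curve\<close>

text \<open>
  Nonnegative quantities are integrated as \<open>ennreal\<close>, so that integrals and essential suprema are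
  always defined and are finite exactly when they are classically.
\<close>

definition strong_traces ::
  "(real \<times> real \<Rightarrow> real \<times> real) \<Rightarrow> (real \<Rightarrow> real) \<Rightarrow> real \<Rightarrow>
   (real \<Rightarrow> real \<times> real) \<Rightarrow> (real \<Rightarrow> real \<times> real) \<Rightarrow> bool" where
  "strong_traces u h T u\<^sub>p u\<^sub>m \<longleftrightarrow>
     u\<^sub>p \<in> Linfty (lebesgue_on {0..T}) \<and> u\<^sub>m \<in> Linfty (lebesgue_on {0..T}) \<and>
     (\<lambda>k. esssup (lebesgue_on {0<..<1 / real k})
            (\<lambda>y. \<integral>\<^sup>+t. ennreal (norm (u (t, h t + y) - u\<^sub>p t) + norm (u (t, h t - y) - u\<^sub>m t))
                   \<partial>lebesgue_on {0..T}))
       \<longlonglongrightarrow> 0"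

end

theory Submission
  imports Defs
begin

text \<open>
  For \<open>\<gamma> = 3\<close> every convex \<open>g\<close> yields the entropy pair
  \<open>\<eta> = \<integral> g(v) dv\<close>, \<open>q = \<integral> v g(v) dv\<close>, the integrals being taken over \<open>\<lambda>\<^sub>1 < v < \<lambda>\<^sub>2\<close>.
  With \<open>g(v) = max (v - k) 0\<close> the entropy \<open>\<eta>\<^sub>k\<close> is a nonnegative density that vanishes exactly where
  \<open>\<lambda>\<^sub>2 \<le> k\<close>, and it is carried with the mean velocity \<open>q\<^sub>k / \<eta>\<^sub>k\<close>. The mean velocity grows with the level
  \<open>k\<close>; since \<open>\<rho>\<close> is bounded below, this growth is quantitative: the quantity
  \<open>q\<^bsub>k+d\<^esub> \<eta>\<^sub>k - \<eta>\<^bsub>k+d\<^esub> q\<^sub>k\<close> is at least a constant times \<open>d\<^sup>3 \<eta>\<^bsub>k+d\<^esub>\<close> (\<open>kin_speed_gap\<close>).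

  Two densities that move with different velocities must cross each other. The interaction functional
  \<open>\<integral>\<integral> \<eta>(t, x) \<eta>'(t, y) dx dy\<close> over \<open>x < y\<close> turns this into a bound: the space-time
  integral of \<open>q \<eta>' - \<eta> q'\<close> is controlled by the product of the two masses (\<open>interaction_estimate\<close>).
  Applied to the levels \<open>k + d\<close> and \<open>k\<close> it bounds the mass at the higher level on a smaller square by the
  square of the mass at the lower level on a larger square (\<open>mass_gain\<close>). Such a superlinear gain can be
  iterated as in De Giorgi's method: if the mean of \<open>\<eta>\<^sub>k\<close> over a square is small, then
  \<open>\<lambda>\<^sub>2 \<le> k + \<delta>\<close> almost everywhere on the square of half the size (\<open>small_mass_imp_bound\<close>). The bound for
  \<open>- \<lambda>\<^sub>1\<close> comes from \<open>g(v) = max (- v - k) 0\<close>, for which the velocities are reversed; both cases are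
  instances of the locale \<open>kinetic_family\<close>.

  Near a point \<open>(t\<^sub>0, h t\<^sub>0)\<close> of the curve this is used with \<open>k\<close> equal to the trace value at \<open>t\<^sub>0\<close> and with
  squares of size comparable to the distance \<open>R\<close> from the curve. The mean of \<open>\<eta>\<^sub>k\<close> is then at most the mean
  excess over the trace plus the mean oscillation of the trace in time. As \<open>R\<close> tends to \<open>0\<close>, both tend to
  \<open>0\<close> after integration in \<open>t\<^sub>0\<close>, the first because the trace is strong and the second by continuity of
  translations, so they are small for all \<open>t\<^sub>0\<close> outside a set of small measure (\<open>control_along_curve\<close>).
  Squares that stay on one side of the curve see only the trace of that side; squares across the curve
  see the maximum of both. On the exceptional times the integrand is merely bounded, which is enough
  for the integrals to converge. Finally \<open>\<rho> = \<lambda>\<^sub>2 + (- \<lambda>\<^sub>1)\<close> inherits the one-sided bounds.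
\<close>


section \<open>Smooth cut-off functions\<close>

lemma C_upto_SucI:
  assumes "\<And>z. (\<phi> has_derivative (\<lambda>v. a z * fst v + b z * snd v)) (at z)"
    and "C_upto k a" and "C_upto k b"
  shows "C_upto (Suc k) \<phi>"
  unfolding C_upto.simps using assms by (intro exI[of _ a] exI[of _ b]) simp

lemma C_upto_SucE:
  assumes "C_upto (Suc k) \<phi>"
  obtains a b where "\<And>z. (\<phi> has_derivative (\<lambda>v. a z * fst v + b z * snd v)) (at z)"
    and "C_upto k a" and "C_upto k b"
proof -
  from assms obtain a b where
    *: "(\<forall>z. (\<phi> has_derivative (\<lambda>v. a z * fst v + b z * snd v)) (at z)) \<and> C_upto k a \<and> C_upto k b"
    unfolding C_upto.simps by (elim exE)
  show thesis
    by (rule that[OF *[THEN conjunct1, rule_format]]) (rule *[THEN conjunct2, THEN conjunct1] *[THEN conjunct2, THEN conjunct2])+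
qed

lemma C_upto_SucD: "C_upto (Suc k) \<phi> \<Longrightarrow> C_upto k \<phi>"
proof (induction k arbitrary: \<phi>)
  case 0
  then obtain a b where "\<And>z. (\<phi> has_derivative (\<lambda>v. a z * fst v + b z * snd v)) (at z)"
    by auto
  then show ?case
    by (auto intro!: continuous_at_imp_continuous_on has_derivative_continuous)
next
  case (Suc k)
  obtain a b where "\<And>z. (\<phi> has_derivative (\<lambda>v. a z * fst v + b z * snd v)) (at z)"
    "C_upto (Suc k) a" "C_upto (Suc k) b"
    by (rule C_upto_SucE[OF Suc.prems]) (rule that)
  with Suc.IH show ?case by (blast intro: C_upto_SucI)
qed

lemma C_upto_const: "C_upto k (\<lambda>z. c)"
proof (induction k arbitrary: c)
  case (Suc k)
  show ?case
    by (rule C_upto_SucI[where a="\<lambda>_. 0" and b="\<lambda>_. 0"]) (simp_all add: Suc)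
qed simp

lemma C_upto_add:
  "C_upto k f \<Longrightarrow> C_upto k g \<Longrightarrow> C_upto k (\<lambda>z. f z + g z)"
proof (induction k arbitrary: f g)
  case 0
  then show ?case by (auto intro: continuous_intros)
next
  case (Suc k)
  obtain a b where
    f: "\<And>z. (f has_derivative (\<lambda>v. a z * fst v + b z * snd v)) (at z)" "C_upto k a" "C_upto k b"
    by (rule C_upto_SucE[OF Suc.prems(1)]) (rule that)
  obtain c d where
    g: "\<And>z. (g has_derivative (\<lambda>v. c z * fst v + d z * snd v)) (at z)" "C_upto k c" "C_upto k d"
    by (rule C_upto_SucE[OF Suc.prems(2)]) (rule that)
  have "((\<lambda>z. f z + g z) has_derivative
      (\<lambda>v. (a z + c z) * fst v + (b z + d z) * snd v)) (at z)" for z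
  proof -
    have "((\<lambda>z. f z + g z) has_derivative
      (\<lambda>v. (a z * fst v + b z * snd v) + (c z * fst v + d z * snd v))) (at z)"
        using f(1) g(1) by (rule has_derivative_add)
    then show "((\<lambda>z. f z + g z) has_derivative
      (\<lambda>v. (a z + c z) * fst v + (b z + d z) * snd v)) (at z)"
      by (simp add: algebra_simps)
  qed
  from this Suc.IH[OF f(2) g(2)] Suc.IH[OF f(3) g(3)] show ?case
    by (rule C_upto_SucI)
qed

lemma has_derivative_mult_partials:
  fixes f g :: "real \<times> real \<Rightarrow> real"
  assumes "(f has_derivative (\<lambda>v. a * fst v + b * snd v)) (at z)"
    and "(g has_derivative (\<lambda>v. c * fst v + d * snd v)) (at z)"
  shows "((\<lambda>z. f z * g z) has_derivative
      (\<lambda>v. (f z * c + a * g z) * fst v + (f z * d + b * g z) * snd v)) (at z)"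
  using has_derivative_mult[OF assms] by (simp add: algebra_simps)

lemma C_upto_mult:
  "C_upto k f \<Longrightarrow> C_upto k g \<Longrightarrow> C_upto k (\<lambda>z. f z * g z)"
proof (induction k arbitrary: f g)
  case 0
  then show ?case by (auto intro: continuous_intros)
next
  case (Suc k)
  obtain a b where
    f: "\<And>z. (f has_derivative (\<lambda>v. a z * fst v + b z * snd v)) (at z)" "C_upto k a" "C_upto k b"
    by (rule C_upto_SucE[OF Suc.prems(1)]) (rule that)
  obtain c d where
    g: "\<And>z. (g has_derivative (\<lambda>v. c z * fst v + d z * snd v)) (at z)" "C_upto k c" "C_upto k d"
    by (rule C_upto_SucE[OF Suc.prems(2)]) (rule that)
  have fg: "C_upto k f" "C_upto k g"
    using Suc.prems C_upto_SucD by blast+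
  have "((\<lambda>z. f z * g z) has_derivative
      (\<lambda>v. (f z * c z + a z * g z) * fst v + (f z * d z + b z * g z) * snd v)) (at z)" for z
    using has_derivative_mult_partials f(1) g(1) by blast
  moreover have "C_upto k (\<lambda>z. f z * c z + a z * g z)" "C_upto k (\<lambda>z. f z * d z + b z * g z)"
    using Suc.IH fg f g by (auto intro!: C_upto_add)
  ultimately show ?case
    by (rule C_upto_SucI)
qed

lemma has_derivative_compose_affine:
  assumes "(f has_real_derivative D) (at (p * fst z + q * snd z + r))"
  shows "((\<lambda>z. f (p * fst z + q * snd z + r)) has_derivative
           (\<lambda>v. (p * D) * fst v + (q * D) * snd v)) (at z)"
proof -
  have "((\<lambda>z. p * fst z + q * snd z + r) has_derivative (\<lambda>v. p * fst v + q * snd v)) (at z)"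
    by (auto intro!: derivative_eq_intros)
  from has_derivative_compose[OF this assms[unfolded has_field_derivative_def]]
  show ?thesis by (simp add: algebra_simps)
qed

text \<open>
  The derivatives of \<open>exp (- 1 / x)\<close> on the positive axis are linear combinations of
  these functions, and the family is closed under differentiation, so that smoothness of all orders is a
  single induction.
\<close>

definition flat_exp :: "nat \<Rightarrow> real \<Rightarrow> real" where
  "flat_exp m x = (if x \<le> 0 then 0 else inverse x ^ m * exp (- inverse x))"

lemma flat_exp_deriv:
  "(flat_exp m has_real_derivative (flat_exp (m + 2) x - real m * flat_exp (m + 1) x)) (at x)"
proof -
  consider "x < 0" | "x > 0" | "x = 0" by linarith
  then show ?thesis
  proof cases
    case 1
    have "((\<lambda>x. 0) has_real_derivative 0) (at x)" by simp
    then have "(flat_exp m has_real_derivative 0) (at x)"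
      by (rule has_field_derivative_transform_within_open[where S="{..<0}"])
        (use 1 in \<open>auto simp: flat_exp_def\<close>)
    with 1 show ?thesis by (simp add: flat_exp_def)
  next
    case 2
    have "((\<lambda>x. inverse x ^ m * exp (- inverse x)) has_real_derivative
        (inverse x ^ (m + 2) * exp (- inverse x) - real m * (inverse x ^ (m + 1) * exp (- inverse x)))) (at x)"
      using 2 by (auto intro!: derivative_eq_intros simp: algebra_simps divide_inverse power_add)
        (cases m; simp add: algebra_simps power2_eq_square)
    then have "(flat_exp m has_real_derivative
        (inverse x ^ (m + 2) * exp (- inverse x) - real m * (inverse x ^ (m + 1) * exp (- inverse x)))) (at x)"
      by (rule has_field_derivative_transform_within_open[where S="{0<..}"])
        (use 2 in \<open>auto simp: flat_exp_def\<close>)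
    with 2 show ?thesis by (simp add: flat_exp_def)
  next
    case 3
    \<comment> \<open>At the origin the difference quotient is the next member of the family, and
      \<open>exp (- 1 / y)\<close> beats every power of \<open>1 / y\<close>.\<close>
    have "((\<lambda>y. flat_exp m y / y) \<longlongrightarrow> 0) (at 0)"
    proof (rule filterlim_split_at_real)
      have "((\<lambda>y. 0) \<longlongrightarrow> (0::real)) (at_left 0)" by simp
      then show "((\<lambda>y. flat_exp m y / y) \<longlongrightarrow> 0) (at_left 0)"
        by (rule Lim_transform_eventually) (auto simp: flat_exp_def eventually_at_filter)
      have "((\<lambda>y. inverse y ^ Suc m / exp (inverse y)) \<longlongrightarrow> (0::real)) (at_right 0)"
        using filterlim_compose[OF tendsto_power_div_exp_0 filterlim_inverse_at_top_right] .
      then show "((\<lambda>y. flat_exp m y / y) \<longlongrightarrow> 0) (at_right 0)"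
        by (rule Lim_transform_eventually)
          (auto simp: flat_exp_def eventually_at_filter exp_minus field_simps)
    qed
    then have "(flat_exp m has_real_derivative 0) (at 0)"
      by (simp add: has_field_derivative_iff flat_exp_def)
    with 3 show ?thesis by (simp add: flat_exp_def)
  qed
qed

lemma C_upto_flat_exp_affine: "C_upto k (\<lambda>z. flat_exp m (p * fst z + q * snd z + r))"
proof (induction k arbitrary: m)
  case 0
  have "isCont (flat_exp m) x" for x
    using flat_exp_deriv DERIV_isCont by blast
  then have "continuous_on UNIV (flat_exp m)"
    by (simp add: continuous_at_imp_continuous_on)
  then show ?case
    by (auto intro!: continuous_intros continuous_on_compose2[of UNIV "flat_exp m"])
next
  case (Suc k)
  let ?D = "\<lambda>z. flat_exp (m + 2) (p * fst z + q * snd z + r)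
             + (- real m) * flat_exp (m + 1) (p * fst z + q * snd z + r)"
  have "((\<lambda>z. flat_exp m (p * fst z + q * snd z + r)) has_derivative
           (\<lambda>v. (p * ?D z) * fst v + (q * ?D z) * snd v)) (at z)" for z
    using flat_exp_deriv[of m] by (intro has_derivative_compose_affine) simp
  moreover have "C_upto k (\<lambda>z. p * ?D z)" "C_upto k (\<lambda>z. q * ?D z)"
    by (intro C_upto_add C_upto_mult C_upto_const Suc)+
  ultimately show ?case
    by (rule C_upto_SucI)
qed

definition bump_mass :: real where
  "bump_mass = integral {0..1} (\<lambda>x. flat_exp 0 x * flat_exp 0 (1 - x))"

definition bump :: "real \<Rightarrow> real" where
  "bump x = flat_exp 0 x * flat_exp 0 (1 - x) / bump_mass"

lemma continuous_on_flat_exp: "continuous_on S (flat_exp m)"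
  by (intro continuous_at_imp_continuous_on ballI DERIV_isCont[OF flat_exp_deriv])

lemma flat_exp_nonneg: "0 \<le> flat_exp m x"
  by (simp add: flat_exp_def)

lemma bump_mass_pos: "0 < bump_mass"
proof -
  let ?f = "\<lambda>x. flat_exp 0 x * flat_exp 0 (1 - x)"
  have cont: "continuous_on {0..1} ?f"
    by (auto intro!: continuous_intros continuous_on_flat_exp
        continuous_on_compose2[OF continuous_on_flat_exp[of UNIV]])
  have nn: "0 \<le> ?f x" for x by (simp add: flat_exp_nonneg)
  have "bump_mass \<ge> 0"
    unfolding bump_mass_def
    using cont nn by (intro integral_nonneg integrable_continuous_interval) auto
  moreover have "bump_mass \<noteq> 0"
  proof
    assume "bump_mass = 0"
    then have "\<forall>x\<in>{0..1}. ?f x = 0"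
      unfolding bump_mass_def by (subst (asm) integral_eq_0_iff[OF cont]) (use nn in auto)
    then have "?f (1/2) = 0" by (rule bspec) simp
    then show False by (simp add: flat_exp_def)
  qed
  ultimately show ?thesis by simp
qed

lemma bump_nonneg: "0 \<le> bump x"
  using bump_mass_pos by (simp add: bump_def flat_exp_nonneg)

lemma bump_reflect: "bump (1 - x) = bump x"
  by (simp add: bump_def)

lemma bump_eq_0: "x \<le> 0 \<or> 1 \<le> x \<Longrightarrow> bump x = 0"
  by (auto simp: bump_def flat_exp_def)

lemma continuous_on_bump: "continuous_on S bump"
  unfolding bump_def using bump_mass_pos
  by (auto intro!: continuous_intros continuous_on_flat_exp
        continuous_on_compose2[OF continuous_on_flat_exp[of UNIV]])

lemma bump_measurable [measurable]: "bump \<in> borel_measurable borel"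
  using continuous_on_bump by (intro borel_measurable_continuous_onI)

definition bump_max :: real where
  "bump_max = (SOME C. \<forall>x. bump x \<le> C)"

lemma bump_le: "bump x \<le> bump_max"
proof -
  have "\<exists>C. \<forall>x. bump x \<le> C"
  proof -
    have "compact (bump ` {0..1})"
      using continuous_on_bump by (intro compact_continuous_image) auto
    then obtain C where C: "\<And>x. x \<in> {0..1} \<Longrightarrow> bump x \<le> C"
      using bounded_imp_bdd_above[OF compact_imp_bounded] unfolding bdd_above_def by fast
    have "bump x \<le> max C 0" for x
      using C[of x] bump_eq_0[of x] by (cases "x \<in> {0..1}") auto
    then show ?thesis by blast
  qed
  then show ?thesis
    unfolding bump_max_def by (rule someI2_ex) blast
qed

lemma bump_max_nonneg: "0 \<le> bump_max"
  using bump_nonneg bump_le order_trans by blast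

lemma bump_integral_Icc: "(bump has_integral 1) {0..1}"
proof -
  have "((\<lambda>x. flat_exp 0 x * flat_exp 0 (1 - x)) has_integral bump_mass) {0..1}"
    unfolding bump_mass_def
    by (intro integrable_integral integrable_continuous_interval)
     (auto intro!: continuous_intros continuous_on_flat_exp
        continuous_on_compose2[OF continuous_on_flat_exp[of UNIV]])
  from has_integral_divide[OF this, of bump_mass] bump_mass_pos show ?thesis
    by (simp add: bump_def[abs_def])
qed

lemma bump_has_integral: "has_bochner_integral lborel bump 1"
proof -
  have "(bump has_integral 1) UNIV"
    by (rule has_integral_on_superset[OF bump_integral_Icc]) (auto intro: bump_eq_0)
  moreover have "integrable lborel bump"
    by (rule integrableI_bounded_set[where A="{0..1}" and B=bump_max])
      (use bump_le bump_nonneg bump_eq_0 in auto)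
  ultimately show ?thesis
    by (metis has_bochner_integral_iff has_integral_integral_lborel has_integral_unique)
qed

text \<open>
  Smooth step from \<open>0\<close> (left of \<open>0\<close>) to \<open>1\<close> (right of
  \<open>1\<close>) whose derivative is the bump; products of rescaled steps serve as cut-offs and as a
  smooth replacement of the Heaviside function.
\<close>

definition step :: "real \<Rightarrow> real" where
  "step x = integral {0..x} bump"

lemma step_eq_0: "x \<le> 0 \<Longrightarrow> step x = 0"
  by (cases "x = 0") (auto simp: step_def)

lemma step_eq_1: "1 \<le> x \<Longrightarrow> step x = 1"
proof -
  assume "1 \<le> x"
  have "(bump has_integral 1) {0..x}"
    by (rule has_integral_on_superset[OF bump_integral_Icc]) (use \<open>1 \<le> x\<close> in \<open>auto intro: bump_eq_0\<close>)
  then show ?thesis by (simp add: step_def integral_unique)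
qed

lemma step_deriv: "(step has_real_derivative bump x) (at x)"
proof -
  let ?b = "\<bar>x\<bar> + 1"
  have zero: "integral {-?b..y} bump = 0" if "y \<le> 0" for y
  proof -
    have "integral {-?b..y} bump = integral {-?b..y} (\<lambda>x. 0)"
      by (rule Henstock_Kurzweil_Integration.integral_cong) (use that in \<open>auto intro: bump_eq_0\<close>)
    then show ?thesis by simp
  qed
  have eq: "integral {-?b..y} bump = step y" if "y \<in> {-?b<..<?b}" for y
  proof (cases "0 \<le> y")
    case True
    have "integral {-?b..0} bump + integral {0..y} bump = integral {-?b..y} bump"
      by (rule Henstock_Kurzweil_Integration.integral_combine)
        (use True in \<open>auto intro!: integrable_continuous_interval continuous_on_bump\<close>)
    with zero[of 0] show ?thesis by (simp add: step_def)
  qed (use zero[of y] step_eq_0[of y] in auto)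
  have "((\<lambda>y. integral {-?b..y} bump) has_real_derivative bump x) (at x within {-?b..?b})"
    by (rule integral_has_real_derivative[OF continuous_on_bump]) auto
  then have "((\<lambda>y. integral {-?b..y} bump) has_real_derivative bump x) (at x within {-?b<..<?b})"
    by (rule has_field_derivative_subset) auto
  then have "((\<lambda>y. integral {-?b..y} bump) has_real_derivative bump x) (at x)"
    by (subst (asm) at_within_open) auto
  then show ?thesis
    by (rule has_field_derivative_transform_within_open[where S="{-?b<..<?b}"]) (use eq in auto)
qed

lemma continuous_on_step: "continuous_on S step"
  by (intro continuous_at_imp_continuous_on ballI DERIV_isCont[OF step_deriv])

lemma step_measurable [measurable]: "step \<in> borel_measurable borel"
  using continuous_on_step by (intro borel_measurable_continuous_onI)

lemma step_mono: "x \<le> y \<Longrightarrow> step x \<le> step y"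
  by (rule DERIV_nonneg_imp_nondecreasing) (use step_deriv bump_nonneg in auto)

lemma step_nonneg: "0 \<le> step x" and step_le_1: "step x \<le> 1"
  using step_mono[of x "max x 1"] step_eq_1[of "max x 1"] step_mono[of "min x 0" x] step_eq_0[of "min x 0"]
  by auto

lemma C_upto_bump_affine: "C_upto k (\<lambda>z. bump (p * fst z + q * snd z + r))"
proof -
  have "C_upto k (\<lambda>z. inverse bump_mass * (flat_exp 0 (p * fst z + q * snd z + r)
            * flat_exp 0 ((- p) * fst z + (- q) * snd z + (1 - r))))"
    by (intro C_upto_mult C_upto_const C_upto_flat_exp_affine)
  also have "(\<lambda>z. inverse bump_mass * (flat_exp 0 (p * fst z + q * snd z + r)
            * flat_exp 0 ((- p) * fst z + (- q) * snd z + (1 - r)))) =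
      (\<lambda>z. bump (p * fst z + q * snd z + r))"
    unfolding bump_def by (intro ext) (simp add: field_simps)
  finally show ?thesis .
qed

lemma C_upto_step_affine: "C_upto k (\<lambda>z. step (p * fst z + q * snd z + r))"
proof (cases k)
  case 0
  then show ?thesis
    by (auto intro!: continuous_intros continuous_on_compose2[OF continuous_on_step[of UNIV]])
next
  case (Suc k')
  have "((\<lambda>z. step (p * fst z + q * snd z + r)) has_derivative
           (\<lambda>v. (p * bump (p * fst z + q * snd z + r)) * fst v
             + (q * bump (p * fst z + q * snd z + r)) * snd v)) (at z)" for z
    using step_deriv by (intro has_derivative_compose_affine) simp
  moreover have "C_upto k' (\<lambda>z. p * bump (p * fst z + q * snd z + r))"
    "C_upto k' (\<lambda>z. q * bump (p * fst z + q * snd z + r))"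
    by (auto intro!: C_upto_mult C_upto_const C_upto_bump_affine)
  ultimately show ?thesis
    unfolding Suc by (rule C_upto_SucI)
qed

section \<open>Continuity of translations in the mean\<close>

lemma integrable_bounded_support:
  fixes f :: "'a::euclidean_space \<Rightarrow> real"
  assumes [measurable]: "f \<in> borel_measurable borel"
    and "\<And>x. \<bar>f x\<bar> \<le> C"
    and "bounded K" and "\<And>x. x \<notin> K \<Longrightarrow> f x = 0"
  shows "integrable lborel f"
proof -
  obtain r where r: "K \<subseteq> cball 0 r"
    using \<open>bounded K\<close> by (auto simp: bounded_iff subset_iff)
  show ?thesis
  proof (rule integrableI_bounded_set)
    show "emeasure lborel (cball (0::'a) r) < \<infinity>"
      using emeasure_lborel_cball_finite[of "0::'a" r] by simp
    show "AE x in lborel. x \<in> cball 0 r \<longrightarrow> norm (f x) \<le> C"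
      using assms by simp
    show "AE x in lborel. x \<notin> cball 0 r \<longrightarrow> f x = 0"
    proof (intro AE_I2 impI)
      fix x :: 'a assume "x \<notin> cball 0 r"
      with r have "x \<notin> K" by blast
      then show "f x = 0" by (rule assms(4))
    qed
  qed simp_all
qed

lemma integrable_indicator_cball:
  "integrable lborel (indicator (cball (x::'a::euclidean_space) r) :: 'a \<Rightarrow> real)"
  using emeasure_lborel_cball_finite[of x r] by (simp add: integrable_indicator_iff)

lemma integral_translate:
  fixes f :: "'a::euclidean_space \<Rightarrow> real"
  assumes [measurable]: "f \<in> borel_measurable borel"
  shows "(LBINT x. f (x + v)) = (LBINT x. f x)"
proof -
  have "(LBINT x. f x) = (\<integral>x. f x \<partial>distr lborel borel ((+) v))"
    by (simp add: lborel_distr_plus)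
  also have "\<dots> = (LBINT x. f (v + x))"
    by (rule integral_distr) auto
  finally show ?thesis by (simp add: add.commute)
qed

text \<open>
  A measurable function is an almost everywhere limit of continuous ones. Clipping these to the range of
  \<open>f\<close> and cutting them off outside the support makes the convergence dominated.
\<close>

lemma L1_approx_continuous:
  fixes f :: "'a::euclidean_space \<Rightarrow> real"
  assumes [measurable]: "f \<in> borel_measurable borel"
    and bd: "\<And>x. \<bar>f x\<bar> \<le> C"
    and K: "bounded K" "\<And>x. x \<notin> K \<Longrightarrow> f x = 0"
    and e: "e > 0"
  obtains g r where "continuous_on UNIV g" "\<And>x. \<bar>g x\<bar> \<le> C" "\<And>x. r \<le> norm x \<Longrightarrow> g x = 0"
    "(LBINT x. \<bar>f x - g x\<bar>) < e"
proof -
  have C: "0 \<le> C" using bd[of undefined] by linarith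
  obtain r where r: "\<And>x. x \<in> K \<Longrightarrow> norm x \<le> r"
    using K(1) bounded_iff by blast
  define cutoff where "cutoff x = max 0 (min 1 (r + 1 - norm x))" for x :: 'a
  have chi: "0 \<le> cutoff x" "cutoff x \<le> 1" "x \<in> K \<Longrightarrow> cutoff x = 1" "r + 1 \<le> norm x \<Longrightarrow> cutoff x = 0" for x
    using r[of x] by (auto simp: cutoff_def)
  have cont_chi: "continuous_on UNIV cutoff"
    unfolding cutoff_def by (intro continuous_intros)
  have "f measurable_on UNIV"
    by (rule lebesgue_measurable_imp_measurable_on) (auto intro!: measurable_completion)
  then obtain N g where N: "negligible N" and g: "\<And>n::nat. continuous_on UNIV (g n)"
    and lim: "\<And>x. x \<notin> N \<Longrightarrow> (\<lambda>n. g n x) \<longlonglongrightarrow> f x"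
    unfolding measurable_on_def by auto
  define g' where "g' n x = cutoff x * max (- C) (min C (g n x))" for n x
  have g': "continuous_on UNIV (g' n)" "\<bar>g' n x\<bar> \<le> C" "r + 1 \<le> norm x \<Longrightarrow> g' n x = 0" for n x
  proof -
    show "continuous_on UNIV (g' n)"
      unfolding g'_def by (intro continuous_intros cont_chi g)
    have "\<bar>max (- C) (min C (g n x))\<bar> \<le> C" using C by auto
    then show "\<bar>g' n x\<bar> \<le> C"
      using chi(1,2)[of x] mult_mono[of "cutoff x" 1 "\<bar>max (- C) (min C (g n x))\<bar>" C]
      by (simp add: g'_def abs_mult)
  qed (simp add: g'_def chi)
  have lim': "(\<lambda>n. g' n x) \<longlonglongrightarrow> f x" if "x \<notin> N" for x
  proof -
    have "(\<lambda>n. g' n x) \<longlonglongrightarrow> cutoff x * max (- C) (min C (f x))"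
      unfolding g'_def by (intro tendsto_intros lim that)
    moreover have "max (- C) (min C (f x)) = f x" using bd[of x] by auto
    moreover have "cutoff x * f x = f x" using chi(3)[of x] K(2)[of x] by (cases "x \<in> K") auto
    ultimately show ?thesis by simp
  qed
  have [measurable]: "g' n \<in> borel_measurable borel" for n
    using g'(1) by (intro borel_measurable_continuous_onI)
  have "(\<lambda>n. LBINT x. \<bar>f x - g' n x\<bar>) \<longlonglongrightarrow> (\<integral>x. 0 \<partial>(lborel::'a measure))"
  proof (rule integral_dominated_convergence)
    show "integrable lborel (\<lambda>x. 2 * C * indicator (cball (0::'a) (r + 1)) x)"
      by (intro integrable_mult_right integrable_indicator_cball)
    have "AE x in lebesgue. x \<notin> N"
      using N by (simp add: negligible_iff_null_sets AE_not_in)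
    then have "AE x in lborel. x \<notin> N"
      by (simp add: AE_completion_iff)
    then show "AE x in lborel. (\<lambda>n. \<bar>f x - g' n x\<bar>) \<longlonglongrightarrow> 0"
    proof eventually_elim
      fix x assume "x \<notin> N"
      then have "(\<lambda>n. \<bar>f x - g' n x\<bar>) \<longlonglongrightarrow> \<bar>f x - f x\<bar>"
        by (intro tendsto_intros lim')
      then show "(\<lambda>n. \<bar>f x - g' n x\<bar>) \<longlonglongrightarrow> 0" by simp
    qed
    fix n
    have "\<bar>f x - g' n x\<bar> \<le> 2 * C * indicator (cball 0 (r + 1)) x" for x
    proof (cases "norm x \<le> r + 1")
      case True
      then show ?thesis using bd[of x] g'(2)[where n=n and x=x] by (auto simp: abs_if split: if_splits)
    next
      case False
      then show ?thesis using r[of x] K(2)[of x] g'(3)[where n=n and x=x] by auto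
    qed
    then show "AE x in lborel. norm \<bar>f x - g' n x\<bar> \<le> 2 * C * indicator (cball 0 (r + 1)) x"
      by simp
  qed auto
  then have "(\<lambda>n. LBINT x. \<bar>f x - g' n x\<bar>) \<longlonglongrightarrow> 0" by simp
  from order_tendstoD(2)[OF this e] obtain n where "(LBINT x. \<bar>f x - g' n x\<bar>) < e"
    by (meson eventually_happens sequentially_bot)
  then show thesis
    using g'(1,2) g'(3)[where n=n] by (intro that[of "g' n" "r + 1"]) auto
qed

text \<open>
  For a continuous function of bounded support this is uniform continuity; the general case follows by
  approximation in the mean, since translations preserve the integral.
\<close>

lemma translation_continuous_L1:
  fixes f :: "'a::euclidean_space \<Rightarrow> real"
  assumes [measurable]: "f \<in> borel_measurable borel"
    and bd: "\<And>x. \<bar>f x\<bar> \<le> C"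
    and K: "bounded K" "\<And>x. x \<notin> K \<Longrightarrow> f x = 0"
    and e: "e > 0"
  obtains d where "d > 0" "\<And>v. norm v < d \<Longrightarrow> (LBINT x. \<bar>f (x + v) - f x\<bar>) < e"
proof -
  obtain g r where g: "continuous_on UNIV g" "\<And>x. \<bar>g x\<bar> \<le> C" "\<And>x. r \<le> norm x \<Longrightarrow> g x = 0"
    and fg: "(LBINT x. \<bar>f x - g x\<bar>) < e / 4"
    using L1_approx_continuous[OF assms(1) bd K, of "e/4"] e by auto
  have [measurable]: "g \<in> borel_measurable borel"
    using g(1) by (intro borel_measurable_continuous_onI)
  have int: "integrable lborel f" "integrable lborel g"
  proof -
    show "integrable lborel f" by (rule integrable_bounded_support[OF _ bd K]) simp_all
    show "integrable lborel g"
      by (rule integrable_bounded_support[OF _ g(2), where K="ball 0 r"]) (simp_all add: g(3))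
  qed
  have shift: "integrable lborel (\<lambda>x. p (x + v))" if "integrable lborel p" for p :: "'a \<Rightarrow> real" and v
  proof -
    have [measurable]: "p \<in> borel_measurable borel" using that by auto
    have "integrable (distr lborel borel ((+) v)) p" using that by (simp add: lborel_distr_plus)
    then show ?thesis by (subst (asm) integrable_distr_eq) (auto simp: add.commute)
  qed
  let ?B = "cball (0::'a) (\<bar>r\<bar> + 1)"
  define m where "m = measure lborel ?B"
  have m: "0 \<le> m" by (simp add: m_def)
  define e' where "e' = e / (4 * (m + 1))"
  have e': "e' > 0" using e m by (simp add: e'_def)
  have "uniformly_continuous_on (cball 0 (\<bar>r\<bar> + 2)) g"
    using g(1) by (intro compact_uniformly_continuous) (auto intro: continuous_on_subset)
  then obtain d where d: "d > 0"
    "\<And>x y. x \<in> cball 0 (\<bar>r\<bar> + 2) \<Longrightarrow> y \<in> cball 0 (\<bar>r\<bar> + 2) \<Longrightarrow> dist y x < d \<Longrightarrow> dist (g y) (g x) < e'"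
    unfolding uniformly_continuous_on_def using e' by metis
  show thesis
  proof (rule that[of "min d 1"])
    show "0 < min d 1" using d(1) by simp
    fix v :: 'a assume v: "norm v < min d 1"
    have gv: "\<bar>g (x + v) - g x\<bar> \<le> e' * indicator ?B x" for x
    proof (cases "x \<in> ?B")
      case True
      have "norm (x + v) \<le> norm x + norm v" by (rule norm_triangle_ineq)
      then have "x + v \<in> cball 0 (\<bar>r\<bar> + 2)" "x \<in> cball 0 (\<bar>r\<bar> + 2)" "dist (x + v) x < d"
        using True v by (simp_all only: mem_cball_0 dist_norm add_diff_cancel_left')
      then have "dist (g (x + v)) (g x) < e'" by (intro d(2))
      then show ?thesis using True by (simp add: dist_real_def)
    next
      case False
      have "norm x \<le> norm (x + v) + norm v" using norm_triangle_ineq4[of "x + v" v] by simp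
      then have "g x = 0" "g (x + v) = 0" using False v by (auto intro!: g(3))
      then show ?thesis using False by simp
    qed
    have i1: "integrable lborel (\<lambda>x. \<bar>g (x + v) - g x\<bar>)"
      and i2: "integrable lborel (\<lambda>x. \<bar>f (x + v) - g (x + v)\<bar>)"
      and i3: "integrable lborel (\<lambda>x. \<bar>f x - g x\<bar>)"
      and i4: "integrable lborel (\<lambda>x. \<bar>f (x + v) - f x\<bar>)"
      by (intro integrable_abs Bochner_Integration.integrable_diff shift int)+
    have iB: "integrable lborel (\<lambda>x. e' * indicator ?B x)"
      by (intro integrable_mult_right integrable_indicator_cball)
    have "(LBINT x. \<bar>g (x + v) - g x\<bar>) \<le> (LBINT x. e' * indicator ?B x)"
      by (intro integral_mono i1 iB gv)
    also have "\<dots> = e' * m" by (simp add: m_def)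
    also have "\<dots> < e / 2" using e m by (simp add: e'_def field_simps add_pos_nonneg)
    finally have 1: "(LBINT x. \<bar>g (x + v) - g x\<bar>) < e / 2" .
    have 2: "(LBINT x. \<bar>f (x + v) - g (x + v)\<bar>) < e / 4"
      using fg integral_translate[of "\<lambda>x. \<bar>f x - g x\<bar>" v] by simp
    have "(LBINT x. \<bar>f (x + v) - f x\<bar>) \<le>
      (LBINT x. \<bar>f (x + v) - g (x + v)\<bar> + \<bar>g (x + v) - g x\<bar> + \<bar>f x - g x\<bar>)"
      by (intro integral_mono i1 i2 i3 i4 Bochner_Integration.integrable_add) auto
    also have "\<dots> = (LBINT x. \<bar>f (x + v) - g (x + v)\<bar>) + (LBINT x. \<bar>g (x + v) - g x\<bar>)
        + (LBINT x. \<bar>f x - g x\<bar>)"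
      by (simp only: Bochner_Integration.integral_add i1 i2 i3 Bochner_Integration.integrable_add)
    finally show "(LBINT x. \<bar>f (x + v) - f x\<bar>) < e" using 1 2 fg by linarith
  qed
qed

section \<open>Bounded functions with bounded support\<close>

definition bmeas :: "('a::euclidean_space \<Rightarrow> real) \<Rightarrow> bool" where
  "bmeas f \<longleftrightarrow> f \<in> borel_measurable borel \<and> (\<exists>C. \<forall>x. \<bar>f x\<bar> \<le> C)"

text \<open>
  All integrands of the interaction estimate are of this kind. The class is stable under multiplication
  by bounded measurable functions and under tensor products, so integrability and the use of Fubini's
  theorem reduce to syntactic closure properties.
\<close>

definition tame :: "('a::euclidean_space \<Rightarrow> real) \<Rightarrow> bool" where
  "tame f \<longleftrightarrow> bmeas f \<and> (\<exists>r. \<forall>x. f x \<noteq> 0 \<longrightarrow> norm x \<le> r)"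

lemma bmeasI: "f \<in> borel_measurable borel \<Longrightarrow> (\<And>x. \<bar>f x\<bar> \<le> C) \<Longrightarrow> bmeas f"
  unfolding bmeas_def by blast

lemma bmeas_measurable: "bmeas f \<Longrightarrow> f \<in> borel_measurable borel"
  by (simp add: bmeas_def)

lemma bmeasE:
  assumes "bmeas f"
  obtains C where "0 \<le> C" "\<And>x. \<bar>f x\<bar> \<le> C"
proof -
  from assms obtain C where C: "\<And>x. \<bar>f x\<bar> \<le> C" unfolding bmeas_def by blast
  with that[of C] C[of undefined] show thesis by force
qed

lemma tameI: "bmeas f \<Longrightarrow> (\<And>x. f x \<noteq> 0 \<Longrightarrow> norm x \<le> r) \<Longrightarrow> tame f"
  unfolding tame_def by blast

lemma tame_bmeas: "tame f \<Longrightarrow> bmeas f"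
  by (simp add: tame_def)

lemma tame_measurable: "tame f \<Longrightarrow> f \<in> borel_measurable borel"
  by (simp add: tame_bmeas bmeas_measurable)

lemma tame_supportE:
  assumes "tame f"
  obtains r where "\<And>x. r < norm x \<Longrightarrow> f x = 0"
proof -
  from assms obtain r where "\<And>x. f x \<noteq> 0 \<Longrightarrow> norm x \<le> r" unfolding tame_def by blast
  with that[of r] show thesis by force
qed

lemma tame_integrable:
  assumes "tame f" shows "integrable lborel f"
proof -
  obtain C where C: "\<And>x. \<bar>f x\<bar> \<le> C" using bmeasE[OF tame_bmeas[OF assms]] by metis
  obtain r where r: "\<And>x. r < norm x \<Longrightarrow> f x = 0" using tame_supportE[OF assms] by metis
  show ?thesis
    by (rule integrable_bounded_support[OF tame_measurable[OF assms] C, of "cball 0 r"])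
      (simp_all add: r)
qed

lemma bmeas_add: "bmeas f \<Longrightarrow> bmeas g \<Longrightarrow> bmeas (\<lambda>x. f x + g x)"
proof -
  assume fg: "bmeas f" "bmeas g"
  obtain C where C: "\<And>x. \<bar>f x\<bar> \<le> C" using bmeasE[OF fg(1)] by metis
  obtain D where D: "\<And>x. \<bar>g x\<bar> \<le> D" using bmeasE[OF fg(2)] by metis
  have "\<bar>f x + g x\<bar> \<le> C + D" for x using C[of x] D[of x] by linarith
  with fg show ?thesis by (intro bmeasI[where C="C + D"]) (auto simp: bmeas_def)
qed

lemma bmeas_mult: "bmeas f \<Longrightarrow> bmeas g \<Longrightarrow> bmeas (\<lambda>x. f x * g x)"
proof -
  assume fg: "bmeas f" "bmeas g"
  obtain C where C: "0 \<le> C" "\<And>x. \<bar>f x\<bar> \<le> C" using bmeasE[OF fg(1)] by metis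
  obtain D where D: "\<And>x. \<bar>g x\<bar> \<le> D" using bmeasE[OF fg(2)] by metis
  have "\<bar>f x * g x\<bar> \<le> C * D" for x
    unfolding abs_mult using C D by (intro mult_mono) auto
  with fg show ?thesis by (intro bmeasI[where C="C * D"]) (auto simp: bmeas_def)
qed

lemma bmeas_const: "bmeas (\<lambda>x. c)"
  by (rule bmeasI[of _ "\<bar>c\<bar>"]) simp_all

lemma bmeas_abs: "bmeas f \<Longrightarrow> bmeas (\<lambda>x. \<bar>f x\<bar>)"
  unfolding bmeas_def by auto

lemma bmeas_compose:
  assumes "bmeas f" and "g \<in> borel_measurable borel"
  shows "bmeas (\<lambda>x. f (g x))"
proof -
  obtain C where "\<And>x. \<bar>f x\<bar> \<le> C" using bmeasE[OF assms(1)] by metis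
  then show ?thesis
    by (intro bmeasI[where C=C] measurable_compose[OF assms(2) bmeas_measurable[OF assms(1)]])
qed

lemma tame_mult:
  assumes "tame f" and "bmeas g"
  shows "tame (\<lambda>x. f x * g x)"
proof -
  obtain r where r: "\<And>x. r < norm x \<Longrightarrow> f x = 0" using tame_supportE[OF assms(1)] by metis
  show ?thesis
  proof (rule tameI[where r=r])
    show "bmeas (\<lambda>x. f x * g x)" by (intro bmeas_mult tame_bmeas assms)
    fix x assume "f x * g x \<noteq> 0"
    then show "norm x \<le> r" using r[of x] by fastforce
  qed
qed

lemma tame_mult': "bmeas g \<Longrightarrow> tame f \<Longrightarrow> tame (\<lambda>x. g x * f x)"
  using tame_mult[of f g] by (simp add: mult.commute)

lemma tame_add:
  assumes "tame f" and "tame g"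
  shows "tame (\<lambda>x. f x + g x)"
proof -
  obtain r where r: "\<And>x. r < norm x \<Longrightarrow> f x = 0" using tame_supportE[OF assms(1)] by metis
  obtain r' where r': "\<And>x. r' < norm x \<Longrightarrow> g x = 0" using tame_supportE[OF assms(2)] by metis
  show ?thesis
  proof (rule tameI[where r="max r r'"])
    fix x assume "f x + g x \<noteq> 0"
    then show "norm x \<le> max r r'" using r[of x] r'[of x] by fastforce
  qed (intro bmeas_add tame_bmeas assms)
qed

lemma tame_minus: "tame f \<Longrightarrow> tame (\<lambda>x. - f x)"
  using tame_mult[OF _ bmeas_const[of "-1"], of f] by simp

lemma tame_diff: "tame f \<Longrightarrow> tame g \<Longrightarrow> tame (\<lambda>x. f x - g x)"
  using tame_add[OF _ tame_minus, of f g] by simp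

lemma tame_abs: "tame f \<Longrightarrow> tame (\<lambda>x. \<bar>f x\<bar>)"
  unfolding tame_def by (auto intro: bmeas_abs)

lemma tame_continuous:
  fixes f :: "'a::euclidean_space \<Rightarrow> real"
  assumes "continuous_on UNIV f" and "compact K" and "\<And>x. x \<notin> K \<Longrightarrow> f x = 0"
  shows "tame f"
proof -
  have "bounded (f ` K)"
    using assms(1,2) by (intro compact_imp_bounded compact_continuous_image)
      (auto intro: continuous_on_subset)
  then obtain C where C: "\<And>x. x \<in> K \<Longrightarrow> \<bar>f x\<bar> \<le> C"
    by (auto simp: bounded_iff)
  have C': "\<bar>f x\<bar> \<le> max C 0" for x
    using C[of x] assms(3)[of x] by (cases "x \<in> K") auto
  obtain r where "\<And>x. x \<in> K \<Longrightarrow> norm x \<le> r"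
    using compact_imp_bounded[OF assms(2)] by (auto simp: bounded_iff)
  with assms(3) have r: "f x \<noteq> 0 \<Longrightarrow> norm x \<le> r" for x by blast
  show ?thesis
    by (rule tameI[OF bmeasI[OF _ C'] r]) (use assms(1) in \<open>auto intro: borel_measurable_continuous_onI\<close>)
qed

lemma tame_tensor:
  fixes f :: "'a::euclidean_space \<Rightarrow> real" and g :: "'b::euclidean_space \<Rightarrow> real"
  assumes "tame f" and "tame g"
  shows "tame (\<lambda>z. f (fst z) * g (snd z))"
proof -
  obtain r where r: "\<And>x. r < norm x \<Longrightarrow> f x = 0" using tame_supportE[OF assms(1)] by metis
  obtain r' where r': "\<And>x. r' < norm x \<Longrightarrow> g x = 0" using tame_supportE[OF assms(2)] by metis
  show ?thesis
  proof (rule tameI[where r="r + r'"])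
    have m: "(fst :: 'a \<times> 'b \<Rightarrow> 'a) \<in> borel_measurable borel" "(snd :: 'a \<times> 'b \<Rightarrow> 'b) \<in> borel_measurable borel"
      by (auto intro!: borel_measurable_continuous_onI continuous_intros)
    show "bmeas (\<lambda>z. f (fst z) * g (snd z))"
      by (intro bmeas_mult bmeas_compose[OF tame_bmeas[OF assms(1)] m(1)]
          bmeas_compose[OF tame_bmeas[OF assms(2)] m(2)])
    fix z :: "'a \<times> 'b" assume "f (fst z) * g (snd z) \<noteq> 0"
    then have "norm (fst z) \<le> r" "norm (snd z) \<le> r'"
      using r[of "fst z"] r'[of "snd z"] by fastforce+
    moreover have "norm z \<le> norm (fst z) + norm (snd z)"
      using norm_Pair_le[where x="fst z" and y="snd z"] by simp
    ultimately show "norm z \<le> r + r'" by linarith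
  qed
qed

lemma Fubini_tame:
  fixes F :: "'a::euclidean_space \<times> 'b::euclidean_space \<Rightarrow> real"
  assumes "tame F"
  shows "(LBINT x. (LBINT y. F (x, y))) = (LBINT z. F z)"
    and "(LBINT y. (LBINT x. F (x, y))) = (LBINT z. F z)"
proof -
  have P: "pair_sigma_finite (lborel :: 'a measure) (lborel :: 'b measure)"
    by unfold_locales
  have int: "integrable (lborel \<Otimes>\<^sub>M lborel) F"
    using tame_integrable[OF assms] by (simp add: lborel_prod)
  have int': "integrable (lborel \<Otimes>\<^sub>M lborel) (\<lambda>(x, y). F (x, y))"
    using int by simp
  show "(LBINT x. (LBINT y. F (x, y))) = (LBINT z. F z)"
    using pair_sigma_finite.integral_fst[OF P int'] by (simp add: lborel_prod)
  show "(LBINT y. (LBINT x. F (x, y))) = (LBINT z. F z)"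
    using pair_sigma_finite.integral_snd[OF P int'] by (simp add: lborel_prod)
qed

lemma tame_section:
  fixes F :: "'a::euclidean_space \<times> 'b::euclidean_space \<Rightarrow> real"
  assumes "tame F"
  shows "tame (\<lambda>y. F (x, y))" and "tame (\<lambda>x. F (x, y))"
proof -
  obtain r where r: "\<And>x. r < norm x \<Longrightarrow> F x = 0" using tame_supportE[OF assms] by metis
  have m: "(\<lambda>y. (x, y)) \<in> borel_measurable borel" "(\<lambda>x. (x, y)) \<in> borel_measurable borel"
    for x :: 'a and y :: 'b
    by (auto intro!: borel_measurable_continuous_onI continuous_intros)
  show "tame (\<lambda>y. F (x, y))"
  proof (rule tameI[where r=r])
    fix y assume "F (x, y) \<noteq> 0"
    then have "norm (x, y) \<le> r" using r[of "(x,y)"] by fastforce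
    then show "norm y \<le> r" using norm_snd_le[of y x] by simp
  qed (rule bmeas_compose[OF tame_bmeas[OF assms] m(1)])
  show "tame (\<lambda>x. F (x, y))"
  proof (rule tameI[where r=r])
    fix x assume "F (x, y) \<noteq> 0"
    then have "norm (x, y) \<le> r" using r[of "(x,y)"] by fastforce
    then show "norm x \<le> r" using norm_fst_le[of x y] by simp
  qed (rule bmeas_compose[OF tame_bmeas[OF assms] m(2)])
qed

section \<open>The interaction estimate\<close>

definition dbump :: "real \<Rightarrow> real" where
  "dbump x = (flat_exp 2 x * flat_exp 0 (1 - x) - flat_exp 0 x * flat_exp 2 (1 - x)) / bump_mass"

lemma bump_deriv: "(bump has_real_derivative dbump x) (at x)"
proof -
  have d0: "(flat_exp 0 has_real_derivative flat_exp 2 x) (at x)" for x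
    using flat_exp_deriv[of 0 x] by (simp add: numeral_2_eq_2)
  show ?thesis
    unfolding bump_def[abs_def] dbump_def using bump_mass_pos
    by (auto intro!: derivative_eq_intros DERIV_chain'[OF _ d0] d0 simp: field_simps)
qed

lemma bmeas_dbump: "bmeas dbump"
proof (rule tame_bmeas[OF tame_continuous[where K="{0..1}"]])
  show "continuous_on UNIV dbump"
    unfolding dbump_def using bump_mass_pos
    by (auto intro!: continuous_intros continuous_on_flat_exp
        continuous_on_compose2[OF continuous_on_flat_exp[of UNIV]])
qed (auto simp: dbump_def flat_exp_def)

lemma bmeas_bump: "bmeas bump"
  using bump_nonneg bump_le by (intro bmeasI[where C=bump_max]) auto

lemma bmeas_step: "bmeas step"
  using step_nonneg step_le_1 by (intro bmeasI[where C=1]) auto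

text \<open>
  The distributional inequality \<open>\<eta>\<^sub>t + q\<^sub>x \<le> 0\<close> for a nonnegative
  density, written as an integral over the plane; \<open>a\<close> and \<open>b\<close> are the partial
  derivatives of the test function.
\<close>

definition weak_subsolution :: "(real \<times> real \<Rightarrow> real) \<Rightarrow> (real \<times> real \<Rightarrow> real) \<Rightarrow> bool" where
  "weak_subsolution \<eta> q \<longleftrightarrow> bmeas \<eta> \<and> bmeas q \<and> (\<forall>z. 0 \<le> \<eta> z) \<and>
    (\<forall>\<phi>\<in>test_functions. \<forall>a b. (\<forall>z. 0 \<le> \<phi> z) \<longrightarrow>
      (\<forall>z. (\<phi> has_derivative (\<lambda>v. a z * fst v + b z * snd v)) (at z)) \<longrightarrow>
      0 \<le> (LBINT z. \<eta> z * a z + q z * b z))"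

locale cutoff =
  fixes \<zeta> \<zeta>t \<zeta>x :: "real \<times> real \<Rightarrow> real" and K :: "(real \<times> real) set"
  assumes smooth: "C_upto k \<zeta>"
    and compact_K: "compact K" and K_spacetime: "K \<subseteq> spacetime"
    and nonneg: "0 \<le> \<zeta> z"
    and outside: "z \<notin> K \<Longrightarrow> \<zeta> z = 0" "z \<notin> K \<Longrightarrow> \<zeta>t z = 0" "z \<notin> K \<Longrightarrow> \<zeta>x z = 0"
    and deriv: "(\<zeta> has_derivative (\<lambda>v. \<zeta>t z * fst v + \<zeta>x z * snd v)) (at z)"
    and cont: "continuous_on UNIV \<zeta>t" "continuous_on UNIV \<zeta>x"
begin

lemma tame_cutoff: "tame \<zeta>" "tame \<zeta>t" "tame \<zeta>x"
  using smooth[of 0] cont outside compact_K by (auto intro!: tame_continuous[where K=K])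

text \<open>
  What the cut-off costs: the derivative of \<open>\<zeta>\<close> along \<open>(\<eta>, q)\<close>, supported where \<open>\<zeta>\<close> is not constant.
\<close>

definition loss :: "(real \<times> real \<Rightarrow> real) \<Rightarrow> (real \<times> real \<Rightarrow> real) \<Rightarrow> real \<times> real \<Rightarrow> real" where
  "loss \<eta> q z = \<zeta>t z * \<eta> z + \<zeta>x z * q z"

lemma tame_loss: "bmeas \<eta> \<Longrightarrow> bmeas q \<Longrightarrow> tame (loss \<eta> q)"
  unfolding loss_def[abs_def] by (intro tame_add tame_mult tame_cutoff)

text \<open>
  The product rule for the test function \<open>\<psi> \<zeta>\<close>: multiplication of
  \<open>(\<eta>, q)\<close> by the cut-off \<open>\<zeta>\<close> leaves a subsolution up to the term
  \<open>loss\<close>; the compact support is provided by \<open>\<zeta>\<close>.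
\<close>

lemma subsolution_product_test:
  assumes sub: "weak_subsolution \<eta> q"
    and psi: "\<And>k. C_upto k \<psi>" "\<And>z. 0 \<le> \<psi> z"
      "\<And>z. (\<psi> has_derivative (\<lambda>v. a z * fst v + b z * snd v)) (at z)"
  shows "0 \<le> (LBINT z. a z * (\<zeta> z * \<eta> z) + \<psi> z * loss \<eta> q z + b z * (\<zeta> z * q z))"
proof -
  have "(\<lambda>z. \<psi> z * \<zeta> z) \<in> test_functions"
    unfolding test_functions_def using compact_K K_spacetime outside(1)
    by (auto intro!: C_upto_mult psi smooth exI[of _ K])
  moreover have "\<forall>z. 0 \<le> \<psi> z * \<zeta> z" using psi(2) nonneg by simp
  moreover have "((\<lambda>z. \<psi> z * \<zeta> z) has_derivative
      (\<lambda>v. (\<psi> z * \<zeta>t z + a z * \<zeta> z) * fst v + (\<psi> z * \<zeta>x z + b z * \<zeta> z) * snd v)) (at z)" for z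
    by (rule has_derivative_mult_partials[OF psi(3) deriv])
  ultimately have "0 \<le> (LBINT z. \<eta> z * (\<psi> z * \<zeta>t z + a z * \<zeta> z) + q z * (\<psi> z * \<zeta>x z + b z * \<zeta> z))"
    using sub unfolding weak_subsolution_def by fast
  then show ?thesis
    by (simp add: loss_def algebra_simps)
qed

text \<open>
  Mass at one time, averaged over a short time interval, cannot exceed what enters through the cut-off:
  the test function is a step in time that drops from \<open>1\<close> to \<open>0\<close> in that
  interval, with slope \<open>- bump / e\<close>.
\<close>

lemma mass_bound:
  assumes sub: "weak_subsolution \<eta> q" and e: "e > 0"
  shows "(LBINT z. bump (c - fst z / e) * (\<zeta> z * \<eta> z)) \<le> e * (LBINT z. \<bar>loss \<eta> q z\<bar>)"
proof -
  have bm: "bmeas \<eta>" "bmeas q" using sub by (simp_all add: weak_subsolution_def)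
  define A where "A z = (- 1 / e) * fst z + 0 * snd z + c" for z :: "real \<times> real"
  have A: "A z = c - fst z / e" for z by (simp add: A_def)
  have mA: "A \<in> borel_measurable borel"
    unfolding A_def by (intro borel_measurable_continuous_onI continuous_intros)
  have "0 \<le> (LBINT z. ((- 1 / e) * bump (A z)) * (\<zeta> z * \<eta> z) + step (A z) * loss \<eta> q z
      + (0 * bump (A z)) * (\<zeta> z * q z))"
    unfolding A_def
    by (rule subsolution_product_test[OF sub C_upto_step_affine step_nonneg has_derivative_compose_affine[OF step_deriv]])
  also have "\<dots> = (LBINT z. step (A z) * loss \<eta> q z - bump (A z) * (\<zeta> z * \<eta> z) / e)"
    by (simp add: algebra_simps)
  also have "\<dots> = (LBINT z. step (A z) * loss \<eta> q z) - (LBINT z. bump (A z) * (\<zeta> z * \<eta> z)) / e"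
  proof -
    have "tame (\<lambda>z. step (A z) * loss \<eta> q z)" "tame (\<lambda>z. bump (A z) * (\<zeta> z * \<eta> z))"
      by (intro tame_mult' tame_mult tame_loss tame_cutoff bm bmeas_compose[OF bmeas_step mA]
          bmeas_compose[OF bmeas_bump mA])+
    then show ?thesis by (simp add: tame_integrable)
  qed
  finally have "(LBINT z. bump (A z) * (\<zeta> z * \<eta> z)) / e \<le> (LBINT z. step (A z) * loss \<eta> q z)"
    by simp
  also have "\<dots> \<le> (LBINT z. \<bar>loss \<eta> q z\<bar>)"
  proof (rule integral_mono)
    show "integrable lborel (\<lambda>z. step (A z) * loss \<eta> q z)"
      by (intro tame_integrable tame_mult' tame_loss bm bmeas_compose[OF bmeas_step mA])
    show "integrable lborel (\<lambda>z. \<bar>loss \<eta> q z\<bar>)"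
      by (intro tame_integrable tame_abs tame_loss bm)
    fix z
    have "step (A z) * loss \<eta> q z \<le> step (A z) * \<bar>loss \<eta> q z\<bar>"
      by (intro mult_left_mono step_nonneg) simp
    also have "\<dots> \<le> 1 * \<bar>loss \<eta> q z\<bar>"
      by (intro mult_right_mono step_le_1) simp
    finally show "step (A z) * loss \<eta> q z \<le> \<bar>loss \<eta> q z\<bar>" by simp
  qed
  finally show ?thesis using e by (simp add: A field_simps)
qed

end

subsection \<open>Approximate identity\<close>

text \<open>
  Supported at negative times and positive positions: the interaction estimate compares the second point
  with the first one, slightly earlier in time and to the right of it.
\<close>

definition kernel :: "real \<Rightarrow> real \<times> real \<Rightarrow> real" where
  "kernel e v = (bump (- (fst v / e)) / e) * (bump (snd v / e) / e)"

lemma bump_scaled: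
  assumes "e > 0"
  shows "tame (\<lambda>x. bump (x / e) / e)" "(LBINT x. bump (x / e) / e) = 1"
    and "tame (\<lambda>x. bump (- (x / e)) / e)" "(LBINT x. bump (- (x / e)) / e) = 1"
proof -
  have z: "bump (x / e) / e = 0" "bump (- (x / e)) / e = 0" if "x \<notin> {-e..e}" for x
    using that assms bump_eq_0[of "x/e"] bump_eq_0[of "-(x/e)"] by (auto simp: field_simps)
  show "tame (\<lambda>x. bump (x / e) / e)"
    by (rule tame_continuous[where K="{-e..e}", OF _ _ z(1)])
      (use assms in \<open>auto intro!: continuous_intros continuous_on_compose2[OF continuous_on_bump[of UNIV]]\<close>)
  show "tame (\<lambda>x. bump (- (x / e)) / e)"
    by (rule tame_continuous[where K="{-e..e}", OF _ _ z(2)])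
      (use assms in \<open>auto intro!: continuous_intros continuous_on_compose2[OF continuous_on_bump[of UNIV]]\<close>)
  have "(LBINT x. bump x) = 1"
    using bump_has_integral by (simp add: has_bochner_integral_iff)
  moreover have "(LBINT x. bump x) = \<bar>1/e\<bar> *\<^sub>R (LBINT x. bump (0 + (1/e) * x))"
    by (rule lborel_integral_real_affine) (use assms in simp)
  moreover have "(LBINT x. bump x) = \<bar>-1/e\<bar> *\<^sub>R (LBINT x. bump (0 + (-1/e) * x))"
    by (rule lborel_integral_real_affine) (use assms in simp)
  ultimately show "(LBINT x. bump (x / e) / e) = 1" "(LBINT x. bump (- (x / e)) / e) = 1"
    using assms by simp_all
qed

lemma
  assumes "e > 0"
  shows tame_kernel: "tame (kernel e)" and integral_kernel: "(LBINT v. kernel e v) = 1"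
    and kernel_nonneg: "0 \<le> kernel e v" and kernel_support: "kernel e v \<noteq> 0 \<Longrightarrow> norm v < 2 * e"
proof -
  show t: "tame (kernel e)"
    unfolding kernel_def[abs_def] by (rule tame_tensor[OF bump_scaled(3,1)[OF assms]])
  have "(LBINT v. kernel e v) = (LBINT x. LBINT y. kernel e (x, y))"
    by (rule Fubini_tame(1)[OF t, symmetric])
  also have "\<dots> = (LBINT x. (bump (- (x / e)) / e) * (LBINT y. bump (y / e) / e))"
    unfolding kernel_def fst_conv snd_conv by (subst integral_mult_right_zero) simp
  also have "\<dots> = 1"
    by (simp only: bump_scaled(2,4)[OF assms] mult_1_right)
  finally show "(LBINT v. kernel e v) = 1" .
  show "0 \<le> kernel e v"
    using assms by (simp add: kernel_def bump_nonneg)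
  assume "kernel e v \<noteq> 0"
  then have "bump (- (fst v / e)) \<noteq> 0" "bump (snd v / e) \<noteq> 0" by (auto simp: kernel_def)
  then have "0 < - (fst v / e)" "- (fst v / e) < 1" "0 < snd v / e" "snd v / e < 1"
    using bump_eq_0 not_le by blast+
  then have "\<bar>fst v\<bar> < e" "\<bar>snd v\<bar> < e"
    using assms by (auto simp: field_simps zero_less_mult_iff mult_less_0_iff)
  moreover have "norm v \<le> \<bar>fst v\<bar> + \<bar>snd v\<bar>"
    using norm_Pair_le[of "fst v" "snd v"] by simp
  ultimately show "norm v < 2 * e" by linarith
qed

lemma borel_measurable_plus_pair:
  "(\<lambda>z::('a::euclidean_space) \<times> 'a. fst z + snd z) \<in> borel_measurable borel"
  "(\<lambda>z::('a::euclidean_space) \<times> 'a. snd z - fst z) \<in> borel_measurable borel"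
  "(fst :: 'a \<times> 'a \<Rightarrow> 'a) \<in> borel_measurable borel"
  "(snd :: 'a \<times> 'a \<Rightarrow> 'a) \<in> borel_measurable borel"
  by (auto intro!: borel_measurable_continuous_onI continuous_intros)

text \<open>
  After the substitution \<open>z' = z + v\<close> the error is an average over small
  \<open>v\<close> of the \<open>L\<^sup>1\<close> distance between \<open>N\<close> and its translate
  by \<open>v\<close>.
\<close>

lemma kernel_limit:
  fixes Q N :: "real \<times> real \<Rightarrow> real"
  assumes Q: "tame Q" and N: "tame N" and r: "r > 0"
  obtains d where "d > 0"
    "\<And>e. 0 < e \<Longrightarrow> e < d \<Longrightarrow>
      \<bar>(LBINT p. kernel e (snd p - fst p) * (Q (fst p) * N (snd p))) - (LBINT z. Q z * N z)\<bar> \<le> r"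
proof -
  obtain C where C: "0 \<le> C" "\<And>x. \<bar>Q x\<bar> \<le> C" using bmeasE[OF tame_bmeas[OF Q]] by metis
  obtain CN where CN: "\<And>x. \<bar>N x\<bar> \<le> CN" using bmeasE[OF tame_bmeas[OF N]] by metis
  obtain R where R: "\<And>x. R < norm x \<Longrightarrow> N x = 0" using tame_supportE[OF N] by metis
  have r': "r / (C + 1) > 0" using r C by simp
  have RK: "x \<notin> cball 0 R \<Longrightarrow> N x = 0" for x using R[of x] by simp
  obtain d where d: "d > 0" "\<And>v. norm v < d \<Longrightarrow> (LBINT x. \<bar>N (x + v) - N x\<bar>) < r / (C + 1)"
    using translation_continuous_L1[OF tame_measurable[OF N] CN bounded_cball RK r'] by metis
  show thesis
  proof (rule that[of "d / 2"])
    show "d / 2 > 0" using d by simp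
    fix e :: real assume e: "0 < e" "e < d / 2"
    note m = borel_measurable_plus_pair[where 'a="real \<times> real"]
    have bk: "bmeas (kernel e)" by (rule tame_bmeas[OF tame_kernel[OF e(1)]])
    have bN: "bmeas N" by (rule tame_bmeas[OF N])
    let ?P = "\<lambda>p. kernel e (snd p - fst p) * (Q (fst p) * N (snd p))"
    have tP: "tame ?P"
      by (intro tame_mult' tame_tensor Q N bmeas_compose[OF bk m(2)])
    let ?G = "\<lambda>p. (Q (fst p) * kernel e (snd p)) * N (fst p + snd p)"
    let ?H = "\<lambda>p. (Q (fst p) * kernel e (snd p)) * N (fst p)"
    have tG: "tame ?G"
      by (intro tame_mult tame_tensor Q tame_kernel e bmeas_compose[OF bN m(1)])
    have tH: "tame ?H"
      by (intro tame_mult tame_tensor Q tame_kernel e bmeas_compose[OF bN m(3)])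
    have "(LBINT p. ?P p) = (LBINT z. LBINT z'. ?P (z, z'))"
      by (rule Fubini_tame(1)[OF tP, symmetric])
    also have "\<dots> = (LBINT z. LBINT v. ?G (z, v))"
    proof (rule Bochner_Integration.integral_cong[OF refl])
      fix z :: "real \<times> real"
      have "(LBINT z'. ?P (z, z')) = (LBINT v. ?P (z, v + z))"
        by (rule integral_translate[symmetric])
          (rule tame_measurable[OF tame_section(1)[OF tP]])
      then show "(LBINT z'. ?P (z, z')) = (LBINT v. ?G (z, v))"
        by (simp add: algebra_simps)
    qed
    also have "\<dots> = (LBINT p. ?G p)"
      by (rule Fubini_tame(1)[OF tG])
    finally have 1: "(LBINT p. ?P p) = (LBINT p. ?G p)" .
    have "(LBINT p. ?H p) = (LBINT z. LBINT v. ?H (z, v))"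
      by (rule Fubini_tame(1)[OF tH, symmetric])
    also have "\<dots> = (LBINT z. LBINT v. (Q z * N z) * kernel e v)"
      by (simp add: algebra_simps)
    also have "\<dots> = (LBINT z. Q z * N z)"
      by (simp add: integral_kernel[OF e(1)])
    finally have 2: "(LBINT p. ?H p) = (LBINT z. Q z * N z)" .
    let ?D = "\<lambda>p. \<bar>?G p - ?H p\<bar>"
    have tD: "tame ?D" by (intro tame_abs tame_diff tG tH)
    have "\<bar>(LBINT p. ?P p) - (LBINT z. Q z * N z)\<bar> = \<bar>LBINT p. ?G p - ?H p\<bar>"
      unfolding 1 2[symmetric] by (simp add: tame_integrable[OF tG] tame_integrable[OF tH])
    also have "\<dots> \<le> (LBINT p. ?D p)"
      by (rule integral_abs_bound)
    also have "\<dots> = (LBINT v. LBINT z. ?D (z, v))"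
      by (rule Fubini_tame(2)[OF tD, symmetric])
    also have "\<dots> \<le> (LBINT v. kernel e v * r)"
    proof (rule integral_mono')
      show "integrable lborel (\<lambda>v. kernel e v * r)"
        by (intro integrable_mult_left tame_integrable tame_kernel e)
      fix v :: "real \<times> real"
      show "0 \<le> kernel e v * r" using kernel_nonneg[OF e(1)] r by simp
      show "(LBINT z. ?D (z, v)) \<le> kernel e v * r"
      proof (cases "kernel e v = 0")
        case False
        then have "norm v < d" using kernel_support[OF e(1)] e by fastforce
        note dv = d(2)[OF this]
        have mv: "(\<lambda>z. z + v) \<in> borel_measurable borel" by simp
        have tN: "tame (\<lambda>z. \<bar>N (z + v) - N z\<bar>)"
        proof (intro tame_abs tame_diff N tameI[where r="R + norm v"] bmeas_compose[OF bN mv])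
          fix x assume "N (x + v) \<noteq> 0"
          then have "norm (x + v) \<le> R" using R[of "x + v"] by fastforce
          then show "norm x \<le> R + norm v" using norm_triangle_ineq4[of "x + v" v] by simp
        qed
        have "(LBINT z. ?D (z, v)) \<le> (LBINT z. kernel e v * (C * \<bar>N (z + v) - N z\<bar>))"
        proof (rule integral_mono[OF tame_integrable[OF tame_section(2)[OF tD]]])
          show "integrable lborel (\<lambda>z. kernel e v * (C * \<bar>N (z + v) - N z\<bar>))"
            by (intro integrable_mult_right tame_integrable tN)
          fix z :: "real \<times> real"
          have "?D (z, v) = \<bar>Q z\<bar> * (kernel e v * \<bar>N (z + v) - N z\<bar>)"
            using kernel_nonneg[OF e(1), of v] by (simp add: right_diff_distrib[symmetric] abs_mult)
          also have "\<dots> \<le> C * (kernel e v * \<bar>N (z + v) - N z\<bar>)"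
            using kernel_nonneg[OF e(1), of v] by (intro mult_right_mono C) simp
          finally show "?D (z, v) \<le> kernel e v * (C * \<bar>N (z + v) - N z\<bar>)"
            by (simp add: algebra_simps)
        qed
        also have "\<dots> = kernel e v * (C * (LBINT z. \<bar>N (z + v) - N z\<bar>))" by simp
        also have "\<dots> \<le> kernel e v * (C * (r / (C + 1)))"
          using kernel_nonneg[OF e(1), of v] C dv by (intro mult_left_mono) auto
        also have "\<dots> \<le> kernel e v * r"
          using kernel_nonneg[OF e(1), of v] C r by (intro mult_left_mono) (auto simp: field_simps)
        finally show ?thesis .
      qed simp
    qed
    also have "\<dots> = r" by (simp add: integral_kernel[OF e(1)])
    finally show "\<bar>(LBINT p. ?P p) - (LBINT z. Q z * N z)\<bar> \<le> r" .
  qed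
qed

text \<open>
  The test function is a bump in time multiplied by a step in space; the speeds \<open>p\<close> and
  \<open>r\<close> appear as weights of the derivative terms.
\<close>

lemma (in cutoff) moving_window_test:
  assumes sub: "weak_subsolution \<eta> q" and A: "\<And>z. A z = p * fst z + p'" and B: "\<And>z. B z = r * snd z + r'"
  shows "0 \<le> (LBINT z. p * (dbump (A z) * step (B z)) * (\<zeta> z * \<eta> z) + bump (A z) * step (B z) * loss \<eta> q z
    + r * (bump (A z) * bump (B z)) * (\<zeta> z * q z))"
proof -
  define a where "a z = p * fst z + 0 * snd z + p'" for z :: "real \<times> real"
  define b where "b z = 0 * fst z + r * snd z + r'" for z :: "real \<times> real"
  have "0 \<le> (LBINT z. (bump (a z) * (0 * bump (b z)) + (p * dbump (a z)) * step (b z)) * (\<zeta> z * \<eta> z)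
      + (bump (a z) * step (b z)) * loss \<eta> q z
      + (bump (a z) * (r * bump (b z)) + (0 * dbump (a z)) * step (b z)) * (\<zeta> z * q z))"
  proof (rule subsolution_product_test[OF sub])
    show "C_upto k (\<lambda>z. bump (a z) * step (b z))" for k
      unfolding a_def b_def by (intro C_upto_mult C_upto_bump_affine C_upto_step_affine)
    show "0 \<le> bump (a z) * step (b z)" for z
      by (simp add: bump_nonneg step_nonneg)
    show "((\<lambda>z. bump (a z) * step (b z)) has_derivative
      (\<lambda>v. (bump (a z) * (0 * bump (b z)) + (p * dbump (a z)) * step (b z)) * fst v
       + (bump (a z) * (r * bump (b z)) + (0 * dbump (a z)) * step (b z)) * snd v)) (at z)" for z
      unfolding a_def b_def
      by (rule has_derivative_mult_partials[OF has_derivative_compose_affine[OF bump_deriv]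
            has_derivative_compose_affine[OF step_deriv]])
  qed
  moreover have "a z = A z" "b z = B z" for z by (simp_all add: a_def b_def A B)
  ultimately show ?thesis by (simp add: mult_ac)
qed

text \<open>
  The formal argument differentiates
  \<open>\<integral>\<integral> \<eta>1(t, x) \<eta>2(t, y) dx dy\<close> over
  \<open>x < y\<close> in time; on the diagonal the fluxes leave
  \<open>\<integral> (q1 \<eta>2 - \<eta>1 q2) dx\<close>. The densities are merely bounded and
  measurable, so the variables are doubled: the weight
  \<open>bump ((t - s) / e) * step ((y - x) / e)\<close> is used as a test function in
  \<open>(t, x)\<close> for fixed \<open>(s, y)\<close> and vice versa. In the sum of the two
  inequalities the derivatives of the bump cancel, those of the step concentrate on the diagonal as
  \<open>e\<close> tends to \<open>0\<close>, and the terms in which a cut-off is differentiated are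
  bounded by \<open>mass_bound\<close>.
\<close>

theorem (in cutoff) interaction_estimate:
  assumes 1: "weak_subsolution \<eta>1 q1" and 2: "weak_subsolution \<eta>2 q2"
  shows "(LBINT z. (\<zeta> z)\<^sup>2 * (q1 z * \<eta>2 z - \<eta>1 z * q2 z))
     \<le> 2 * (LBINT z. \<bar>loss \<eta>1 q1 z\<bar>) * (LBINT z. \<bar>loss \<eta>2 q2 z\<bar>)"
proof -
  have bm: "bmeas \<eta>1" "bmeas q1" "bmeas \<eta>2" "bmeas q2"
    using 1 2 by (simp_all add: weak_subsolution_def)
  have nn: "0 \<le> \<eta>1 z" "0 \<le> \<eta>2 z" for z
    using 1 2 unfolding weak_subsolution_def by blast+
  define N1 where "N1 z = \<zeta> z * \<eta>1 z" for z
  define N2 where "N2 z = \<zeta> z * \<eta>2 z" for z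
  define Q1 where "Q1 z = \<zeta> z * q1 z" for z
  define Q2 where "Q2 z = \<zeta> z * q2 z" for z
  define R1 where "R1 = loss \<eta>1 q1"
  define R2 where "R2 = loss \<eta>2 q2"
  have tN: "tame N1" "tame N2" "tame Q1" "tame Q2" "tame R1" "tame R2"
    unfolding N1_def[abs_def] N2_def[abs_def] Q1_def[abs_def] Q2_def[abs_def] R1_def R2_def
    by (intro tame_mult tame_cutoff tame_loss bm)+
  have N_nn: "0 \<le> N1 z" "0 \<le> N2 z" for z
    using nn nonneg by (simp_all add: N1_def N2_def)
  have key: "(LBINT p. kernel e (snd p - fst p) * (Q1 (fst p) * N2 (snd p)))
      - (LBINT p. kernel e (snd p - fst p) * (N1 (fst p) * Q2 (snd p)))
      \<le> 2 * (LBINT z. \<bar>R1 z\<bar>) * (LBINT z. \<bar>R2 z\<bar>)" if e: "e > 0" for e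
  proof -
    define \<tau> where "\<tau> p = (fst (fst p) - fst (snd p)) / e" for p :: "(real \<times> real) \<times> (real \<times> real)"
    define \<sigma> where "\<sigma> p = (snd (snd p) - snd (fst p)) / e" for p :: "(real \<times> real) \<times> (real \<times> real)"
    have m: "\<tau> \<in> borel_measurable borel" "\<sigma> \<in> borel_measurable borel"
      unfolding \<tau>_def \<sigma>_def using e by (auto intro!: borel_measurable_continuous_onI continuous_intros)
    define D where "D p = dbump (\<tau> p) * step (\<sigma> p) / e" for p
    define S where "S p = bump (\<tau> p) * step (\<sigma> p)" for p
    define k where "k p = bump (\<tau> p) * bump (\<sigma> p) / e" for p
    define B where "B p = bump (\<tau> p)" for p
    note bc = bmeas_compose[OF bmeas_dbump m(1)] bmeas_compose[OF bmeas_bump m(1)]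
      bmeas_compose[OF bmeas_step m(2)] bmeas_compose[OF bmeas_bump m(2)]
    have b: "bmeas D" "bmeas S" "bmeas k" "bmeas B"
      unfolding D_def[abs_def] S_def[abs_def] k_def[abs_def] B_def[abs_def] divide_inverse
      by (intro bmeas_mult bmeas_const bc)+
    have T: "tame (\<lambda>p. G p * (f (fst p) * g (snd p)))" if "bmeas G" "tame f" "tame g" for G and f g :: "real \<times> real \<Rightarrow> real"
      using that by (intro tame_mult' tame_tensor)
    note I = tame_integrable[OF T]
    \<comment> \<open>The second point is fixed; increasing \<open>x\<close> decreases the step.\<close>
    have A1: "0 \<le> (LBINT z. D (z, z') * N1 z + S (z, z') * R1 z - k (z, z') * Q1 z)" for z'
      using moving_window_test[OF 1, of "\<lambda>z. \<tau> (z, z')" "1 / e" "- fst z' / e" "\<lambda>z. \<sigma> (z, z')" "- 1 / e" "snd z' / e"]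
      by (simp add: \<tau>_def \<sigma>_def D_def S_def k_def N1_def Q1_def R1_def diff_divide_distrib algebra_simps)
    \<comment> \<open>The first point is fixed; the signs of both derivatives are reversed.\<close>
    have A2: "0 \<le> (LBINT z'. - (D (z, z') * N2 z') + S (z, z') * R2 z' + k (z, z') * Q2 z')" for z
      using moving_window_test[OF 2, of "\<lambda>z'. \<tau> (z, z')" "- 1 / e" "fst z / e" "\<lambda>z'. \<sigma> (z, z')" "1 / e" "- snd z / e"]
      by (simp add: \<tau>_def \<sigma>_def D_def S_def k_def N2_def Q2_def R2_def diff_divide_distrib algebra_simps)
    let ?F1 = "\<lambda>p. D p * (N1 (fst p) * N2 (snd p)) + S p * (R1 (fst p) * N2 (snd p))
        - k p * (Q1 (fst p) * N2 (snd p))"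
    let ?F2 = "\<lambda>p. - (D p * (N1 (fst p) * N2 (snd p))) + S p * (N1 (fst p) * R2 (snd p))
        + k p * (N1 (fst p) * Q2 (snd p))"
    \<comment> \<open>In \<open>?F1 + ?F2\<close> the terms with \<open>D\<close> cancel.\<close>
    have tF: "tame ?F1" "tame ?F2"
      by (intro tame_add tame_diff tame_minus T b tN)+
    have "0 \<le> (LBINT z'. N2 z' * (LBINT z. D (z, z') * N1 z + S (z, z') * R1 z - k (z, z') * Q1 z))"
      using A1 N_nn by (intro integral_nonneg_AE) simp
    also have "\<dots> = (LBINT z'. LBINT z. ?F1 (z, z'))"
      unfolding integral_mult_right_zero[symmetric]
      by (intro Bochner_Integration.integral_cong refl) (simp add: algebra_simps)
    also have "\<dots> = (LBINT p. ?F1 p)" by (rule Fubini_tame(2)[OF tF(1)])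
    finally have F1: "0 \<le> (LBINT p. ?F1 p)" .
    have "0 \<le> (LBINT z. N1 z * (LBINT z'. - (D (z, z') * N2 z') + S (z, z') * R2 z' + k (z, z') * Q2 z'))"
      using A2 N_nn by (intro integral_nonneg_AE) simp
    also have "\<dots> = (LBINT z. LBINT z'. ?F2 (z, z'))"
      unfolding integral_mult_right_zero[symmetric]
      by (intro Bochner_Integration.integral_cong refl) (simp add: algebra_simps)
    also have "\<dots> = (LBINT p. ?F2 p)" by (rule Fubini_tame(1)[OF tF(2)])
    finally have F2: "0 \<le> (LBINT p. ?F2 p)" .
    have F1': "(LBINT p. ?F1 p) = (LBINT p. D p * (N1 (fst p) * N2 (snd p)))
      + (LBINT p. S p * (R1 (fst p) * N2 (snd p))) - (LBINT p. k p * (Q1 (fst p) * N2 (snd p)))"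
      using b tN by (simp add: I)
    have F2': "(LBINT p. ?F2 p) = - (LBINT p. D p * (N1 (fst p) * N2 (snd p)))
      + (LBINT p. S p * (N1 (fst p) * R2 (snd p))) + (LBINT p. k p * (N1 (fst p) * Q2 (snd p)))"
      using b tN by (simp add: I)
    have S_le: "\<bar>S p\<bar> \<le> B p" for p
      using mult_left_mono[OF step_le_1 bump_nonneg] bump_nonneg step_nonneg
      by (simp add: S_def B_def abs_mult)
    have "(LBINT p. S p * (R1 (fst p) * N2 (snd p))) \<le> (LBINT p. B p * (\<bar>R1 (fst p)\<bar> * N2 (snd p)))"
    proof (rule integral_mono)
      fix p :: "(real \<times> real) \<times> (real \<times> real)"
      have "S p * (R1 (fst p) * N2 (snd p)) \<le> \<bar>S p\<bar> * (\<bar>R1 (fst p)\<bar> * N2 (snd p))"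
        using abs_ge_self[of "S p * (R1 (fst p) * N2 (snd p))"] N_nn by (simp add: abs_mult)
      also have "\<dots> \<le> B p * (\<bar>R1 (fst p)\<bar> * N2 (snd p))"
        using S_le N_nn by (intro mult_right_mono) auto
      finally show "S p * (R1 (fst p) * N2 (snd p)) \<le> B p * (\<bar>R1 (fst p)\<bar> * N2 (snd p))" .
    qed (intro tame_integrable T b tN tame_abs)+
    also have "\<dots> = (LBINT z. LBINT z'. B (z, z') * (\<bar>R1 z\<bar> * N2 z'))"
      using Fubini_tame(1)[OF T[OF b(4) tame_abs[OF tN(5)] tN(2)]] by simp
    also have "\<dots> = (LBINT z. \<bar>R1 z\<bar> * (LBINT z'. bump (fst z / e - fst z' / e) * (\<zeta> z' * \<eta>2 z')))"
      unfolding integral_mult_right_zero[symmetric]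
      by (intro Bochner_Integration.integral_cong refl)
        (simp add: B_def \<tau>_def N2_def diff_divide_distrib mult_ac)
    also have "\<dots> \<le> (LBINT z. \<bar>R1 z\<bar> * (e * (LBINT z. \<bar>R2 z\<bar>)))"
      using e by (intro integral_mono' mult_left_mono mult_nonneg_nonneg integral_nonneg
          mass_bound[OF 2 e, folded R2_def] integrable_mult_left tame_integrable tame_abs tN) auto
    finally have S1: "(LBINT p. S p * (R1 (fst p) * N2 (snd p)))
        \<le> e * ((LBINT z. \<bar>R1 z\<bar>) * (LBINT z. \<bar>R2 z\<bar>))"
      by (simp add: mult_ac)
    have "(LBINT p. S p * (N1 (fst p) * R2 (snd p))) \<le> (LBINT p. B p * (N1 (fst p) * \<bar>R2 (snd p)\<bar>))"
    proof (rule integral_mono)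
      fix p :: "(real \<times> real) \<times> (real \<times> real)"
      have "S p * (N1 (fst p) * R2 (snd p)) \<le> \<bar>S p\<bar> * (N1 (fst p) * \<bar>R2 (snd p)\<bar>)"
        using abs_ge_self[of "S p * (N1 (fst p) * R2 (snd p))"] N_nn by (simp add: abs_mult)
      also have "\<dots> \<le> B p * (N1 (fst p) * \<bar>R2 (snd p)\<bar>)"
        using S_le N_nn by (intro mult_right_mono) auto
      finally show "S p * (N1 (fst p) * R2 (snd p)) \<le> B p * (N1 (fst p) * \<bar>R2 (snd p)\<bar>)" .
    qed (intro tame_integrable T b tN tame_abs)+
    also have "\<dots> = (LBINT z'. LBINT z. B (z, z') * (N1 z * \<bar>R2 z'\<bar>))"
      using Fubini_tame(2)[OF T[OF b(4) tN(1) tame_abs[OF tN(6)]]] by simp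
    also have "\<dots> = (LBINT z'. \<bar>R2 z'\<bar> * (LBINT z. bump ((1 + fst z' / e) - fst z / e) * (\<zeta> z * \<eta>1 z)))"
      unfolding integral_mult_right_zero[symmetric]
    proof (intro Bochner_Integration.integral_cong refl)
      \<comment> \<open>The bump is symmetric about \<open>1/2\<close>, so the roles of the two times can be exchanged.\<close>
      fix z' z :: "real \<times> real"
      have "bump ((1 + fst z' / e) - fst z / e) = bump (1 - (fst z / e - fst z' / e))"
        by (simp add: algebra_simps)
      also have "\<dots> = B (z, z')" by (simp add: bump_reflect B_def \<tau>_def diff_divide_distrib)
      finally show "B (z, z') * (N1 z * \<bar>R2 z'\<bar>) = \<bar>R2 z'\<bar> * (bump (1 + fst z' / e - fst z / e) * (\<zeta> z * \<eta>1 z))"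
        by (simp add: N1_def mult_ac)
    qed
    also have "\<dots> \<le> (LBINT z. \<bar>R2 z\<bar> * (e * (LBINT z. \<bar>R1 z\<bar>)))"
      using e by (intro integral_mono' mult_left_mono mult_nonneg_nonneg integral_nonneg
          mass_bound[OF 1 e, folded R1_def] integrable_mult_left tame_integrable tame_abs tN) auto
    finally have S2: "(LBINT p. S p * (N1 (fst p) * R2 (snd p)))
        \<le> e * ((LBINT z. \<bar>R1 z\<bar>) * (LBINT z. \<bar>R2 z\<bar>))"
      by (simp add: mult_ac)
    have "(LBINT p. k p * (Q1 (fst p) * N2 (snd p))) - (LBINT p. k p * (N1 (fst p) * Q2 (snd p)))
       \<le> 2 * e * ((LBINT z. \<bar>R1 z\<bar>) * (LBINT z. \<bar>R2 z\<bar>))"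
      using F1 F2 F1' F2' S1 S2 by linarith
    moreover have "k p = e * kernel e (snd p - fst p)" for p
      using e by (simp add: k_def kernel_def \<tau>_def \<sigma>_def minus_divide_left)
    ultimately have "e * ((LBINT p. kernel e (snd p - fst p) * (Q1 (fst p) * N2 (snd p)))
      - (LBINT p. kernel e (snd p - fst p) * (N1 (fst p) * Q2 (snd p))))
      \<le> e * (2 * (LBINT z. \<bar>R1 z\<bar>) * (LBINT z. \<bar>R2 z\<bar>))"
      by (simp add: mult.assoc right_diff_distrib mult.left_commute)
    then show ?thesis using e by simp
  qed
  have "(LBINT z. Q1 z * N2 z) - (LBINT z. N1 z * Q2 z)
      \<le> 2 * (LBINT z. \<bar>R1 z\<bar>) * (LBINT z. \<bar>R2 z\<bar>)"
  proof (rule field_le_epsilon)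
    fix r :: real assume "r > 0"
    then have r: "r / 2 > 0" by simp
    obtain d1 where d1: "d1 > 0" "\<And>e. 0 < e \<Longrightarrow> e < d1 \<Longrightarrow>
      \<bar>(LBINT p. kernel e (snd p - fst p) * (Q1 (fst p) * N2 (snd p))) - (LBINT z. Q1 z * N2 z)\<bar> \<le> r / 2"
      by (rule kernel_limit[OF tN(3) tN(2) r]) (rule that)
    obtain d2 where d2: "d2 > 0" "\<And>e. 0 < e \<Longrightarrow> e < d2 \<Longrightarrow>
      \<bar>(LBINT p. kernel e (snd p - fst p) * (N1 (fst p) * Q2 (snd p))) - (LBINT z. N1 z * Q2 z)\<bar> \<le> r / 2"
      by (rule kernel_limit[OF tN(1) tN(4) r]) (rule that)
    define e where "e = min d1 d2 / 2"
    have e: "0 < e" "e < d1" "e < d2" using d1 d2 by (auto simp: e_def)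
    show "(LBINT z. Q1 z * N2 z) - (LBINT z. N1 z * Q2 z)
      \<le> 2 * (LBINT z. \<bar>R1 z\<bar>) * (LBINT z. \<bar>R2 z\<bar>) + r"
      using key[OF e(1)] d1(2)[OF e(1,2)] d2(2)[OF e(1,3)] by linarith
  qed
  also have "(LBINT z. Q1 z * N2 z) - (LBINT z. N1 z * Q2 z)
     = (LBINT z. Q1 z * N2 z - N1 z * Q2 z)"
    by (simp add: tame_integrable tame_mult tame_bmeas tN)
  also have "\<dots> = (LBINT z. (\<zeta> z)\<^sup>2 * (q1 z * \<eta>2 z - \<eta>1 z * q2 z))"
    by (simp add: Q1_def Q2_def N1_def N2_def power2_eq_square algebra_simps)
  finally show ?thesis by (simp add: R1_def R2_def)
qed

section \<open>From small mass to a pointwise bound\<close>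

definition square :: "real \<times> real \<Rightarrow> real \<Rightarrow> (real \<times> real) set" where
  "square c r = {z. \<bar>fst z - fst c\<bar> \<le> r \<and> \<bar>snd z - snd c\<bar> \<le> r}"

lemma square_mono: "r \<le> s \<Longrightarrow> square c r \<subseteq> square c s"
  by (auto simp: square_def)

lemma square_eq_Times: "square c r = {fst c - r..fst c + r} \<times> {snd c - r..snd c + r}"
  by (auto simp: square_def abs_le_iff)

lemma compact_square: "compact (square c r)"
  unfolding square_eq_Times by (intro compact_Times compact_Icc)

lemma square_spacetime: "r < fst c \<Longrightarrow> square c r \<subseteq> spacetime"
  by (auto simp: square_def spacetime_def)

lemma square_measurable [measurable]: "square c r \<in> sets borel"
  using compact_square by (intro borel_closed compact_imp_closed)

text \<open>A product of four steps of width \<open>s - r\<close>, one for each side of the square.\<close>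

lemma square_cutoff:
  assumes r: "r < s" and s: "s < fst c"
  obtains \<zeta> \<zeta>t \<zeta>x where "cutoff \<zeta> \<zeta>t \<zeta>x (square c s)" "\<And>z. z \<in> square c r \<Longrightarrow> \<zeta> z = 1"
    "\<And>z. \<bar>\<zeta>t z\<bar> \<le> 2 * bump_max / (s - r)" "\<And>z. \<bar>\<zeta>x z\<bar> \<le> 2 * bump_max / (s - r)"
proof -
  define g where "g = s - r"
  have g: "g > 0" using r by (simp add: g_def)
  define a1 where "a1 z = (1 / g) * fst z + 0 * snd z + (s - fst c) / g" for z :: "real \<times> real"
  define a2 where "a2 z = (- 1 / g) * fst z + 0 * snd z + (s + fst c) / g" for z :: "real \<times> real"
  define a3 where "a3 z = 0 * fst z + (1 / g) * snd z + (s - snd c) / g" for z :: "real \<times> real"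
  define a4 where "a4 z = 0 * fst z + (- 1 / g) * snd z + (s + snd c) / g" for z :: "real \<times> real"
  have a: "a1 z = (s + (fst z - fst c)) / g" "a2 z = (s - (fst z - fst c)) / g"
     "a3 z = (s + (snd z - snd c)) / g" "a4 z = (s - (snd z - snd c)) / g" for z
    using g by (simp_all add: a1_def a2_def a3_def a4_def field_simps)
  have ca: "continuous_on UNIV a1" "continuous_on UNIV a2" "continuous_on UNIV a3" "continuous_on UNIV a4"
    unfolding a1_def a2_def a3_def a4_def by (intro continuous_intros)+
  define \<zeta> where "\<zeta> z = (step (a1 z) * step (a2 z)) * (step (a3 z) * step (a4 z))" for z
  define ft where "ft z = step (a1 z) * ((- 1 / g) * bump (a2 z)) + ((1 / g) * bump (a1 z)) * step (a2 z)" for z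
  define fx where "fx z = step (a1 z) * (0 * bump (a2 z)) + (0 * bump (a1 z)) * step (a2 z)" for z
  define ht where "ht z = step (a3 z) * (0 * bump (a4 z)) + (0 * bump (a3 z)) * step (a4 z)" for z
  define hx where "hx z = step (a3 z) * ((- 1 / g) * bump (a4 z)) + ((1 / g) * bump (a3 z)) * step (a4 z)" for z
  define \<zeta>t where "\<zeta>t z = (step (a1 z) * step (a2 z)) * ht z + ft z * (step (a3 z) * step (a4 z))" for z
  define \<zeta>x where "\<zeta>x z = (step (a1 z) * step (a2 z)) * hx z + fx z * (step (a3 z) * step (a4 z))" for z
  have zt: "\<zeta>t z = (bump (a1 z) * step (a2 z) - step (a1 z) * bump (a2 z)) / g * (step (a3 z) * step (a4 z))"
    and zx: "\<zeta>x z = (bump (a3 z) * step (a4 z) - step (a3 z) * bump (a4 z)) / g * (step (a1 z) * step (a2 z))" for z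
    using g by (simp_all add: \<zeta>t_def \<zeta>x_def ft_def fx_def ht_def hx_def field_simps)
  have bs: "\<bar>(bump u * step v - step u * bump v) / g * (step w * step y)\<bar> \<le> 2 * bump_max / g" for u v w y
  proof -
    have p: "0 \<le> bump u * step v" "bump u * step v \<le> bump_max * 1" for u v
      by (intro mult_mono mult_nonneg_nonneg bump_nonneg step_nonneg bump_le step_le_1 bump_max_nonneg)+
    have "\<bar>bump u * step v - step u * bump v\<bar> \<le> 2 * bump_max"
      using p[of u v] p[of v u] by (simp add: mult.commute)
    then have "\<bar>(bump u * step v - step u * bump v) / g\<bar> \<le> 2 * bump_max / g"
      using g by (simp add: divide_right_mono)
    moreover have "\<bar>step w * step y\<bar> \<le> 1"
      using mult_mono[OF step_le_1[of w] step_le_1[of y]] step_nonneg by (simp add: abs_mult)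
    ultimately have "\<bar>(bump u * step v - step u * bump v) / g\<bar> * \<bar>step w * step y\<bar> \<le> 2 * bump_max / g * 1"
      using g bump_max_nonneg by (intro mult_mono) auto
    then show ?thesis by (simp only: abs_mult mult_1_right)
  qed
  have out: "a1 z \<le> 0 \<or> a2 z \<le> 0 \<or> a3 z \<le> 0 \<or> a4 z \<le> 0" if "z \<notin> square c s" for z
    using that g unfolding a square_def by (auto simp: divide_le_0_iff)
  note cs = continuous_on_compose2[OF continuous_on_step[of UNIV] ca(1)]
    continuous_on_compose2[OF continuous_on_step[of UNIV] ca(2)]
    continuous_on_compose2[OF continuous_on_step[of UNIV] ca(3)]
    continuous_on_compose2[OF continuous_on_step[of UNIV] ca(4)]
    continuous_on_compose2[OF continuous_on_bump[of UNIV] ca(1)]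
    continuous_on_compose2[OF continuous_on_bump[of UNIV] ca(2)]
    continuous_on_compose2[OF continuous_on_bump[of UNIV] ca(3)]
    continuous_on_compose2[OF continuous_on_bump[of UNIV] ca(4)]
  have "cutoff \<zeta> \<zeta>t \<zeta>x (square c s)"
  proof
    show "C_upto k \<zeta>" for k
      unfolding \<zeta>_def a1_def a2_def a3_def a4_def by (intro C_upto_mult C_upto_step_affine)
    show "compact (square c s)" "square c s \<subseteq> spacetime"
      by (rule compact_square square_spacetime[OF s])+
    show "0 \<le> \<zeta> z" for z by (simp add: \<zeta>_def step_nonneg)
    show "\<zeta> z = 0" if "z \<notin> square c s" for z
      using out[OF that] by (auto simp: \<zeta>_def step_eq_0)
    show "\<zeta>t z = 0" if "z \<notin> square c s" for z
      using out[OF that] by (auto simp: zt step_eq_0 bump_eq_0)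
    show "\<zeta>x z = 0" if "z \<notin> square c s" for z
      using out[OF that] by (auto simp: zx step_eq_0 bump_eq_0)
    show "(\<zeta> has_derivative (\<lambda>v. \<zeta>t z * fst v + \<zeta>x z * snd v)) (at z)" for z
      unfolding \<zeta>_def[abs_def] \<zeta>t_def \<zeta>x_def ft_def fx_def ht_def hx_def a1_def a2_def a3_def a4_def
      by (rule has_derivative_mult_partials[OF
           has_derivative_mult_partials[OF has_derivative_compose_affine[OF step_deriv] has_derivative_compose_affine[OF step_deriv]]
           has_derivative_mult_partials[OF has_derivative_compose_affine[OF step_deriv] has_derivative_compose_affine[OF step_deriv]]])
    show "continuous_on UNIV \<zeta>t" "continuous_on UNIV \<zeta>x"
      unfolding zt[abs_def] zx[abs_def] using g by (auto intro!: continuous_intros cs)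
  qed
  moreover have "\<zeta> z = 1" if "z \<in> square c r" for z
  proof -
    have "1 \<le> a1 z" "1 \<le> a2 z" "1 \<le> a3 z" "1 \<le> a4 z"
      using that g unfolding a square_def by (auto simp: g_def)
    then show ?thesis by (simp add: \<zeta>_def step_eq_1)
  qed
  moreover have "\<bar>\<zeta>t z\<bar> \<le> 2 * bump_max / (s - r)" "\<bar>\<zeta>x z\<bar> \<le> 2 * bump_max / (s - r)" for z
    unfolding zt zx g_def[symmetric] by (rule bs)+
  ultimately show thesis by (rule that)
qed

text \<open>
  De Giorgi's iteration lemma: a quadratic gain beats the geometric loss \<open>b ^ n\<close> once the
  first term is small.
\<close>

lemma superlinear_recursion_decay:
  fixes A :: "nat \<Rightarrow> real"
  assumes nn: "\<And>n. 0 \<le> A n" and step: "\<And>n. A (Suc n) \<le> D * b ^ n * (A n)\<^sup>2"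
    and b: "b > 0" and D: "D \<ge> 0" and A0: "D * b * A 0 \<le> 1"
  shows "A n \<le> A 0 / b ^ n"
proof (induction n)
  case (Suc n)
  have "A (Suc n) \<le> D * b ^ n * (A n)\<^sup>2" by (rule step)
  also have "\<dots> \<le> D * b ^ n * (A 0 / b ^ n)\<^sup>2"
    using Suc nn b D by (intro mult_left_mono power_mono) auto
  also have "\<dots> = (D * b * A 0) * (A 0 / b ^ Suc n)"
    using b by (simp add: field_simps power2_eq_square)
  also have "\<dots> \<le> 1 * (A 0 / b ^ Suc n)"
    using A0 nn b by (intro mult_right_mono) auto
  finally show ?case by simp
qed simp

text \<open>
  What the iteration needs to know about the entropies \<open>\<eta> k\<close>: finite speed,
  monotonicity in the level \<open>k\<close>, and a strict gap \<open>speed_gap\<close> between the mean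
  velocities of two levels. The function \<open>f\<close>, which is to be bounded from above, satisfies
  \<open>f \<le> k\<close> where \<open>\<eta> k\<close> vanishes. The sign \<open>sg\<close> says
  whether higher levels move to the right or to the left.
\<close>

locale kinetic_family =
  fixes \<eta> q :: "real \<Rightarrow> real \<times> real \<Rightarrow> real" and f :: "real \<times> real \<Rightarrow> real"
    and M \<kappa> d0 sg :: real
  assumes sub: "weak_subsolution (\<eta> k) (q k)"
    and flux_le: "\<bar>q k z\<bar> \<le> M * \<eta> k z"
    and anti: "k \<le> l \<Longrightarrow> \<eta> l z \<le> \<eta> k z"
    and sg: "sg = 1 \<or> sg = - 1"
    and pos: "M > 0" "\<kappa> > 0" "d0 > 0"
    and speed_gap: "- M \<le> k \<Longrightarrow> 0 < d \<Longrightarrow> d \<le> d0 \<Longrightarrow>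
      \<kappa> * d ^ 3 * \<eta> (k + d) z \<le> sg * (q (k + d) z * \<eta> k z - \<eta> (k + d) z * q k z)"
    and zero: "\<eta> k z = 0 \<Longrightarrow> f z \<le> k"
    and upper: "- M \<le> k \<Longrightarrow> \<eta> k z \<le> M * max (f z - k) 0"
    and f_meas: "f \<in> borel_measurable borel"
begin

lemma eta_bmeas: "bmeas (\<eta> k)" and q_bmeas: "bmeas (q k)" and eta_nonneg: "0 \<le> \<eta> k z"
  using sub[of k] unfolding weak_subsolution_def by blast+

definition mass :: "real \<Rightarrow> real \<times> real \<Rightarrow> real \<Rightarrow> real" where
  "mass k c r = (LBINT z. indicator (square c r) z * \<eta> k z)"

lemma tame_indicator_square: "tame (indicator (square c r))"
proof -
  have "bounded (square c r)" by (intro compact_imp_bounded compact_square)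
  then obtain R where R: "\<And>z. z \<in> square c r \<Longrightarrow> norm z \<le> R" by (auto simp: bounded_iff)
  show ?thesis
  proof (rule tameI[where r=R])
    show "bmeas (indicator (square c r))" by (rule bmeasI[where C=1]) (simp_all add: indicator_def)
    show "norm z \<le> R" if "indicator (square c r) z \<noteq> (0::real)" for z
      using that R[of z] by (auto simp: indicator_def split: if_splits)
  qed
qed

lemma integrable_mass: "integrable lborel (\<lambda>z. indicator (square c r) z * \<eta> k z)"
  by (intro tame_integrable tame_mult tame_indicator_square eta_bmeas)

lemma mass_nonneg: "0 \<le> mass k c r"
  unfolding mass_def by (intro integral_nonneg_AE) (simp add: eta_nonneg)

lemma mass_mono: "k \<le> l \<Longrightarrow> r \<le> s \<Longrightarrow> mass l c r \<le> mass k c s"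
  unfolding mass_def using square_mono[of r s c] anti eta_nonneg
  by (intro integral_mono integrable_mass mult_mono) (auto simp: indicator_def)

definition gain :: real where
  "gain = 8 * (bump_max + 1)\<^sup>2 * (1 + M)\<^sup>2"

lemma gain_pos: "gain > 0"
  unfolding gain_def using pos bump_max_nonneg by (intro mult_pos_pos zero_less_power) auto

text \<open>
  Interaction of the levels \<open>k + d\<close> and \<open>k\<close>: by \<open>speed_gap\<close> the
  interaction integral controls the mass at level \<open>k + d\<close> on the inner square, and both
  losses are at most a multiple of the mass at level \<open>k\<close> on the outer one. The interaction
  estimate holds for the two densities in either order, so the sign \<open>sg\<close> is harmless.
\<close>

lemma mass_gain:
  assumes k: "- M \<le> k" and d: "0 < d" "d \<le> d0" and r: "r < s" and s: "s < fst c"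
  shows "\<kappa> * d ^ 3 * mass (k + d) c r \<le> gain / (s - r)\<^sup>2 * (mass k c s)\<^sup>2"
proof -
  obtain \<zeta> \<zeta>t \<zeta>x where cut: "cutoff \<zeta> \<zeta>t \<zeta>x (square c s)"
    and z1: "\<And>z. z \<in> square c r \<Longrightarrow> \<zeta> z = 1"
    and zt: "\<And>z. \<bar>\<zeta>t z\<bar> \<le> 2 * bump_max / (s - r)" and zx: "\<And>z. \<bar>\<zeta>x z\<bar> \<le> 2 * bump_max / (s - r)"
    using square_cutoff[OF r s] by metis
  interpret cutoff \<zeta> \<zeta>t \<zeta>x "square c s" by (rule cut)
  let ?L = "2 * bump_max / (s - r) * (1 + M)"
  have L: "0 \<le> ?L" using r pos bump_max_nonneg by simp
  have loss_le: "(LBINT z. \<bar>loss (\<eta> l) (q l) z\<bar>) \<le> ?L * mass k c s" if "k \<le> l" for l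
  proof -
    have "\<bar>loss (\<eta> l) (q l) z\<bar> \<le> ?L * (indicator (square c s) z * \<eta> k z)" for z
    proof (cases "z \<in> square c s")
      case True
      have "\<bar>loss (\<eta> l) (q l) z\<bar> \<le> \<bar>\<zeta>t z\<bar> * \<eta> l z + \<bar>\<zeta>x z\<bar> * \<bar>q l z\<bar>"
        unfolding loss_def using abs_triangle_ineq[of "\<zeta>t z * \<eta> l z" "\<zeta>x z * q l z"] eta_nonneg
        by (simp add: abs_mult)
      also have "\<dots> \<le> 2 * bump_max / (s - r) * \<eta> l z + 2 * bump_max / (s - r) * (M * \<eta> l z)"
        using r bump_max_nonneg
        by (intro add_mono mult_mono zt zx eta_nonneg flux_le) auto
      also have "\<dots> = ?L * \<eta> l z" by (simp add: algebra_simps add_divide_distrib)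
      also have "\<dots> \<le> ?L * \<eta> k z" using L anti[OF that] by (intro mult_left_mono)
      finally show ?thesis using True by simp
    qed (simp add: loss_def outside)
    then have "(LBINT z. \<bar>loss (\<eta> l) (q l) z\<bar>) \<le> (LBINT z. ?L * (indicator (square c s) z * \<eta> k z))"
      by (intro integral_mono tame_integrable tame_abs tame_loss eta_bmeas q_bmeas
          integrable_mult_right integrable_mass)
    then show ?thesis by (simp only: integral_mult_right_zero mass_def)
  qed
  let ?I = "\<lambda>z. (\<zeta> z)\<^sup>2 * (sg * (q (k + d) z * \<eta> k z - \<eta> (k + d) z * q k z))"
  have "\<kappa> * d ^ 3 * mass (k + d) c r = (LBINT z. \<kappa> * d ^ 3 * (indicator (square c r) z * \<eta> (k + d) z))"
    by (simp add: mass_def)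
  also have "\<dots> \<le> (LBINT z. ?I z)"
  proof (rule integral_mono)
    show "integrable lborel (\<lambda>z. \<kappa> * d ^ 3 * (indicator (square c r) z * \<eta> (k + d) z))"
      by (intro integrable_mult_right integrable_mass)
    have "tame (\<lambda>z. (\<zeta> z * (\<zeta> z * sg)) * (q (k + d) z * \<eta> k z) + (- 1) * ((\<zeta> z * (\<zeta> z * sg)) * (\<eta> (k + d) z * q k z)))"
      by (intro tame_add tame_mult' bmeas_const tame_mult tame_cutoff bmeas_mult tame_bmeas[OF tame_cutoff(1)]
        eta_bmeas q_bmeas)
    then show "integrable lborel ?I"
      by (drule_tac tame_integrable) (simp add: algebra_simps power2_eq_square)
    fix z
    have g: "\<kappa> * d ^ 3 * \<eta> (k + d) z \<le> sg * (q (k + d) z * \<eta> k z - \<eta> (k + d) z * q k z)"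
      by (rule speed_gap[OF k d])
    moreover have "0 \<le> \<kappa> * d ^ 3 * \<eta> (k + d) z"
      using pos d eta_nonneg by simp
    ultimately show "\<kappa> * d ^ 3 * (indicator (square c r) z * \<eta> (k + d) z) \<le> ?I z"
      using z1[of z] by (cases "z \<in> square c r") simp_all
  qed
  also have "\<dots> \<le> 2 * (?L * mass k c s) * (?L * mass k c s)"
  proof -
    have le: "2 * (LBINT z. \<bar>loss (\<eta> l) (q l) z\<bar>) * (LBINT z. \<bar>loss (\<eta> l') (q l') z\<bar>)
        \<le> 2 * (?L * mass k c s) * (?L * mass k c s)" if "k \<le> l" "k \<le> l'" for l l'
    proof -
      let ?X = "?L * mass k c s"
      have "0 \<le> ?X" by (rule mult_nonneg_nonneg[OF L mass_nonneg])
      then show ?thesis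
        using loss_le[OF that(1)] loss_le[OF that(2)] by (intro mult_mono mult_left_mono) auto
    qed
    from sg show ?thesis
    proof
      assume "sg = 1"
      then show ?thesis
        using interaction_estimate[OF sub[of "k + d"] sub[of k]] le[of "k + d" k] d by simp
    next
      assume "sg = - 1"
      then have "?I = (\<lambda>z. (\<zeta> z)\<^sup>2 * (q k z * \<eta> (k + d) z - \<eta> k z * q (k + d) z))"
        by (simp add: mult.commute)
      then show ?thesis
        using interaction_estimate[OF sub[of k] sub[of "k + d"]] le[of k "k + d"] d by simp
    qed
  qed
  also have "\<dots> = 8 * bump_max\<^sup>2 * (1 + M)\<^sup>2 / (s - r)\<^sup>2 * (mass k c s)\<^sup>2"
    using r by (simp add: field_simps power2_eq_square)
  also have "\<dots> \<le> gain / (s - r)\<^sup>2 * (mass k c s)\<^sup>2"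
    unfolding gain_def using bump_max_nonneg
    by (intro mult_right_mono divide_right_mono mult_left_mono power_mono) auto
  finally show ?thesis .
qed

text \<open>
  Iteration of \<open>mass_gain\<close> along levels that increase from \<open>k\<close> to
  \<open>k + d\<close> and squares that shrink from radius \<open>s\<close> to \<open>s / 2\<close>,
  both in geometric steps. A step costs \<open>2^(2 n + 4) / s\<^sup>2\<close> for the squares and
  \<open>2^(3 n + 3) / d\<^sup>3\<close> for the levels, hence the base \<open>32\<close> and the
  constant \<open>4096 = 32 * 128\<close>.
\<close>

theorem small_mass_imp_bound:
  assumes k: "- M \<le> k" and d: "0 < d" "d \<le> d0" and s: "0 < s" "s < fst c"
    and small: "4096 * gain * mass k c s \<le> \<kappa> * d ^ 3 * s\<^sup>2"
  shows "AE z in lborel. z \<in> square c (s / 2) \<longrightarrow> f z \<le> k + d"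
proof -
  define \<rho> where "\<rho> n = s / 2 + s / 2 ^ (n + 1)" for n :: nat
  define l where "l n = k + d * (1 - 1 / 2 ^ n)" for n :: nat
  define A where "A n = mass (l n) c (\<rho> n)" for n
  define D where "D = 128 * gain / (\<kappa> * d ^ 3 * s\<^sup>2)"
  have "A n \<le> A 0 / 32 ^ n" for n
  proof (rule superlinear_recursion_decay[where D=D])
    show "0 \<le> A n" for n by (simp add: A_def mass_nonneg)
    show "D \<ge> 0" using gain_pos pos d by (simp add: D_def)
    have "D * 32 * A 0 = 4096 * gain * mass k c s / (\<kappa> * d ^ 3 * s\<^sup>2)"
      by (simp add: D_def A_def l_def \<rho>_def)
    also have "\<dots> \<le> 1"
      using small pos d s by (simp add: divide_le_eq)
    finally show "D * 32 * A 0 \<le> 1" .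
    fix n
    let ?d = "d / 2 ^ (n + 1)"
    have p: "(0::real) < 2 ^ n" "(1::real) \<le> 2 ^ n" by simp_all
    have l: "l (Suc n) = l n + ?d" by (simp add: l_def field_simps)
    have r: "\<rho> n - \<rho> (Suc n) = s / 2 ^ (n + 2)" by (simp add: \<rho>_def field_simps)
    have ln: "- M \<le> l n"
    proof -
      have "0 \<le> d * (1 - 1 / 2 ^ n)" using d p by (intro mult_nonneg_nonneg) auto
      then show ?thesis using k by (simp add: l_def)
    qed
    have dn: "0 < ?d" "?d \<le> d0"
    proof -
      have "?d \<le> d / 1" using d one_le_power[of "2::real" "n+1"] by (intro divide_left_mono) auto
      then show "?d \<le> d0" using d by simp
    qed (use d in simp)
    have rn: "\<rho> (Suc n) < \<rho> n"
    proof -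
      have "0 < s / 2 ^ (n + 2)" using s by simp
      then show ?thesis using r by linarith
    qed
    have "s / 2 ^ (n + 1) \<le> s / 2"
      using s one_le_power[of "2::real" "n"] by (intro divide_left_mono) auto
    then have rs: "\<rho> n < fst c" using s by (simp add: \<rho>_def)
    have "\<kappa> * ?d ^ 3 * A (Suc n) \<le> gain / (s / 2 ^ (n + 2))\<^sup>2 * (A n)\<^sup>2"
      using mass_gain[OF ln dn rn rs] by (simp only: A_def l r)
    then have "A (Suc n) \<le> gain / (s / 2 ^ (n + 2))\<^sup>2 * (A n)\<^sup>2 / (\<kappa> * ?d ^ 3)"
      using pos dn by (subst pos_le_divide_eq) (auto simp: mult.commute)
    also have "\<dots> = D * (2 ^ n)^5 * (A n)\<^sup>2"
      using pos d s p by (simp add: D_def divide_simps power2_eq_square power3_eq_cube power_divide)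
        (simp add: algebra_simps eval_nat_numeral)?
    also have "((2::real) ^ n) ^ 5 = (2 ^ 5) ^ n" by (simp only: power_mult[symmetric] mult.commute)
    also have "(2::real) ^ 5 = 32" by simp
    finally show "A (Suc n) \<le> D * 32 ^ n * (A n)\<^sup>2" .
  qed simp
  moreover have "mass (k + d) c (s / 2) \<le> A n" for n
  proof -
    have "d * (1 - 1 / 2 ^ n) \<le> d * 1" using d by (intro mult_left_mono) auto
    then show ?thesis unfolding A_def using s by (intro mass_mono) (auto simp: l_def \<rho>_def)
  qed
  ultimately have le: "mass (k + d) c (s / 2) \<le> A 0 / 32 ^ n" for n
    using order_trans by blast
  have "(\<lambda>n. A 0 * (1 / 32) ^ n) \<longlonglongrightarrow> A 0 * 0"
    by (intro tendsto_intros LIMSEQ_realpow_zero) auto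
  then have "mass (k + d) c (s / 2) \<le> 0"
    using le by (intro LIMSEQ_le_const[where X="\<lambda>n. A 0 * (1 / 32) ^ n"]) (auto simp: power_one_over)
  then have "mass (k + d) c (s / 2) = 0" using mass_nonneg[of "k+d" c "s/2"] by simp
  then have "AE z in lborel. indicator (square c (s / 2)) z * \<eta> (k + d) z = 0"
    unfolding mass_def
    by (subst (asm) integral_nonneg_eq_0_iff_AE[OF integrable_mass]) (auto simp: eta_nonneg)
  then show ?thesis
    by eventually_elim (auto intro: zero)
qed

end

section \<open>Kinetic entropies\<close>

text \<open>
  Primitives of \<open>max (v - k) 0\<close> and of \<open>v * max (v - k) 0\<close>, so that
  \<open>kin_ent\<close> and \<open>kin_flux\<close> below are the integrals of these functions over
  \<open>{lo..hi}\<close>.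
\<close>

definition ent_prim :: "real \<Rightarrow> real \<Rightarrow> real" where
  "ent_prim k v = (max (v - k) 0)\<^sup>2 / 2"

definition flux_prim :: "real \<Rightarrow> real \<Rightarrow> real" where
  "flux_prim k v = (max (v - k) 0) ^ 3 / 3 + k * (max (v - k) 0)\<^sup>2 / 2"

definition kin_ent :: "real \<Rightarrow> real \<Rightarrow> real \<Rightarrow> real" where
  "kin_ent k lo hi = ent_prim k hi - ent_prim k lo"

definition kin_flux :: "real \<Rightarrow> real \<Rightarrow> real \<Rightarrow> real" where
  "kin_flux k lo hi = flux_prim k hi - flux_prim k lo"

lemma max0_power_deriv:
  "((\<lambda>v. (max (v - k) 0) ^ (n + 2)) has_real_derivative real (n + 2) * (max (v - k) 0) ^ (n + 1)) (at (v::real))"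
proof -
  consider "v < k" | "v > k" | "v = k" by linarith
  then show ?thesis
  proof cases
    case 1
    have "((\<lambda>v. 0) has_real_derivative 0) (at v)" by simp
    then have "((\<lambda>v. (max (v - k) 0) ^ (n + 2)) has_real_derivative 0) (at v)"
      by (rule has_field_derivative_transform_within_open[where S="{..<k}"]) (use 1 in auto)
    with 1 show ?thesis by simp
  next
    case 2
    have "((\<lambda>v. v - k) has_real_derivative 1) (at v)"
      by (auto intro!: derivative_eq_intros)
    from DERIV_power[OF this, of "n + 2"]
    have "((\<lambda>v. (v - k) ^ (n + 2)) has_real_derivative real (n + 2) * (v - k) ^ (n + 1)) (at v)"
      by simp
    then have "((\<lambda>v. (max (v - k) 0) ^ (n + 2)) has_real_derivative real (n + 2) * (v - k) ^ (n + 1)) (at v)"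
      by (rule has_field_derivative_transform_within_open[where S="{k<..}"]) (use 2 in auto)
    with 2 show ?thesis by (simp add: max_def)
  next
    case 3
    have "((\<lambda>h. (max h 0) ^ (n + 2) / h) \<longlongrightarrow> 0) (at (0::real))"
    proof (rule Lim_null_comparison)
      show "\<forall>\<^sub>F h in at 0. norm ((max h 0) ^ (n + 2) / h) \<le> \<bar>h\<bar> ^ (n + 1)"
      proof (rule always_eventually, intro allI)
        fix h :: real
        show "norm ((max h 0) ^ (n + 2) / h) \<le> \<bar>h\<bar> ^ (n + 1)"
          by (cases "h \<le> 0") (simp_all add: max_def mult_nonpos_nonneg)
      qed
      have "((\<lambda>h. \<bar>h\<bar> ^ (n + 1)) \<longlongrightarrow> \<bar>0\<bar> ^ (n + 1)) (at (0::real))"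
        by (intro tendsto_intros)
      then show "((\<lambda>h. \<bar>h\<bar> ^ (n + 1)) \<longlongrightarrow> 0) (at (0::real))" by simp
    qed
    then show ?thesis using 3 by (simp add: DERIV_def)
  qed
qed

lemma ent_prim_deriv: "(ent_prim k has_real_derivative max (v - k) 0) (at v)"
  using DERIV_cdivide[OF max0_power_deriv[of k 0 v], of 2]
  by (simp add: ent_prim_def[abs_def] numeral_2_eq_2)

lemma flux_prim_deriv: "(flux_prim k has_real_derivative v * max (v - k) 0) (at v)"
proof -
  have "((\<lambda>v. (max (v - k) 0) ^ 3) has_real_derivative 3 * (max (v - k) 0)\<^sup>2) (at v)"
    using max0_power_deriv[of k 1 v] by (simp add: numeral_3_eq_3 numeral_2_eq_2)
  moreover have "((\<lambda>v. (max (v - k) 0)\<^sup>2) has_real_derivative 2 * max (v - k) 0) (at v)"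
    using max0_power_deriv[of k 0 v] by (simp add: numeral_2_eq_2)
  ultimately have "(flux_prim k has_real_derivative
      3 * (max (v - k) 0)\<^sup>2 / 3 + k * (2 * max (v - k) 0) / 2) (at v)"
    unfolding flux_prim_def[abs_def]
    by (intro DERIV_add DERIV_cdivide DERIV_cmult)
  moreover have "3 * (max (v - k) 0)\<^sup>2 / 3 + k * (2 * max (v - k) 0) / 2 = v * max (v - k) 0"
    by (auto simp: max_def power2_eq_square algebra_simps)
  ultimately show ?thesis by simp
qed

subsection \<open>Pointwise inequalities\<close>

lemma kin_ent_nonneg: "lo \<le> hi \<Longrightarrow> 0 \<le> kin_ent k lo hi"
  by (auto simp: kin_ent_def ent_prim_def intro!: divide_right_mono power_mono)

lemma kin_ent_anti:
  assumes "lo \<le> hi" "k \<le> l" shows "kin_ent l lo hi \<le> kin_ent k lo hi"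
proof -
  have "(\<lambda>v. ent_prim k v - ent_prim l v) lo \<le> (\<lambda>v. ent_prim k v - ent_prim l v) hi"
  proof (rule DERIV_nonneg_imp_nondecreasing[OF assms(1)])
    fix v
    have "((\<lambda>v. ent_prim k v - ent_prim l v) has_real_derivative max (v - k) 0 - max (v - l) 0) (at v)"
      by (intro DERIV_diff ent_prim_deriv)
    moreover have "0 \<le> max (v - k) 0 - max (v - l) 0" using assms(2) by auto
    ultimately show "\<exists>y. ((\<lambda>v. ent_prim k v - ent_prim l v) has_real_derivative y) (at v) \<and> 0 \<le> y" by blast
  qed
  then show ?thesis by (simp add: kin_ent_def)
qed

lemma kin_flux_le:
  assumes "lo \<le> hi" "- M \<le> lo" "hi \<le> M"
  shows "\<bar>kin_flux k lo hi\<bar> \<le> M * kin_ent k lo hi"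
proof -
  have *: "(\<lambda>v. M * ent_prim k v + s * flux_prim k v) lo \<le> (\<lambda>v. M * ent_prim k v + s * flux_prim k v) hi"
    if s: "\<bar>s\<bar> = 1" for s
  proof (rule DERIV_nonneg_imp_nondecreasing[OF assms(1)])
    fix v assume v: "lo \<le> v" "v \<le> hi"
    have "((\<lambda>v. M * ent_prim k v + s * flux_prim k v) has_real_derivative
        M * max (v - k) 0 + s * (v * max (v - k) 0)) (at v)"
      by (intro DERIV_add DERIV_cmult ent_prim_deriv flux_prim_deriv)
    moreover have "M * max (v - k) 0 + s * (v * max (v - k) 0) = (M + s * v) * max (v - k) 0"
      by (simp add: algebra_simps)
    moreover have "0 \<le> M + s * v"
      using s v assms by (auto simp: abs_if split: if_splits)
    ultimately show "\<exists>y. ((\<lambda>v. M * ent_prim k v + s * flux_prim k v) has_real_derivative y) (at v) \<and> 0 \<le> y"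
      by (metis mult_nonneg_nonneg max.cobounded2)
  qed
  show ?thesis
    using *[of 1] *[of "-1"] by (simp add: kin_ent_def kin_flux_def algebra_simps abs_le_iff)
qed

lemma kin_ent_pos: "lo < hi \<Longrightarrow> kin_ent k lo hi = 0 \<Longrightarrow> hi \<le> k"
proof (rule ccontr)
  assume a: "lo < hi" "kin_ent k lo hi = 0" "\<not> hi \<le> k"
  then have "max (lo - k) 0 < max (hi - k) 0" by auto
  then have "(max (lo - k) 0)\<^sup>2 < (max (hi - k) 0)\<^sup>2"
    by (intro power_strict_mono) auto
  with a show False by (simp add: kin_ent_def ent_prim_def)
qed

lemma kin_ent_le:
  assumes "- M \<le> k" "hi \<le> M"
  shows "kin_ent k lo hi \<le> M * max (hi - k) 0"
proof -
  have "kin_ent k lo hi \<le> max (hi - k) 0 * max (hi - k) 0 / 2"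
    by (simp add: kin_ent_def ent_prim_def power2_eq_square)
  also have "\<dots> \<le> max (hi - k) 0 * (2 * M) / 2"
    by (cases "hi \<le> k") (use assms in \<open>auto simp: max_def intro!: mult_left_mono\<close>)
  finally show ?thesis by (simp add: mult.commute)
qed

text \<open>
  With the weights \<open>a(v) = max (v - k - d) 0\<close> and
  \<open>b(v) = max (v - k) 0\<close> the right-hand side is half the double integral of
  \<open>(v - w) * (a(v) b(w) - a(w) b(v))\<close> over \<open>{lo..hi}\<close>; its integrand
  is nonnegative and equals \<open>d * (v - w)\<^sup>2\<close> where both velocities exceed
  \<open>k + d\<close>. The proof evaluates the integral, according to the position of
  \<open>lo\<close> relative to the two levels. If \<open>lo \<le> k\<close>, the gap of the mean
  velocities is exactly \<open>d / 3\<close>. Otherwise the interval \<open>{lo..hi}\<close> has a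
  part of length at least \<open>c / 2\<close> above \<open>k + d\<close>, which is where the lower
  bound \<open>c\<close> for \<open>hi - lo\<close> enters.
\<close>

lemma kin_speed_gap:
  assumes c: "0 < c" "c \<le> 1" "c \<le> hi - lo" and M: "- M \<le> lo" "hi \<le> M" and k: "- M \<le> k"
    and d: "0 < d" "d \<le> c / 2"
  shows "c ^ 3 / (24 * (M + 1)) * d ^ 3 * kin_ent (k + d) lo hi
    \<le> kin_flux (k + d) lo hi * kin_ent k lo hi - kin_ent (k + d) lo hi * kin_flux k lo hi"
    (is "?\<kappa> * d ^ 3 * ?a \<le> ?I")
proof -
  have Mp: "0 \<le> M" using M c by linarith
  have d1: "d \<le> 1" using c d by linarith
  have a0: "0 \<le> ?a" using c by (intro kin_ent_nonneg) linarith
  \<comment> \<open>The constant is chosen to be below those of the three cases, which are \<open>1 / 6\<close>, \<open>c\<^sup>2 / (24 d\<^sup>2)\<close> and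
    \<open>c\<^sup>3 / (24 (M + 1) d\<^sup>2)\<close>.\<close>
  have c3: "c ^ 3 \<le> 1" "c ^ 3 \<le> c\<^sup>2"
    using c by (auto intro: power_le_one power_decreasing)
  have d3: "d ^ 3 \<le> d" using d d1 power_decreasing[of 1 3 d] by simp
  have "?\<kappa> \<le> c ^ 3 / 24"
    using Mp c by (intro divide_left_mono) auto
  with c3 have K1: "?\<kappa> \<le> 1 / 24" "?\<kappa> \<le> c\<^sup>2 / 24" by linarith+
  have K1': "?\<kappa> \<ge> 0" using Mp c by simp
  have K: "?\<kappa> * d ^ 3 * ?a \<le> X" if "y * ?a \<le> X" "?\<kappa> * d ^ 3 \<le> y" for X y
    using mult_right_mono[OF that(2) a0] that(1) by linarith
  consider (z) "hi \<le> k + d" | (lo) "k + d < hi" "lo \<le> k" | (mid) "k < lo" "lo \<le> k + d" "k + d < hi"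
    | (up) "k + d < lo" by linarith
  then show ?thesis
  proof cases
    case z
    then have "?a = 0" "kin_flux (k + d) lo hi = 0"
      using c by (auto simp: kin_ent_def kin_flux_def ent_prim_def flux_prim_def max_def)
    then show ?thesis by simp
  next
    case lo
    define w where "w = hi - (k + d)"
    have w: "0 < w" "hi = w + d + k" using lo by (simp_all add: w_def)
    have ea: "?a = w\<^sup>2 / 2" and eb: "kin_ent k lo hi = (w + d)\<^sup>2 / 2"
      and qa: "kin_flux (k + d) lo hi = w ^ 3 / 3 + (k + d) * w\<^sup>2 / 2"
      and qb: "kin_flux k lo hi = (w + d) ^ 3 / 3 + k * (w + d)\<^sup>2 / 2"
      using lo d w by (auto simp: kin_ent_def kin_flux_def ent_prim_def flux_prim_def max_def)
    have "?I = d / 3 * ((w + d)\<^sup>2 / 2) * ?a"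
      unfolding ea eb qa qb by (simp add: field_simps power2_eq_square power3_eq_cube)
    moreover have "d / 3 * (d\<^sup>2 / 2) * ?a \<le> d / 3 * ((w + d)\<^sup>2 / 2) * ?a"
      using w d a0 by (intro mult_right_mono mult_left_mono divide_right_mono power_mono) auto
    moreover have "?\<kappa> * d ^ 3 \<le> d / 3 * (d\<^sup>2 / 2)"
    proof -
      have "d / 3 * (d\<^sup>2 / 2) = d ^ 3 / 6" by (simp add: power2_eq_square power3_eq_cube)
      moreover have "?\<kappa> * d ^ 3 \<le> 1 / 24 * d ^ 3" "0 \<le> d ^ 3"
        using mult_right_mono[OF K1(1), of "d ^ 3"] d by simp_all
      ultimately show ?thesis by linarith
    qed
    ultimately show ?thesis by (intro K[of "d / 3 * (d\<^sup>2 / 2)"]) auto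
  next
    case mid
    define w where "w = hi - (k + d)"
    define l where "l = lo - k"
    have w: "0 < w" "hi = w + d + k" and l: "0 < l" "l \<le> d" "lo = l + k"
      using mid by (simp_all add: w_def l_def)
    have wc: "c / 2 \<le> w" using c d l w by linarith
    have ea: "?a = w\<^sup>2 / 2" and eb: "kin_ent k lo hi = ((w + d)\<^sup>2 - l\<^sup>2) / 2"
      and qa: "kin_flux (k + d) lo hi = w ^ 3 / 3 + (k + d) * w\<^sup>2 / 2"
      and qb: "kin_flux k lo hi = ((w + d) ^ 3 - l ^ 3) / 3 + k * ((w + d)\<^sup>2 - l\<^sup>2) / 2"
      using mid d w l by (auto simp: kin_ent_def kin_flux_def ent_prim_def flux_prim_def max_def field_simps)
    let ?B = "(2 * (w + d) + d) / 6 * ((w + d)\<^sup>2 - l\<^sup>2) - ((w + d) ^ 3 - l ^ 3) / 3"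
    have I: "?I = ?B * ?a"
      unfolding ea eb qa qb by (simp add: field_simps power2_eq_square power3_eq_cube)
    have "?B - d * w\<^sup>2 / 6 = (d - l) * ((2 * w + 3 * d) * (d + l) - 2 * (d\<^sup>2 + d * l + l\<^sup>2)) / 6"
      by (simp add: field_simps power2_eq_square power3_eq_cube)
    also have "\<dots> \<ge> 0"
    proof -
      have "2 * (d\<^sup>2 + d * l + l\<^sup>2) \<le> 3 * d * (d + l)"
      proof -
        have "3 * d * (d + l) - 2 * (d\<^sup>2 + d * l + l\<^sup>2) = d * (d - l) + 2 * (l * (d - l))"
          by (simp add: power2_eq_square algebra_simps)
        moreover have "0 \<le> d * (d - l)" "0 \<le> l * (d - l)" using l d by simp_all
        ultimately show ?thesis by linarith
      qed
      also have "\<dots> \<le> (2 * w + 3 * d) * (d + l)"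
        using w l d by (intro mult_right_mono) auto
      finally show ?thesis using l by simp
    qed
    finally have B: "d * w\<^sup>2 / 6 \<le> ?B" by simp
    have "c\<^sup>2 / 4 \<le> w\<^sup>2" using power_mono[OF wc, of 2] c by (simp add: power_divide)
    then have "d * (c\<^sup>2 / 4) \<le> d * w\<^sup>2" using d by (intro mult_left_mono) auto
    then have "d * (c\<^sup>2 / 24) \<le> ?B" using B by linarith
    moreover have "?\<kappa> * d ^ 3 \<le> d * (c\<^sup>2 / 24)"
      using mult_mono[OF K1(2) d3] c d by (simp add: mult.commute)
    ultimately have "?\<kappa> * d ^ 3 \<le> ?B" by linarith
    then show ?thesis unfolding I using a0 by (rule mult_right_mono)
  next
    case up
    define r where "r = hi - lo"
    define l where "l = lo - (k + d)"
    have r: "c \<le> r" "hi = r + l + d + k" and l: "0 < l" "lo = l + d + k"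
      using up c by (simp_all add: r_def l_def)
    have ea: "?a = ((r + l)\<^sup>2 - l\<^sup>2) / 2" and eb: "kin_ent k lo hi = ((r + l + d)\<^sup>2 - (l + d)\<^sup>2) / 2"
      and qa: "kin_flux (k + d) lo hi = ((r + l) ^ 3 - l ^ 3) / 3 + (k + d) * ((r + l)\<^sup>2 - l\<^sup>2) / 2"
      and qb: "kin_flux k lo hi = ((r + l + d) ^ 3 - (l + d) ^ 3) / 3 + k * ((r + l + d)\<^sup>2 - (l + d)\<^sup>2) / 2"
      using up d r l c by (auto simp: kin_ent_def kin_flux_def ent_prim_def flux_prim_def max_def field_simps)
    have I: "?I = d * r ^ 4 / 12"
      unfolding ea eb qa qb by (simp add: field_simps power2_eq_square power3_eq_cube power4_eq_xxxx)
    have "?a = r * ((r + l) + l) / 2" unfolding ea by (simp add: field_simps power2_eq_square)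
    also have "\<dots> \<le> r * (2 * (M + 1)) "
    proof -
      have "(r + l) + l \<le> 4 * M" using r l M k d c by linarith
      then have "r * ((r + l) + l) \<le> r * (4 * (M + 1))" using r c by (intro mult_left_mono) auto
      then show ?thesis by (simp add: algebra_simps)
    qed
    finally have a_le: "?a \<le> r * (2 * (M + 1))" .
    have "?\<kappa> * d ^ 3 * ?a \<le> ?\<kappa> * d * (r * (2 * (M + 1)))"
      using K1' d d3 a_le a0 by (intro mult_mono mult_left_mono mult_nonneg_nonneg) auto
    also have "\<dots> = d * (c ^ 3 * r) / 12" using Mp by (simp add: field_simps)
    also have "\<dots> \<le> d * (r ^ 3 * r) / 12"
      using d r c by (intro divide_right_mono mult_left_mono mult_right_mono power_mono) auto
    also have "\<dots> = ?I" unfolding I by (simp add: power4_eq_xxxx power3_eq_cube)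
    finally show ?thesis .
  qed
qed

subsection \<open>The kinetic entropies are entropies of the system\<close>

lemma lambda_eq: "lambda1 (\<rho>, m) = m / \<rho> - \<rho> / 2" "lambda2 (\<rho>, m) = m / \<rho> + \<rho> / 2"
  by (simp_all add: lambda1_def lambda2_def)

text \<open>
  The left-hand side is the integral of \<open>v - k\<close> over the topmost fraction
  \<open>p\<close> of \<open>{lambda1..lambda2}\<close>, which never exceeds the integral of the
  positive part over the whole interval. It is linear in \<open>(\<rho>, m)\<close> up to a nonnegative
  multiple of \<open>\<rho>\<^sup>2\<close>, hence convex.
\<close>

lemma kin_ent_ge:
  assumes \<rho>: "\<rho> > 0" and p: "0 \<le> p" "p \<le> 1"
  shows "p * (m - k * \<rho>) + p * (1 - p) * \<rho>\<^sup>2 / 2 \<le> kin_ent k (lambda1 (\<rho>, m)) (lambda2 (\<rho>, m))"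
proof -
  define X where "X = m / \<rho> + \<rho> / 2 - k"
  define y where "y = p * \<rho>"
  have y: "0 \<le> y" "y \<le> \<rho>" using p \<rho> mult_right_mono[of p 1 \<rho>] by (auto simp: y_def)
  have "p * (m - k * \<rho>) + p * (1 - p) * \<rho>\<^sup>2 / 2 = y * X - y\<^sup>2 / 2"
    using \<rho> by (simp add: X_def y_def field_simps power2_eq_square)
  also have "\<dots> \<le> (max X 0)\<^sup>2 / 2 - (max (X - \<rho>) 0)\<^sup>2 / 2"
  proof -
    consider "X \<le> 0" | "0 < X" "X \<le> \<rho>" | "\<rho> < X" by linarith
    then show ?thesis
    proof cases
      case 1
      then have "y * X \<le> 0" using y by (simp add: mult_nonneg_nonpos)
      moreover have "(max X 0)\<^sup>2 / 2 - (max (X - \<rho>) 0)\<^sup>2 / 2 = 0" using 1 \<rho> by (simp add: max_def)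
      ultimately show ?thesis using zero_le_power2[of y] by linarith
    next
      case 2
      then show ?thesis using zero_le_power2[of "X - y"] by (simp add: max_def power2_eq_square algebra_simps)
    next
      case 3
      have "0 \<le> (\<rho> - y) * ((X - \<rho>) + (X - y))" using 3 y by (intro mult_nonneg_nonneg) auto
      moreover have "X\<^sup>2 / 2 - (X - \<rho>)\<^sup>2 / 2 - (y * X - y\<^sup>2 / 2) = (\<rho> - y) * ((X - \<rho>) + (X - y)) / 2"
        by (simp add: field_simps power2_eq_square)
      moreover have "max X 0 = X" "max (X - \<rho>) 0 = X - \<rho>" using 3 \<rho> by auto
      ultimately show ?thesis by simp
    qed
  qed
  also have "\<dots> = kin_ent k (lambda1 (\<rho>, m)) (lambda2 (\<rho>, m))"
    using \<rho> by (simp add: kin_ent_def ent_prim_def lambda_eq X_def algebra_simps)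
  finally show ?thesis .
qed

text \<open>The optimal fraction is the part of the interval above the level \<open>k\<close>.\<close>

lemma kin_ent_attained:
  assumes \<rho>: "\<rho> > 0"
  obtains p where "0 \<le> p" "p \<le> 1"
    "kin_ent k (lambda1 (\<rho>, m)) (lambda2 (\<rho>, m)) = p * (m - k * \<rho>) + p * (1 - p) * \<rho>\<^sup>2 / 2"
proof -
  define X where "X = m / \<rho> + \<rho> / 2 - k"
  define y where "y = max 0 (min X \<rho>)"
  define p where "p = y / \<rho>"
  have y: "0 \<le> y" "y \<le> \<rho>" "y = p * \<rho>" using \<rho> by (auto simp: y_def p_def)
  have "p * (m - k * \<rho>) + p * (1 - p) * \<rho>\<^sup>2 / 2 = y * X - y\<^sup>2 / 2"
    unfolding y(3) using \<rho> by (simp add: X_def field_simps power2_eq_square)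
  also have "\<dots> = (max X 0)\<^sup>2 / 2 - (max (X - \<rho>) 0)\<^sup>2 / 2"
    using \<rho> by (auto simp: y_def max_def min_def field_simps power2_eq_square)
  also have "\<dots> = kin_ent k (lambda1 (\<rho>, m)) (lambda2 (\<rho>, m))"
    using \<rho> by (simp add: kin_ent_def ent_prim_def lambda_eq X_def algebra_simps)
  finally have eq: "p * (m - k * \<rho>) + p * (1 - p) * \<rho>\<^sup>2 / 2
      = kin_ent k (lambda1 (\<rho>, m)) (lambda2 (\<rho>, m))" .
  have "0 \<le> p" "p \<le> 1"
    using y(1,2) \<rho> by (simp_all add: p_def)
  then show thesis by (rule that[OF _ _ eq[symmetric]])
qed

lemma convex_states: "convex states"
  unfolding states_def by (intro convex_Times) auto

text \<open>
  By \<open>kin_ent_ge\<close> and \<open>kin_ent_attained\<close> the entropy is a maximum of convex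
  functions. The reflection \<open>s = - 1\<close> of the momentum exchanges \<open>lambda2\<close>
  and \<open>- lambda1\<close>.
\<close>

lemma convex_kin_ent:
  assumes s: "\<bar>s\<bar> = 1"
  shows "convex_on states (\<lambda>w. kin_ent k (lambda1 (fst w, s * snd w)) (lambda2 (fst w, s * snd w)))"
proof (rule convex_onI[OF _ convex_states])
  fix t :: real and x y :: "real \<times> real"
  assume t: "0 < t" "t < 1" and xy: "x \<in> states" "y \<in> states"
  let ?z = "(1 - t) *\<^sub>R x + t *\<^sub>R y"
  let ?E = "\<lambda>w. kin_ent k (lambda1 (fst w, s * snd w)) (lambda2 (fst w, s * snd w))"
  have pos: "0 < fst x" "0 < fst y" using xy by (auto simp: states_def)
  then have z: "0 < fst ?z" using t by (simp add: add_pos_pos)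
  obtain p where p: "0 \<le> p" "p \<le> 1"
    and E: "?E ?z = p * (s * snd ?z - k * fst ?z) + p * (1 - p) * (fst ?z)\<^sup>2 / 2"
    using kin_ent_attained[OF z] by metis
  have sq: "(fst ?z)\<^sup>2 \<le> (1 - t) * (fst x)\<^sup>2 + t * (fst y)\<^sup>2"
  proof -
    have "(1 - t) * (fst x)\<^sup>2 + t * (fst y)\<^sup>2 - (fst ?z)\<^sup>2 = t * (1 - t) * (fst x - fst y)\<^sup>2"
      by (simp add: power2_eq_square algebra_simps)
    also have "\<dots> \<ge> 0" using t by simp
    finally show ?thesis by simp
  qed
  have "p * (1 - p) * (fst ?z)\<^sup>2 / 2 \<le> p * (1 - p) * ((1 - t) * (fst x)\<^sup>2 + t * (fst y)\<^sup>2) / 2"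
    using p sq by (intro divide_right_mono mult_left_mono mult_nonneg_nonneg) auto
  then have "?E ?z \<le> (1 - t) * (p * (s * snd x - k * fst x) + p * (1 - p) * (fst x)\<^sup>2 / 2)
      + t * (p * (s * snd y - k * fst y) + p * (1 - p) * (fst y)\<^sup>2 / 2)"
    unfolding E by (simp add: algebra_simps add_divide_distrib diff_divide_distrib)
  also have "\<dots> \<le> (1 - t) * ?E x + t * ?E y"
    using t kin_ent_ge[OF pos(1) p, of "s * snd x" k] kin_ent_ge[OF pos(2) p, of "s * snd y" k]
    by (intro add_mono mult_left_mono) auto
  finally show "?E ?z \<le> (1 - t) * ?E x + t * ?E y" .
qed

lemma lambda_deriv:
  assumes "w \<in> states"
  shows "(lambda1 has_derivative (\<lambda>v. (snd v - lambda2 w * fst v) / fst w)) (at w)"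
    and "(lambda2 has_derivative (\<lambda>v. (snd v - lambda1 w * fst v) / fst w)) (at w)"
    and "(flux has_derivative (\<lambda>v. (snd v, 2 * (snd w / fst w) * snd v - (snd w / fst w)\<^sup>2 * fst v
           + (fst w)\<^sup>2 / 4 * fst v))) (at w)"
proof -
  have w: "fst w > 0" using assms by (auto simp: states_def)
  have l: "lambda1 = (\<lambda>w. snd w / fst w - fst w / 2)" "lambda2 = (\<lambda>w. snd w / fst w + fst w / 2)"
    "flux = (\<lambda>w. (snd w, (snd w)\<^sup>2 / fst w + (fst w) ^ 3 / 12))"
    by (auto simp: lambda1_def lambda2_def flux_def split: prod.splits)
  show "(lambda1 has_derivative (\<lambda>v. (snd v - lambda2 w * fst v) / fst w)) (at w)"
    unfolding l using w
    by (auto intro!: derivative_eq_intros ext simp: field_simps)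
  show "(lambda2 has_derivative (\<lambda>v. (snd v - lambda1 w * fst v) / fst w)) (at w)"
    unfolding l using w
    by (auto intro!: derivative_eq_intros ext simp: field_simps)
  show "(flux has_derivative (\<lambda>v. (snd v, 2 * (snd w / fst w) * snd v - (snd w / fst w)\<^sup>2 * fst v
           + (fst w)\<^sup>2 / 4 * fst v))) (at w)"
    unfolding l using w
    by (auto intro!: derivative_eq_intros ext simp: field_simps power2_eq_square power3_eq_cube)
qed

text \<open>
  The Riemann invariants diagonalise the system:
  \<open>lambda1' \<circ> flux' = lambda1 * lambda1'\<close> and likewise for
  \<open>lambda2\<close>. Hence a function of a single invariant \<open>v\<close> with derivative
  \<open>e(v)\<close> has a flux with derivative \<open>v * e(v)\<close>.
\<close>

lemma entropy_pair_primitives: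
  assumes conv: "convex_on states (\<lambda>w. E2 (lambda2 w) - E1 (lambda1 w))"
    and E: "\<And>v. (E1 has_real_derivative e1 v) (at v)" "\<And>v. (E2 has_real_derivative e2 v) (at v)"
    and P: "\<And>v. (P1 has_real_derivative v * e1 v) (at v)" "\<And>v. (P2 has_real_derivative v * e2 v) (at v)"
  shows "entropy_pair (\<lambda>w. E2 (lambda2 w) - E1 (lambda1 w)) (\<lambda>w. P2 (lambda2 w) - P1 (lambda1 w))"
proof -
  have dE: "((\<lambda>w. G2 (lambda2 w) - G1 (lambda1 w)) has_derivative
       (\<lambda>v. g2 (lambda2 w) * ((snd v - lambda1 w * fst v) / fst w)
          - g1 (lambda1 w) * ((snd v - lambda2 w * fst v) / fst w))) (at w)"
    if "w \<in> states" "\<And>v. (G1 has_real_derivative g1 v) (at v)" "\<And>v. (G2 has_real_derivative g2 v) (at v)"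
    for w G1 G2 g1 g2
    by (intro has_derivative_diff has_derivative_compose[OF lambda_deriv(1)[OF that(1)]]
        has_derivative_compose[OF lambda_deriv(2)[OF that(1)]])
       (use that in \<open>auto simp: has_field_derivative_def\<close>)
  show ?thesis
    unfolding entropy_pair_def
  proof (intro conjI ballI conv)
    show "continuous_on states (\<lambda>w. E2 (lambda2 w) - E1 (lambda1 w))"
      using dE[OF _ E] by (intro continuous_at_imp_continuous_on ballI has_derivative_continuous) blast
    show "continuous_on states (\<lambda>w. P2 (lambda2 w) - P1 (lambda1 w))"
      using dE[OF _ P] by (intro continuous_at_imp_continuous_on ballI has_derivative_continuous) blast
    fix w assume w: "w \<in> states"
    then have pos: "fst w > 0" by (auto simp: states_def)
    let ?D = "\<lambda>v. e2 (lambda2 w) * ((snd v - lambda1 w * fst v) / fst w)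
          - e1 (lambda1 w) * ((snd v - lambda2 w * fst v) / fst w)"
    let ?F = "\<lambda>v. (snd v, 2 * (snd w / fst w) * snd v - (snd w / fst w)\<^sup>2 * fst v + (fst w)\<^sup>2 / 4 * fst v)"
    have l: "lambda1 w = snd w / fst w - fst w / 2" "lambda2 w = snd w / fst w + fst w / 2"
      by (cases w; simp add: lambda_eq)+
    have c1: "snd (?F v) - lambda1 w * fst (?F v) = lambda2 w * (snd v - lambda1 w * fst v)"
      and c2: "snd (?F v) - lambda2 w * fst (?F v) = lambda1 w * (snd v - lambda2 w * fst v)" for v
      unfolding l fst_conv snd_conv by (simp_all add: algebra_simps power2_eq_square)
    have "?D \<circ> ?F = (\<lambda>v. (lambda2 w * e2 (lambda2 w)) * ((snd v - lambda1 w * fst v) / fst w)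
          - (lambda1 w * e1 (lambda1 w)) * ((snd v - lambda2 w * fst v) / fst w))"
      unfolding o_def c1 c2 by (simp add: mult_ac)
    then show "\<exists>D Df. ((\<lambda>w. E2 (lambda2 w) - E1 (lambda1 w)) has_derivative D) (at w) \<and>
        (flux has_derivative Df) (at w) \<and>
        ((\<lambda>w. P2 (lambda2 w) - P1 (lambda1 w)) has_derivative (D \<circ> Df)) (at w)"
      using dE[OF w E] lambda_deriv(3)[OF w] dE[OF w P]
      by (intro exI[of _ ?D] exI[of _ ?F]) simp
  qed
qed

lemma entropy_pair_upper:
  "entropy_pair (\<lambda>w. kin_ent k (lambda1 w) (lambda2 w)) (\<lambda>w. kin_flux k (lambda1 w) (lambda2 w))"
  unfolding kin_ent_def kin_flux_def
  by (rule entropy_pair_primitives[where ?e1.0="\<lambda>v. max (v - k) 0" and ?e2.0="\<lambda>v. max (v - k) 0"])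
    (use convex_kin_ent[of 1 k] in \<open>auto simp: kin_ent_def intro: ent_prim_deriv flux_prim_deriv\<close>)

lemma entropy_pair_lower:
  "entropy_pair (\<lambda>w. kin_ent k (- lambda2 w) (- lambda1 w)) (\<lambda>w. - kin_flux k (- lambda2 w) (- lambda1 w))"
proof -
  have d: "((\<lambda>v. - ent_prim k (- v)) has_real_derivative max (- v - k) 0) (at v)"
    "((\<lambda>v. flux_prim k (- v)) has_real_derivative v * max (- v - k) 0) (at v)" for v
  proof -
    have m: "((\<lambda>v::real. - v) has_real_derivative - 1) (at v)"
      by (auto intro!: derivative_eq_intros)
    show "((\<lambda>v. - ent_prim k (- v)) has_real_derivative max (- v - k) 0) (at v)"
      using DERIV_minus[OF DERIV_chain2[OF ent_prim_deriv m]] by simp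
    show "((\<lambda>v. flux_prim k (- v)) has_real_derivative v * max (- v - k) 0) (at v)"
      using DERIV_chain2[OF flux_prim_deriv m] by simp
  qed
  have refl: "lambda1 (fst w, - snd w) = - lambda2 w" "lambda2 (fst w, - snd w) = - lambda1 w" for w
    by (cases w; simp add: lambda_eq)+
  have "convex_on states (\<lambda>w. - ent_prim k (- lambda2 w) - (- ent_prim k (- lambda1 w)))"
    using convex_kin_ent[of "-1" k] by (simp add: kin_ent_def refl)
  from entropy_pair_primitives[OF this d(1) d(1) d(2) d(2)]
  show ?thesis by (simp add: kin_ent_def kin_flux_def)
qed

section \<open>One-sided control along a curve\<close>

lemma nn_integral_plane:
  assumes [measurable]: "F \<in> borel_measurable (borel \<Otimes>\<^sub>M borel)"
  shows "(\<integral>\<^sup>+z. F z \<partial>(lborel :: (real \<times> real) measure)) = (\<integral>\<^sup>+t. \<integral>\<^sup>+x. F (t, x) \<partial>lborel \<partial>lborel)"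
    and "(\<integral>\<^sup>+z. F z \<partial>(lborel :: (real \<times> real) measure)) = (\<integral>\<^sup>+x. \<integral>\<^sup>+t. F (t, x) \<partial>lborel \<partial>lborel)"
proof -
  have m: "F \<in> borel_measurable (lborel \<Otimes>\<^sub>M lborel)"
    using assms by (simp add: measurable_cong_sets[OF sets_pair_measure_cong[OF sets_lborel sets_lborel] refl])
  show "(\<integral>\<^sup>+z. F z \<partial>lborel) = (\<integral>\<^sup>+t. \<integral>\<^sup>+x. F (t, x) \<partial>lborel \<partial>lborel)"
    using lborel.nn_integral_fst[OF m] by (simp add: lborel_prod)
  then show "(\<integral>\<^sup>+z. F z \<partial>lborel) = (\<integral>\<^sup>+x. \<integral>\<^sup>+t. F (t, x) \<partial>lborel \<partial>lborel)"
    using lborel_pair.Fubini[OF m] by simp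
qed

lemma nn_integral_translate:
  fixes F :: "real \<Rightarrow> ennreal"
  assumes [measurable]: "F \<in> borel_measurable borel"
  shows "(\<integral>\<^sup>+x. F (v + x) \<partial>lborel) = (\<integral>\<^sup>+x. F x \<partial>lborel)"
proof -
  have "(\<integral>\<^sup>+x. F x \<partial>lborel) = (\<integral>\<^sup>+x. F x \<partial>distr lborel borel ((+) v))"
    by (simp add: lborel_distr_plus)
  also have "\<dots> = (\<integral>\<^sup>+x. F (v + x) \<partial>lborel)"
    by (rule nn_integral_distr) auto
  finally show ?thesis by simp
qed

lemma nn_integral_shear:
  assumes [measurable]: "F \<in> borel_measurable (borel \<Otimes>\<^sub>M borel)" "h \<in> borel_measurable borel"
  shows "(\<integral>\<^sup>+z. F z \<partial>(lborel :: (real \<times> real) measure)) = (\<integral>\<^sup>+y. \<integral>\<^sup>+t. F (t, h t + y) \<partial>lborel \<partial>lborel)"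
proof -
  have "(\<integral>\<^sup>+z. F z \<partial>lborel) = (\<integral>\<^sup>+t. \<integral>\<^sup>+x. F (t, x) \<partial>lborel \<partial>lborel)"
    by (rule nn_integral_plane) simp
  also have "\<dots> = (\<integral>\<^sup>+t. \<integral>\<^sup>+y. F (t, h t + y) \<partial>lborel \<partial>lborel)"
    by (intro nn_integral_cong nn_integral_translate[symmetric]) simp
  also have "\<dots> = (\<integral>\<^sup>+z. F (fst z, h (fst z) + snd z) \<partial>lborel)"
    by (subst nn_integral_plane(1)) simp_all
  also have "\<dots> = (\<integral>\<^sup>+y. \<integral>\<^sup>+t. F (t, h t + y) \<partial>lborel \<partial>lborel)"
    by (subst nn_integral_plane(2)) simp_all
  finally show ?thesis .
qed

definition excess :: "real \<Rightarrow> (real \<times> real \<Rightarrow> real) \<Rightarrow> (real \<Rightarrow> real) \<Rightarrow> (real \<Rightarrow> real) \<Rightarrow> real \<Rightarrow> ennreal" where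
  "excess T F h K y = (\<integral>\<^sup>+t. indicator {0..T} t * ennreal (max (F (t, h t + y) - K t) 0) \<partial>lborel)"

context kinetic_family
begin

text \<open>
  The points where \<open>f\<close> exceeds an almost everywhere bound that it satisfies in a
  neighbourhood. With rational squares and levels this is one null set, valid for the uncountably many
  squares and levels that \<open>control_along_curve\<close> attaches to the points of the curve.
\<close>

definition exceptional :: "(real \<times> real) set" where
  "exceptional = (\<Union>(p, r, k) \<in> {(p, r, k) \<in> (\<rat> \<times> \<rat>) \<times> \<rat> \<times> \<rat>. AE z in lborel. z \<in> square p r \<longrightarrow> f z \<le> k}.
      {z \<in> square p r. k < f z})"

lemma exceptional_null: "exceptional \<in> null_sets lborel"
  unfolding exceptional_def
proof (rule null_sets_UN', safe)
  have "countable ((\<rat> \<times> \<rat>) \<times> \<rat> \<times> \<rat> :: ((real \<times> real) \<times> real \<times> real) set)"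
    by (intro countable_SIGMA countable_rat)
  then show "countable {(p, r, k) \<in> (\<rat> \<times> \<rat>) \<times> \<rat> \<times> (\<rat>::real set). AE z in lborel. z \<in> square p r \<longrightarrow> f z \<le> k}"
    by (rule countable_subset[rotated]) auto
  fix a b r k :: real
  assume *: "AE z in lborel. z \<in> square (a, b) r \<longrightarrow> f z \<le> k"
  note [measurable] = f_meas
  have "{z \<in> space borel. z \<in> square (a, b) r \<and> k < f z} \<in> sets borel" by measurable
  then have "{z \<in> square (a, b) r. k < f z} \<in> sets lborel" by simp
  then show "{z \<in> square (a, b) r. k < f z} \<in> null_sets lborel"
    by (subst AE_iff_null_sets) (use * in \<open>auto elim!: eventually_mono\<close>)
qed

lemma outside_exceptional:
  assumes ae: "AE z in lborel. z \<in> square c s \<longrightarrow> f z \<le> k" and s: "s > 0" and k: "k < k'"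
    and c: "c \<notin> exceptional"
  shows "f c \<le> k'"
proof (rule ccontr)
  assume "\<not> f c \<le> k'"
  obtain l where l: "l \<in> \<rat>" "k < l" "l < k'" using Rats_dense_in_real[OF k] by auto
  obtain r where r: "r \<in> \<rat>" "0 < r" "r < s / 2" using Rats_dense_in_real[of 0 "s/2"] s by auto
  obtain a where a: "a \<in> \<rat>" "fst c - r < a" "a < fst c" using Rats_dense_in_real[of "fst c - r" "fst c"] r by auto
  obtain b where b: "b \<in> \<rat>" "snd c - r < b" "b < snd c" using Rats_dense_in_real[of "snd c - r" "snd c"] r by auto
  have "square (a, b) r \<subseteq> square c s"
    using a b r by (auto simp: square_def)
  then have "AE z in lborel. z \<in> square (a, b) r \<longrightarrow> f z \<le> l"
    using ae l(2) by (auto elim!: eventually_mono)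
  moreover have "c \<in> square (a, b) r" using a b by (auto simp: square_def)
  moreover have "l < f c" using l \<open>\<not> f c \<le> k'\<close> by linarith
  ultimately have "c \<in> exceptional"
    unfolding exceptional_def using a b r l by (intro UN_I[of "((a, b), r, l)"]) auto
  with c show False by simp
qed

text \<open>
  For a good time \<open>t\<close>, \<open>small_mass_imp_bound\<close> is applied at level
  \<open>K t\<close> to the square of radius \<open>s = \<gamma> R\<close> around
  \<open>(t, h t + y)\<close>. The factor \<open>\<gamma>\<close> is chosen such that this square,
  seen from the moving curve, stays within distance \<open>\<epsilon> R\<close> of \<open>y\<close> and
  hence in \<open>J\<close>. The mass in the square is at most \<open>M (G1 t + G2 t)\<close>,
  where \<open>G1\<close> integrates the excess over the level and \<open>G2\<close> the oscillation of
  the level in time. Both have integrals of order \<open>R s e\<close> with \<open>e\<close>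
  arbitrarily small, while the admissible mass is of order \<open>s\<^sup>2\<close>, so Markov's
  inequality bounds the measure of the bad times by a multiple of \<open>e\<close>.
\<close>

theorem control_along_curve:
  fixes h K :: "real \<Rightarrow> real" and J :: "real set"
  assumes T: "T > 0" and L: "0 \<le> L" "\<And>s t. \<bar>h s - h t\<bar> \<le> L * \<bar>s - t\<bar>"
    and K_meas: "K \<in> borel_measurable borel" and K_le: "\<And>t. \<bar>K t\<bar> \<le> M"
    and J: "J \<in> sets borel"
    and trace: "\<And>e. e > 0 \<Longrightarrow> \<exists>R>0. AE y in lborel. y \<in> J \<and> \<bar>y\<bar> < R \<longrightarrow>
        excess T f h K y \<le> ennreal e"
    and eps: "\<epsilon> > 0" and del: "\<delta> > 0"
  shows "\<exists>R0>0. \<forall>R. 0 < R \<and> R < R0 \<longrightarrow> (\<exists>Bad\<in>sets borel. emeasure lborel Bad \<le> ennreal \<delta> \<and>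
      (\<forall>t\<in>{0..T} - Bad. \<forall>y. \<bar>y\<bar> < R \<and> (\<forall>y'. \<bar>y' - y\<bar> \<le> \<epsilon> * R \<longrightarrow> y' \<in> J) \<and> (t, h t + y) \<notin> exceptional
          \<longrightarrow> f (t, h t + y) \<le> K t + \<delta>))"
proof -
  note [measurable] = K_meas J
  have f_meas' [measurable]: "f \<in> borel_measurable (borel \<Otimes>\<^sub>M borel)"
    using f_meas by (simp add: borel_prod)
  have h_cont: "continuous_on UNIV h"
    unfolding continuous_on_iff
  proof (intro ballI allI impI)
    fix x e :: real assume "e > 0"
    have "L * d < e" if "0 \<le> d" "d < e / (L + 1)" for d
    proof -
      have "L * d \<le> (L + 1) * d" using that by (simp add: algebra_simps)
      also have "\<dots> < e" using that L(1) by (simp add: field_simps)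
      finally show ?thesis .
    qed
    then show "\<exists>d>0. \<forall>x'\<in>UNIV. dist x' x < d \<longrightarrow> dist (h x') (h x) < e"
      using \<open>e > 0\<close> L le_less_trans[OF L(2)]
      by (intro exI[of _ "e / (L + 1)"]) (auto simp: dist_real_def)
  qed
  then have [measurable]: "h \<in> borel_measurable borel"
    by (intro borel_measurable_continuous_onI)
  define \<epsilon>' where "\<epsilon>' = min \<epsilon> 1"
  have e': "0 < \<epsilon>'" "\<epsilon>' \<le> \<epsilon>" "\<epsilon>' \<le> 1" using eps by (auto simp: \<epsilon>'_def)
  define \<gamma> where "\<gamma> = \<epsilon>' / (1 + L)"
  have \<gamma>: "0 < \<gamma>" "(1 + L) * \<gamma> = \<epsilon>'" using e' L by (auto simp: \<gamma>_def)
  define d where "d = min (\<delta> / 2) d0"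
  have d: "0 < d" "d \<le> d0" "d < \<delta>" using pos del by (auto simp: d_def)
  define c1 where "c1 = \<kappa> * d ^ 3 / (4096 * gain * M)"
  have c1: "0 < c1" using pos d gain_pos by (simp add: c1_def)
  define e where "e = \<delta> * c1 * \<gamma> / 32"
  have e: "0 < e" using del c1 \<gamma> by (simp add: e_def)
  obtain R1 where R1: "R1 > 0" "AE y in lborel. y \<in> J \<and> \<bar>y\<bar> < R1 \<longrightarrow>
        excess T f h K y \<le> ennreal e"
    using trace[OF e] by blast
  define K' where "K' t = indicator {0..T} t * K t" for t
  have K'_meas [measurable]: "K' \<in> borel_measurable borel" unfolding K'_def by simp
  have K'_le: "\<bar>K' t\<bar> \<le> M" for t using K_le[of t] pos by (auto simp: K'_def indicator_def)
  obtain d1 where d1: "d1 > 0" "\<And>v. norm v < d1 \<Longrightarrow> (LBINT t. \<bar>K' (t + v) - K' t\<bar>) < e"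
    by (rule translation_continuous_L1[OF K'_meas K'_le bounded_closed_interval[of 0 T] _ e])
      (auto simp: K'_def)
  have tame_K': "tame K'"
    by (rule tameI[OF bmeasI[OF K'_meas K'_le], of T]) (auto simp: K'_def indicator_def split: if_splits)
  define R0 where "R0 = min (R1 / 2) (min (\<delta> / (4 * \<gamma>)) (d1 / \<gamma>))"
  have "R0 > 0" using R1 d1 del \<gamma> by (simp add: R0_def)
  moreover have "\<exists>Bad\<in>sets borel. emeasure lborel Bad \<le> ennreal \<delta> \<and>
      (\<forall>t\<in>{0..T} - Bad. \<forall>y. \<bar>y\<bar> < R \<and> (\<forall>y'. \<bar>y' - y\<bar> \<le> \<epsilon> * R \<longrightarrow> y' \<in> J) \<and> (t, h t + y) \<notin> exceptional
          \<longrightarrow> f (t, h t + y) \<le> K t + \<delta>)" if R: "0 < R" "R < R0" for R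
  proof -
    have R': "2 * R \<le> R1" using R by (simp add: R0_def)
    define s where "s = \<gamma> * R"
    have s: "0 < s" "s < \<delta> / 4" "s < d1" "(1 + L) * s = \<epsilon>' * R"
    proof -
      have "R < \<delta> / (4 * \<gamma>)" "R < d1 / \<gamma>" using R by (simp_all add: R0_def)
      then show "s < \<delta> / 4" "s < d1"
        using \<gamma>(1) by (simp_all add: s_def pos_less_divide_eq mult_ac)
      show "0 < s" using R \<gamma> by (simp add: s_def)
      show "(1 + L) * s = \<epsilon>' * R" by (simp only: s_def mult.assoc[symmetric] \<gamma>(2))
    qed
    define g1 where "g1 z = indicator {0..T} (fst z) * indicator (J \<inter> {-2*R<..<2*R}) (snd z - h (fst z))
        * ennreal (max (f z - K (fst z)) 0)" for z
    define G1 where "G1 t0 = (\<integral>\<^sup>+z. indicator {-s..s} (fst z - t0) * g1 z \<partial>lborel)" for t0 :: real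
    define G2 where "G2 t0 = (\<integral>\<^sup>+z. indicator {-s..s} (fst z - t0) * indicator {-2*R<..<2*R} (snd z - h (fst z))
        * ennreal \<bar>K' (fst z) - K' t0\<bar> \<partial>lborel)" for t0 :: real
    have [measurable]: "g1 \<in> borel_measurable (borel \<Otimes>\<^sub>M borel)" unfolding g1_def by measurable
    have G1_eq: "G1 t0 = (\<integral>\<^sup>+t. \<integral>\<^sup>+x. indicator {-s..s} (t - t0) * g1 (t, x) \<partial>lborel \<partial>lborel)" for t0
      unfolding G1_def by (subst nn_integral_plane(1)) simp_all
    have len: "(\<integral>\<^sup>+x. indicator {a<..<b} (x - c) \<partial>lborel) = ennreal (b - a)" if "a \<le> b" for a b c :: real
    proof -
      have "(\<integral>\<^sup>+x. indicator {a<..<b} (x - c) \<partial>lborel) = (\<integral>\<^sup>+x. indicator {a<..<b} (c + x - c) \<partial>lborel)"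
        by (rule nn_integral_translate[symmetric]) simp
      then show ?thesis using that by simp
    qed
    have len': "(\<integral>\<^sup>+t0. indicator {-s..s} (t - t0) \<partial>lborel) = ennreal (2 * s)" for t :: real
    proof -
      have "(\<integral>\<^sup>+t0. indicator {-s..s} (t - t0) \<partial>lborel) = (\<integral>\<^sup>+t0. indicator {t - s..t + s} t0 \<partial>(lborel::real measure))"
        by (intro nn_integral_cong) (auto simp: indicator_def)
      then show ?thesis using s by simp
    qed
    have G2_eq: "G2 t0 = ennreal (4 * R) * (\<integral>\<^sup>+t. indicator {-s..s} (t - t0) * ennreal \<bar>K' t - K' t0\<bar> \<partial>lborel)" for t0
    proof -
      have "G2 t0 = (\<integral>\<^sup>+t. \<integral>\<^sup>+x. (indicator {-s..s} (t - t0) * ennreal \<bar>K' t - K' t0\<bar>) * indicator {-2*R<..<2*R} (x - h t) \<partial>lborel \<partial>lborel)"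
        unfolding G2_def by (subst nn_integral_plane(1)) (simp_all add: mult_ac)
      also have "\<dots> = (\<integral>\<^sup>+t. (indicator {-s..s} (t - t0) * ennreal \<bar>K' t - K' t0\<bar>) * ennreal (4 * R) \<partial>lborel)"
        using R by (intro nn_integral_cong) (simp add: nn_integral_cmult len)
      also have "\<dots> = (\<integral>\<^sup>+t. indicator {-s..s} (t - t0) * ennreal \<bar>K' t - K' t0\<bar> \<partial>lborel) * ennreal (4 * R)"
        by (rule nn_integral_multc) measurable
      finally show ?thesis by (simp only: mult.commute[of _ "ennreal (4 * R)"])
    qed
    have mG1 [measurable]: "G1 \<in> borel_measurable borel"
      unfolding G1_eq by measurable
    have mG2 [measurable]: "G2 \<in> borel_measurable borel"
      unfolding G2_eq by measurable
    \<comment> \<open>The shear that straightens the curve preserves Lebesgue measure, so the trace hypothesis can be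
      integrated in \<open>y\<close>.\<close>
    have "(\<integral>\<^sup>+z. g1 z \<partial>lborel) = (\<integral>\<^sup>+y. \<integral>\<^sup>+t. g1 (t, h t + y) \<partial>lborel \<partial>lborel)"
      by (rule nn_integral_shear) simp_all
    also have "\<dots> \<le> (\<integral>\<^sup>+y. ennreal e * indicator {-2*R<..<2*R} y \<partial>lborel)"
    proof (rule nn_integral_mono_AE)
      show "AE y in lborel. (\<integral>\<^sup>+t. g1 (t, h t + y) \<partial>lborel) \<le> ennreal e * indicator {-2*R<..<2*R} y"
        using R1(2)
      proof eventually_elim
        case (elim y)
        have "(\<integral>\<^sup>+t. g1 (t, h t + y) \<partial>lborel) = indicator (J \<inter> {-2*R<..<2*R}) y *
          (\<integral>\<^sup>+t. indicator {0..T} t * ennreal (max (f (t, h t + y) - K t) 0) \<partial>lborel)"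
          by (subst nn_integral_cmult[symmetric]) (simp_all add: g1_def mult_ac)
        also have "\<dots> \<le> ennreal e * indicator {-2*R<..<2*R} y"
          using elim R' by (auto simp: indicator_def excess_def)
        finally show ?case .
      qed
    qed
    also have "\<dots> = ennreal (4 * R * e)"
      using R e by (simp add: nn_integral_cmult ennreal_mult'[symmetric] mult.commute)
    finally have g1_le: "(\<integral>\<^sup>+z. g1 z \<partial>lborel) \<le> ennreal (4 * R * e)" .
    have "(\<integral>\<^sup>+t0. G1 t0 \<partial>lborel) = (\<integral>\<^sup>+z. \<integral>\<^sup>+t0. indicator {-s..s} (fst z - t0) * g1 z \<partial>lborel \<partial>lborel)"
      unfolding G1_def lborel_prod[symmetric]
      by (rule pair_sigma_finite.Fubini'[symmetric]) (unfold_locales, simp)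
    also have "\<dots> = (\<integral>\<^sup>+z. ennreal (2 * s) * g1 z \<partial>lborel)"
      by (intro nn_integral_cong) (simp add: nn_integral_multc len')
    also have "\<dots> = ennreal (2 * s) * (\<integral>\<^sup>+z. g1 z \<partial>lborel)"
      by (rule nn_integral_cmult) (simp add: borel_prod[symmetric])
    also have "\<dots> \<le> ennreal (2 * s) * ennreal (4 * R * e)"
      by (intro mult_left_mono g1_le) simp
    also have "\<dots> = ennreal (8 * R * s * e)"
      using s R e by (simp add: ennreal_mult'[symmetric] mult_ac)
    finally have I1: "(\<integral>\<^sup>+t0. G1 t0 \<partial>lborel) \<le> ennreal (8 * R * s * e)" .
    have "(\<integral>\<^sup>+t0. \<integral>\<^sup>+t. indicator {-s..s} (t - t0) * ennreal \<bar>K' t - K' t0\<bar> \<partial>lborel \<partial>lborel)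
      = (\<integral>\<^sup>+t0. \<integral>\<^sup>+v. indicator {-s..s} v * ennreal \<bar>K' (t0 + v) - K' t0\<bar> \<partial>lborel \<partial>lborel)"
    proof (rule nn_integral_cong)
      fix t0 :: real
      show "(\<integral>\<^sup>+t. indicator {-s..s} (t - t0) * ennreal \<bar>K' t - K' t0\<bar> \<partial>lborel)
        = (\<integral>\<^sup>+v. indicator {-s..s} v * ennreal \<bar>K' (t0 + v) - K' t0\<bar> \<partial>lborel)"
        by (subst nn_integral_translate[where v=t0, symmetric]) simp_all
    qed
    also have "\<dots> = (\<integral>\<^sup>+v. \<integral>\<^sup>+t0. indicator {-s..s} v * ennreal \<bar>K' (t0 + v) - K' t0\<bar> \<partial>lborel \<partial>lborel)"
      by (rule lborel_pair.Fubini') simp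
    also have "\<dots> \<le> (\<integral>\<^sup>+v. ennreal e * indicator {-s..s} v \<partial>lborel)"
    proof (rule nn_integral_mono)
      fix v :: real
      show "(\<integral>\<^sup>+t0. indicator {-s..s} v * ennreal \<bar>K' (t0 + v) - K' t0\<bar> \<partial>lborel) \<le> ennreal e * indicator {-s..s} v"
      proof (cases "v \<in> {-s..s}")
        case True
        then have v: "norm v < d1" using s by auto
        have int: "integrable lborel (\<lambda>t. \<bar>K' (t + v) - K' t\<bar>)"
        proof (intro tame_integrable tame_abs tame_diff tame_K')
          show "tame (\<lambda>t. K' (t + v))"
          proof (rule tameI[where r="T + \<bar>v\<bar>"])
            show "bmeas (\<lambda>t. K' (t + v))" by (rule bmeas_compose[OF tame_bmeas[OF tame_K']]) simp
            show "K' (t + v) \<noteq> 0 \<Longrightarrow> norm t \<le> T + \<bar>v\<bar>" for t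
              by (auto simp: K'_def indicator_def split: if_splits)
          qed
        qed
        have "(\<integral>\<^sup>+t0. ennreal \<bar>K' (t0 + v) - K' t0\<bar> \<partial>lborel) = ennreal (LBINT t0. \<bar>K' (t0 + v) - K' t0\<bar>)"
          by (rule nn_integral_eq_integral[OF int]) simp
        also have "\<dots> \<le> ennreal e" using d1(2)[OF v] by (intro ennreal_leI) simp
        finally show ?thesis using True by simp
      qed simp
    qed
    also have "\<dots> = ennreal (2 * s * e)"
      using s e by (simp add: nn_integral_cmult ennreal_mult'[symmetric] mult.commute)
    finally have "(\<integral>\<^sup>+t0. \<integral>\<^sup>+t. indicator {-s..s} (t - t0) * ennreal \<bar>K' t - K' t0\<bar> \<partial>lborel \<partial>lborel) \<le> ennreal (2 * s * e)" .
    then have "(\<integral>\<^sup>+t0. G2 t0 \<partial>lborel) \<le> ennreal (4 * R) * ennreal (2 * s * e)"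
      unfolding G2_eq by (subst nn_integral_cmult) (auto intro!: mult_left_mono)
    also have "\<dots> = ennreal (8 * R * s * e)"
      using s R e by (simp add: ennreal_mult'[symmetric] mult_ac)
    finally have I2: "(\<integral>\<^sup>+t0. G2 t0 \<partial>lborel) \<le> ennreal (8 * R * s * e)" .
    define \<theta> where "\<theta> = c1 * s\<^sup>2"
    have \<theta>: "0 < \<theta>" using c1 s by (simp add: \<theta>_def)
    define B2 where "B2 = {t0 \<in> space lborel. 1 \<le> ennreal (1 / \<theta>) * (G1 t0 + G2 t0)}"
    have B2_sets [measurable]: "B2 \<in> sets borel"
      unfolding B2_def space_lborel space_borel[symmetric] by measurable
    have "emeasure lborel B2 = emeasure lborel (B2 \<inter> UNIV)" by simp
    have "emeasure lborel B2 \<le> ennreal (1 / \<theta>) * (\<integral>\<^sup>+t0. G1 t0 + G2 t0 \<partial>lborel)"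
      using nn_integral_Markov_inequality[of "\<lambda>t0. G1 t0 + G2 t0" UNIV lborel "ennreal (1 / \<theta>)"]
      by (simp add: B2_def)
    also have "\<dots> \<le> ennreal (1 / \<theta>) * (ennreal (8 * R * s * e) + ennreal (8 * R * s * e))"
      using I1 I2 by (subst nn_integral_add) (auto intro!: mult_left_mono add_mono)
    also have "\<dots> = ennreal (1 / \<theta> * (16 * R * s * e))"
      using R s e \<theta> by (simp add: ennreal_plus[symmetric] ennreal_mult[symmetric] del: ennreal_plus)
    also have "1 / \<theta> * (16 * R * s * e) = \<delta> / 2"
      using R \<gamma> c1 by (simp add: \<theta>_def e_def s_def field_simps power2_eq_square)
    finally have B2_le: "emeasure lborel B2 \<le> ennreal (\<delta> / 2)" .
    \<comment> \<open>Times close to \<open>0\<close> or \<open>T\<close> are discarded, since the squares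
      around them leave the strip.\<close>
    define Bad where "Bad = {0..s} \<union> {T - s..T} \<union> B2"
    have Bad_sets: "Bad \<in> sets borel" unfolding Bad_def by measurable
    have "emeasure lborel Bad \<le> emeasure lborel {0..s} + emeasure lborel {T - s..T} + emeasure lborel B2"
      unfolding Bad_def
      by (intro order_trans[OF emeasure_subadditive] add_mono emeasure_subadditive) auto
    also have "\<dots> \<le> ennreal s + ennreal s + ennreal (\<delta> / 2)"
      using s B2_le by (intro add_mono) simp_all
    also have "\<dots> \<le> ennreal \<delta>"
      using s del by (simp add: ennreal_plus[symmetric] del: ennreal_plus)
    finally have Bad_le: "emeasure lborel Bad \<le> ennreal \<delta>" .
    have "f (t0, h t0 + y0) \<le> K t0 + \<delta>"
      if t0: "t0 \<in> {0..T} - Bad" and y0: "\<bar>y0\<bar> < R" "\<And>y'. \<bar>y' - y0\<bar> \<le> \<epsilon> * R \<Longrightarrow> y' \<in> J"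
        "(t0, h t0 + y0) \<notin> exceptional" for t0 y0
    proof -
      let ?z = "(t0, h t0 + y0)"
      have t0': "s < t0" "t0 < T - s" "t0 \<in> {0..T}" and nB: "t0 \<notin> B2" using t0 by (auto simp: Bad_def)
      have nB': "ennreal (1 / \<theta>) * (G1 t0 + G2 t0) < 1" using nB by (simp add: B2_def)
      have "G1 t0 + G2 t0 = ennreal \<theta> * (ennreal (1 / \<theta>) * (G1 t0 + G2 t0))"
        using \<theta> by (simp add: mult.assoc[symmetric] ennreal_mult[symmetric])
      also have "\<dots> \<le> ennreal \<theta> * 1" using nB' by (intro mult_left_mono) auto
      finally have G: "G1 t0 + G2 t0 \<le> ennreal \<theta>" by simp
      have pw: "ennreal (indicator (square ?z s) z * \<eta> (K t0) z) \<le> ennreal M *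
         (indicator {-s..s} (fst z - t0) * g1 z + indicator {-s..s} (fst z - t0) * indicator {-2*R<..<2*R} (snd z - h (fst z))
           * ennreal \<bar>K' (fst z) - K' t0\<bar>)" for z
      proof (cases "z \<in> square ?z s")
        case True
        obtain t x where z: "z = (t, x)" by (cases z)
        have tx: "\<bar>t - t0\<bar> \<le> s" "\<bar>x - (h t0 + y0)\<bar> \<le> s" using True by (auto simp: z square_def)
        have t: "t \<in> {0..T}" using tx t0' by auto
        have "\<bar>h t0 - h t\<bar> \<le> L * s"
          using L(2)[of t0 t] mult_left_mono[OF tx(1) L(1)] by (simp add: abs_minus_commute)
        then have "\<bar>(x - h t) - y0\<bar> \<le> (1 + L) * s" using tx(2) by (simp add: algebra_simps)
        then have y: "\<bar>(x - h t) - y0\<bar> \<le> \<epsilon>' * R" by (simp add: s(4))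
        have "\<epsilon>' * R \<le> \<epsilon> * R" "\<epsilon>' * R \<le> 1 * R" using e' R by (intro mult_right_mono; simp)+
        then have J': "x - h t \<in> J \<inter> {-2*R<..<2*R}"
          using y y0(1) y0(2)[of "x - h t"] by auto
        have K'eq: "K' t = K t" "K' t0 = K t0" using t t0' by (simp_all add: K'_def)
        have "\<eta> (K t0) z \<le> M * max (f z - K t0) 0"
          by (rule upper) (use K_le[of t0] in linarith)
        also have "\<dots> \<le> M * (max (f z - K t) 0 + \<bar>K' t - K' t0\<bar>)"
          using pos unfolding K'eq by (intro mult_left_mono) auto
        finally have "ennreal (\<eta> (K t0) z) \<le> ennreal M * (ennreal (max (f z - K t) 0) + ennreal \<bar>K' t - K' t0\<bar>)"
          using pos by (simp add: ennreal_mult[symmetric] ennreal_plus[symmetric] ennreal_leI del: ennreal_plus)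
        then show ?thesis
          using True J' t tx by (simp add: g1_def z abs_le_iff)
      qed simp
      have "ennreal (mass (K t0) ?z s) = (\<integral>\<^sup>+z. ennreal (indicator (square ?z s) z * \<eta> (K t0) z) \<partial>lborel)"
        unfolding mass_def by (rule nn_integral_eq_integral[symmetric, OF integrable_mass]) (simp add: eta_nonneg)
      also have "\<dots> \<le> (\<integral>\<^sup>+z. ennreal M *
         (indicator {-s..s} (fst z - t0) * g1 z + indicator {-s..s} (fst z - t0) * indicator {-2*R<..<2*R} (snd z - h (fst z))
           * ennreal \<bar>K' (fst z) - K' t0\<bar>) \<partial>lborel)"
        by (rule nn_integral_mono) (rule pw)
      also have "\<dots> = ennreal M * (G1 t0 + G2 t0)"
        unfolding G1_def G2_def lborel_prod[symmetric] by (simp add: nn_integral_cmult nn_integral_add)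
      also have "\<dots> \<le> ennreal M * ennreal \<theta>" using G by (intro mult_left_mono) auto
      also have "\<dots> = ennreal (M * \<theta>)" using pos \<theta> by (simp add: ennreal_mult)
      finally have "mass (K t0) ?z s \<le> M * \<theta>" using pos \<theta> by (simp add: ennreal_le_iff)
      then have "4096 * gain * mass (K t0) ?z s \<le> 4096 * gain * (M * \<theta>)"
        using gain_pos by (intro mult_left_mono) auto
      also have "\<dots> = \<kappa> * d ^ 3 * s\<^sup>2"
        using gain_pos pos by (simp add: \<theta>_def c1_def)
      finally have "AE z in lborel. z \<in> square ?z (s / 2) \<longrightarrow> f z \<le> K t0 + d"
        using K_le[of t0] d s t0' by (intro small_mass_imp_bound) auto
      then show ?thesis
        by (rule outside_exceptional) (use s d y0 in auto)
    qed
    then show ?thesis using Bad_sets Bad_le by (intro bexI[of _ Bad]) auto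
  qed
  ultimately show ?thesis by blast
qed

end

section \<open>Borel representatives\<close>

text \<open>
  A closed set of states on which the Riemann invariants are bounded and Lipschitz continuous:
  \<open>\<rho>\<close> is bounded below by \<open>c\<close>, and \<open>\<rho>\<close> and
  \<open>\<bar>m / \<rho>\<bar>\<close> are bounded by \<open>V\<close>.
\<close>

definition admissible :: "real \<Rightarrow> real \<Rightarrow> (real \<times> real) set" where
  "admissible c V = {w. c \<le> fst w \<and> fst w \<le> V \<and> \<bar>snd w\<bar> \<le> V * fst w}"

lemma closed_admissible: "closed (admissible c V)"
proof -
  have "admissible c V = {w. c \<le> fst w} \<inter> {w. fst w \<le> V} \<inter> {w. \<bar>snd w\<bar> \<le> V * fst w}"
    by (auto simp: admissible_def)
  then show ?thesis
    by (auto intro!: closed_Int closed_Collect_le continuous_intros)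
qed

lemma lambda_fst_snd: "lambda1 w = snd w / fst w - fst w / 2" "lambda2 w = snd w / fst w + fst w / 2"
  by (simp_all add: lambda1_def lambda2_def split: prod.splits)

lemma lambda_diff: "lambda2 w - lambda1 w = fst w"
  by (simp add: lambda_fst_snd)

lemma lambda_bounds:
  assumes "0 < c" and w: "w \<in> admissible c V"
  shows "- (2 * V) \<le> lambda1 w" "lambda2 w \<le> 2 * V" "c \<le> lambda2 w - lambda1 w"
proof -
  have p: "0 < fst w" "fst w \<le> V" "\<bar>snd w\<bar> \<le> V * fst w" "c \<le> fst w"
    using assms by (auto simp: admissible_def)
  then have "\<bar>snd w / fst w\<bar> \<le> V" by (simp add: divide_le_eq)
  then have "- V \<le> snd w / fst w" "snd w / fst w \<le> V" by linarith+
  with p show "- (2 * V) \<le> lambda1 w" "lambda2 w \<le> 2 * V" by (simp_all add: lambda_fst_snd)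
  show "c \<le> lambda2 w - lambda1 w" using p by (simp add: lambda_diff)
qed

lemma lambda_lipschitz:
  assumes c: "0 < c" and w: "w \<in> admissible c V" "w' \<in> admissible c V"
  shows "\<bar>lambda1 w - lambda1 w'\<bar> \<le> ((1 + V) / c + 1) * norm (w - w')"
    and "\<bar>lambda2 w - lambda2 w'\<bar> \<le> ((1 + V) / c + 1) * norm (w - w')"
proof -
  have p: "0 < fst w" "0 < fst w'" "c \<le> fst w" "\<bar>snd w'\<bar> \<le> V * fst w'" "0 \<le> V"
    using assms by (auto simp: admissible_def)
  have "w - w' = (fst w - fst w', snd w - snd w')" by (simp add: prod_eq_iff)
  then have n: "\<bar>fst w - fst w'\<bar> \<le> norm (w - w')" "\<bar>snd w - snd w'\<bar> \<le> norm (w - w')"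
    using norm_fst_le[of "fst w - fst w'" "snd w - snd w'"] norm_snd_le[of "snd w - snd w'" "fst w - fst w'"]
    by simp_all
  have "snd w / fst w - snd w' / fst w' = ((snd w - snd w') - snd w' / fst w' * (fst w - fst w')) / fst w"
    using p by (simp add: field_simps)
  also have "\<bar>\<dots>\<bar> \<le> (norm (w - w') + V * norm (w - w')) / c"
  proof -
    have "\<bar>snd w' / fst w'\<bar> \<le> V" using p by (simp add: divide_le_eq)
    then have "\<bar>snd w' / fst w' * (fst w - fst w')\<bar> \<le> V * norm (w - w')"
      unfolding abs_mult using n p by (intro mult_mono) auto
    then have "\<bar>(snd w - snd w') - snd w' / fst w' * (fst w - fst w')\<bar> \<le> norm (w - w') + V * norm (w - w')"
      using n by linarith
    then show ?thesis unfolding abs_divide using p c by (intro frac_le) auto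
  qed
  finally have "\<bar>snd w / fst w - snd w' / fst w'\<bar> \<le> (1 + V) / c * norm (w - w')"
    by (simp add: algebra_simps)
  with n(1) show "\<bar>lambda1 w - lambda1 w'\<bar> \<le> ((1 + V) / c + 1) * norm (w - w')"
    and "\<bar>lambda2 w - lambda2 w'\<bar> \<le> ((1 + V) / c + 1) * norm (w - w')"
    unfolding lambda_fst_snd distrib_right by linarith+
qed

lemma borel_fst_snd [measurable]:
  "(fst :: real \<times> real \<Rightarrow> real) \<in> borel_measurable borel"
  "(snd :: real \<times> real \<Rightarrow> real) \<in> borel_measurable borel"
  by (auto intro!: borel_measurable_continuous_onI continuous_intros)

lemma lambda_measurable [measurable]:
  "lambda1 \<in> borel_measurable borel" "lambda2 \<in> borel_measurable borel"
  unfolding lambda_fst_snd[abs_def] by measurable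

lemma AE_lebesgue_on_iff:
  fixes S :: "'a::euclidean_space set"
  assumes "S \<in> sets borel"
  shows "(AE x in lebesgue_on S. P x) \<longleftrightarrow> (AE x in lborel. x \<in> S \<longrightarrow> P x)"
  using assms by (simp add: AE_restrict_space_iff AE_completion_iff)

lemma spacetime_borel [measurable]: "spacetime \<in> sets borel"
  unfolding spacetime_def by (intro borel_open open_Times) auto

lemma ex_borel_representative:
  fixes g :: "'a::euclidean_space \<Rightarrow> real \<times> real"
  assumes S: "S \<in> sets borel" and g: "g \<in> borel_measurable (lebesgue_on S)"
  obtains g' where "g' \<in> borel_measurable borel" "AE x in lborel. x \<in> S \<longrightarrow> g x = g' x"
proof -
  have S': "S \<inter> space lebesgue \<in> sets lebesgue" using S by simp
  have "(\<lambda>x. p (g x)) \<in> borel_measurable (lebesgue_on S)" if "p \<in> borel_measurable borel" for p :: "real \<times> real \<Rightarrow> real"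
    by (rule measurable_compose[OF g that])
  then have "(\<lambda>x. indicator S x *\<^sub>R p (g x)) \<in> borel_measurable lebesgue" if "p \<in> borel_measurable borel" for p :: "real \<times> real \<Rightarrow> real"
    by (rule borel_measurable_restrict_space_iff[OF S', THEN iffD1]) (use that in blast)
  from completion_ex_borel_measurable_real[OF this[OF borel_fst_snd(1)]]
    completion_ex_borel_measurable_real[OF this[OF borel_fst_snd(2)]]
  obtain a b where [measurable]: "a \<in> borel_measurable lborel" "b \<in> borel_measurable lborel"
    and ab: "AE x in lborel. indicator S x *\<^sub>R fst (g x) = a x" "AE x in lborel. indicator S x *\<^sub>R snd (g x) = b x"
    by blast
  show thesis
  proof (rule that[of "\<lambda>x. (a x, b x)"])
    have "(\<lambda>x. (a x, b x)) \<in> lborel \<rightarrow>\<^sub>M borel \<Otimes>\<^sub>M borel" by measurable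
    then show "(\<lambda>x. (a x, b x)) \<in> borel_measurable borel" by (simp add: borel_prod)
    show "AE x in lborel. x \<in> S \<longrightarrow> g x = (a x, b x)"
      using ab by eventually_elim (auto simp: prod_eq_iff)
  qed
qed

text \<open>
  A Lebesgue measurable function is replaced by a Borel function that satisfies the bounds everywhere,
  so that the integrals below are over \<open>lborel\<close>, where Fubini's theorem is available
  without completion.
\<close>

lemma ex_admissible_representative:
  fixes g :: "'a::euclidean_space \<Rightarrow> real \<times> real"
  assumes S: "S \<in> sets borel" and g: "g \<in> borel_measurable (lebesgue_on S)"
    and adm: "AE x in lborel. x \<in> S \<longrightarrow> g x \<in> admissible c V" and c: "0 < c" "c \<le> V"
  obtains g' where "g' \<in> borel_measurable borel" "AE x in lborel. x \<in> S \<longrightarrow> g x = g' x"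
    "\<And>x. g' x \<in> admissible c V"
proof -
  obtain g0 where [measurable]: "g0 \<in> borel_measurable borel" and g0: "AE x in lborel. x \<in> S \<longrightarrow> g x = g0 x"
    by (rule ex_borel_representative[OF S g])
  have [measurable]: "admissible c V \<in> sets borel" by (rule borel_closed[OF closed_admissible])
  show thesis
  proof (rule that[of "\<lambda>x. if g0 x \<in> admissible c V then g0 x else (c, 0)"])
    show "(\<lambda>x. if g0 x \<in> admissible c V then g0 x else (c, 0)) \<in> borel_measurable borel" by measurable
    show "AE x in lborel. x \<in> S \<longrightarrow> g x = (if g0 x \<in> admissible c V then g0 x else (c, 0))"
      using g0 adm by eventually_elim auto
    show "(if g0 x \<in> admissible c V then g0 x else (c, 0)) \<in> admissible c V" for x
      using c by (simp add: admissible_def)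
  qed
qed

lemma solution_admissible:
  assumes u: "bounded_entropy_solution u"
    and inf: "essinf (lebesgue_on spacetime) (\<lambda>z. fst (u z)) > 0"
  obtains c V where "0 < c" "c \<le> 1" "c \<le> V" "AE z in lborel. z \<in> spacetime \<longrightarrow> u z \<in> admissible c V"
proof -
  from u obtain C1 C2 where C: "AE z in lebesgue_on spacetime. norm (fst (u z)) \<le> C1"
    "AE z in lebesgue_on spacetime. norm (snd (u z) / fst (u z)) \<le> C2"
    unfolding bounded_entropy_solution_def Linfty_def by blast
  let ?E = "esssup (lebesgue_on spacetime) (\<lambda>z. - ereal (fst (u z)))"
  have "0 < - ?E" using inf by (simp add: essinf_def)
  then obtain c0 where c0: "0 < ereal c0" "ereal c0 < - ?E"
    using ereal_dense2 by (metis ereal_less(2) zero_ereal_def)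
  define c where "c = min c0 1"
  define V where "V = max 1 (max C1 C2)"
  have "AE z in lebesgue_on spacetime. - ereal (fst (u z)) \<le> ?E" by (rule esssup_AE)
  then have "AE z in lebesgue_on spacetime. u z \<in> admissible c V"
    using C
  proof eventually_elim
    case (elim z)
    have "?E < - ereal c0" by (rule ereal_less_uminus_reorder[THEN iffD1, OF c0(2)])
    with elim(1) have "- ereal (fst (u z)) < - ereal c0" by (rule le_less_trans)
    then have "c0 < fst (u z)" by simp
    then have 1: "c \<le> fst (u z)" "0 < fst (u z)" using c0 by (auto simp: c_def)
    have "\<bar>snd (u z)\<bar> \<le> C2 * fst (u z)" using elim(3) 1 by (simp add: divide_le_eq)
    also have "\<dots> \<le> V * fst (u z)" using 1 by (intro mult_right_mono) (auto simp: V_def)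
    finally show ?case using 1 elim(2) by (auto simp: admissible_def V_def)
  qed
  then show thesis
    using c0 by (intro that[of c V]) (auto simp: AE_lebesgue_on_iff c_def V_def)
qed

text \<open>
  Test functions are supported in \<open>spacetime\<close>, so the integral does not change when
  \<open>u\<close> is replaced by a representative that is defined on the whole plane.
\<close>

lemma entropy_imp_weak_subsolution:
  assumes u: "bounded_entropy_solution u" and ep: "entropy_pair E Q"
    and eq: "AE z in lborel. z \<in> spacetime \<longrightarrow> u z = v z"
    and bm: "bmeas (\<lambda>z. E (v z))" "bmeas (\<lambda>z. Q (v z))" and nn: "\<And>z. 0 \<le> E (v z)"
  shows "weak_subsolution (\<lambda>z. E (v z)) (\<lambda>z. Q (v z))"
  unfolding weak_subsolution_def
proof (intro conjI ballI allI impI bm nn)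
  fix \<phi> a b
  assume phi: "\<phi> \<in> test_functions" and phi_nn: "\<forall>z. 0 \<le> \<phi> z"
    and d: "\<forall>z. (\<phi> has_derivative (\<lambda>v. a z * fst v + b z * snd v)) (at z)"
  from phi obtain K where K: "compact K" "K \<subseteq> spacetime" "\<And>z. z \<notin> K \<Longrightarrow> \<phi> z = 0" and s: "\<And>k. C_upto k \<phi>"
    unfolding test_functions_def by blast
  have fd: "frechet_derivative \<phi> (at z) = (\<lambda>v. a z * fst v + b z * snd v)" for z
    by (rule frechet_derivative_at[OF d[rule_format], symmetric])
  obtain a' b' where d': "\<And>z. (\<phi> has_derivative (\<lambda>v. a' z * fst v + b' z * snd v)) (at z)"
    and c': "C_upto 0 a'" "C_upto 0 b'"
    by (rule C_upto_SucE[OF s[of "Suc 0"]]) (rule that)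
  have ab: "a z = a' z" "b z = b' z" for z
  proof -
    have "(\<lambda>v. a z * fst v + b z * snd v) = (\<lambda>v. a' z * fst v + b' z * snd v)"
      using has_derivative_unique[OF d[rule_format] d'] .
    from fun_cong[OF this, of "(1, 0)"] fun_cong[OF this, of "(0, 1)"] show "a z = a' z" "b z = b' z" by simp_all
  qed
  have [measurable]: "a \<in> borel_measurable borel" "b \<in> borel_measurable borel"
    using c' ab by (auto intro!: borel_measurable_continuous_onI simp: ab[abs_def])
  have zero: "a z = 0" "b z = 0" if "z \<notin> K" for z
  proof -
    have "((\<lambda>z. 0) has_derivative (\<lambda>v. 0)) (at z)" by simp
    then have "(\<phi> has_derivative (\<lambda>v. 0)) (at z)"
      by (rule has_derivative_transform_within_open[where s="- K"])
        (use K that open_Compl[OF compact_imp_closed[OF K(1)]] in auto)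
    from has_derivative_unique[OF d[rule_format] this]
    have "(\<lambda>v. a z * fst v + b z * snd v) = (\<lambda>v. 0)" .
    from fun_cong[OF this, of "(1, 0)"] fun_cong[OF this, of "(0, 1)"] show "a z = 0" "b z = 0" by simp_all
  qed
  let ?F = "\<lambda>z. E (v z) * a z + Q (v z) * b z"
  let ?G = "\<lambda>z. indicator spacetime z *\<^sub>R (E (u z) * a z + Q (u z) * b z)"
  note [measurable] = bm[THEN bmeas_measurable]
  have F: "?F \<in> borel_measurable lborel" by measurable
  have "AE z in lborel. ?F z = ?G z"
    using eq
  proof eventually_elim
    case (elim z)
    show ?case
    proof (cases "z \<in> spacetime")
      case False
      then have "z \<notin> K" using K(2) by blast
      then show ?thesis using False by (simp add: zero)
    qed (use elim in simp)
  qed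
  then have FG: "AE z in lebesgue. ?F z = ?G z" by (simp add: AE_completion_iff)
  have mF: "?F \<in> borel_measurable lebesgue" using F by (rule measurable_completion)
  have mG: "?G \<in> borel_measurable lebesgue" by (rule borel_measurable_AE[OF mF FG])
  have "distr_div_le_0 (\<lambda>z. E (u z)) (\<lambda>z. Q (u z))"
    using u ep unfolding bounded_entropy_solution_def by blast
  then have "div_action (\<lambda>z. E (u z)) (\<lambda>z. Q (u z)) \<phi> \<le> 0"
    using phi phi_nn unfolding distr_div_le_0_def by blast
  then have "0 \<le> (LINT z|lebesgue_on spacetime. E (u z) * a z + Q (u z) * b z)"
    by (simp add: div_action_def fd)
  also have "\<dots> = (LINT z|lebesgue. ?G z)"
    by (rule integral_restrict_space) simp
  also have "\<dots> = (LINT z|lebesgue. ?F z)"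
    by (rule integral_cong_AE[OF mG mF]) (use FG in eventually_elim, simp)
  also have "\<dots> = (LBINT z. ?F z)"
    by (rule integral_completion[OF F])
  finally show "0 \<le> (LBINT z. ?F z)" .
qed

lemma bmeas_kin:
  assumes lo: "lo \<in> borel_measurable borel" and hi: "hi \<in> borel_measurable borel"
    and bd: "\<And>z. - M \<le> lo z" "\<And>z. hi z \<le> M" "\<And>z. lo z \<le> hi z"
  shows "bmeas (\<lambda>z. kin_ent k (lo z) (hi z))" "bmeas (\<lambda>z. kin_flux k (lo z) (hi z))"
proof -
  have c: "continuous_on UNIV (ent_prim k)" "continuous_on UNIV (flux_prim k)"
    unfolding ent_prim_def flux_prim_def by (intro continuous_intros; simp)+
  note [measurable] = borel_measurable_continuous_onI[OF c(1)] borel_measurable_continuous_onI[OF c(2)] lo hi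
  have "bounded (ent_prim k ` {-M..M})" "bounded (flux_prim k ` {-M..M})"
    using c by (auto intro!: compact_imp_bounded compact_continuous_image intro: continuous_on_subset)
  then obtain A B where A': "\<forall>x\<in>ent_prim k ` {-M..M}. norm x \<le> A" and B': "\<forall>x\<in>flux_prim k ` {-M..M}. norm x \<le> B"
    unfolding bounded_iff by blast
  then have A: "\<And>v. v \<in> {-M..M} \<Longrightarrow> \<bar>ent_prim k v\<bar> \<le> A" and B: "\<And>v. v \<in> {-M..M} \<Longrightarrow> \<bar>flux_prim k v\<bar> \<le> B"
    by simp_all
  have r: "lo z \<in> {-M..M}" "hi z \<in> {-M..M}" for z
    using bd(1)[of z] bd(2)[of z] bd(3)[of z] by auto
  show "bmeas (\<lambda>z. kin_ent k (lo z) (hi z))"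
  proof (rule bmeasI[where C="A + A"])
    show "(\<lambda>z. kin_ent k (lo z) (hi z)) \<in> borel_measurable borel" unfolding kin_ent_def by measurable
    show "\<bar>kin_ent k (lo z) (hi z)\<bar> \<le> A + A" for z
      using A[OF r(1)[of z]] A[OF r(2)[of z]] unfolding kin_ent_def by linarith
  qed
  show "bmeas (\<lambda>z. kin_flux k (lo z) (hi z))"
  proof (rule bmeasI[where C="B + B"])
    show "(\<lambda>z. kin_flux k (lo z) (hi z)) \<in> borel_measurable borel" unfolding kin_flux_def by measurable
    show "\<bar>kin_flux k (lo z) (hi z)\<bar> \<le> B + B" for z
      using B[OF r(1)[of z]] B[OF r(2)[of z]] unfolding kin_flux_def by linarith
  qed
qed

lemma kinetic_familyI:
  assumes lo [measurable]: "lo \<in> borel_measurable borel" and hi [measurable]: "hi \<in> borel_measurable borel"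
    and bd: "\<And>z. - M \<le> lo z" "\<And>z. hi z \<le> M" and c: "0 < c" "c \<le> 1" "\<And>z. c \<le> hi z - lo z"
    and sg: "sg = 1 \<or> sg = - 1" and M: "M > 0"
    and sub: "\<And>k. weak_subsolution (\<lambda>z. kin_ent k (lo z) (hi z)) (\<lambda>z. sg * kin_flux k (lo z) (hi z))"
  shows "kinetic_family (\<lambda>k z. kin_ent k (lo z) (hi z)) (\<lambda>k z. sg * kin_flux k (lo z) (hi z)) hi
      M (c ^ 3 / (24 * (M + 1))) (c / 2) sg"
proof
  have le: "lo z < hi z" "lo z \<le> hi z" for z using c(1) c(3)[of z] by auto
  have sg2: "sg * sg = 1" "\<bar>sg\<bar> = 1" using sg by auto
  show "weak_subsolution (\<lambda>z. kin_ent k (lo z) (hi z)) (\<lambda>z. sg * kin_flux k (lo z) (hi z))" for k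
    by (rule sub)
  show "\<bar>sg * kin_flux k (lo z) (hi z)\<bar> \<le> M * kin_ent k (lo z) (hi z)" for k z
    unfolding abs_mult sg2 mult_1 by (intro kin_flux_le le bd)
  show "kin_ent l (lo z) (hi z) \<le> kin_ent k (lo z) (hi z)" if "k \<le> l" for k l z
    by (intro kin_ent_anti le that)
  show "c ^ 3 / (24 * (M + 1)) * d ^ 3 * kin_ent (k + d) (lo z) (hi z)
     \<le> sg * (sg * kin_flux (k + d) (lo z) (hi z) * kin_ent k (lo z) (hi z)
       - kin_ent (k + d) (lo z) (hi z) * (sg * kin_flux k (lo z) (hi z)))"
    if "- M \<le> k" "0 < d" "d \<le> c / 2" for k d z
  proof -
    have "sg * (sg * F * E - E' * (sg * F')) = (sg * sg) * (F * E - E' * F')" for F E E' F'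
      by (simp add: algebra_simps)
    then show ?thesis
      using kin_speed_gap[OF c(1,2) c(3)[of z] bd(1)[of z] bd(2)[of z] that] by (simp only: sg2 mult_1)
  qed
  show "hi z \<le> k" if "kin_ent k (lo z) (hi z) = 0" for k z
    by (rule kin_ent_pos[OF le(1) that])
  show "kin_ent k (lo z) (hi z) \<le> M * max (hi z - k) 0" if "- M \<le> k" for k z
    by (intro kin_ent_le that bd)
  show "0 < c ^ 3 / (24 * (M + 1))" "0 < c / 2" using c M by simp_all
qed (use sg M in auto)

lemma solution_kinetic_family:
  assumes u: "bounded_entropy_solution u"
    and eq: "AE z in lborel. z \<in> spacetime \<longrightarrow> u z = v z"
    and v [measurable]: "v \<in> borel_measurable borel" and adm: "\<And>z. v z \<in> admissible c V"
    and c: "0 < c" "c \<le> 1" "c \<le> V"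
  shows "kinetic_family (\<lambda>k z. kin_ent k (lambda1 (v z)) (lambda2 (v z)))
      (\<lambda>k z. 1 * kin_flux k (lambda1 (v z)) (lambda2 (v z))) (\<lambda>z. lambda2 (v z))
      (2 * V) (c ^ 3 / (24 * (2 * V + 1))) (c / 2) 1" (is ?A)
    and "kinetic_family (\<lambda>k z. kin_ent k (- lambda2 (v z)) (- lambda1 (v z)))
      (\<lambda>k z. - 1 * kin_flux k (- lambda2 (v z)) (- lambda1 (v z))) (\<lambda>z. - lambda1 (v z))
      (2 * V) (c ^ 3 / (24 * (2 * V + 1))) (c / 2) (- 1)" (is ?B)
proof -
  note b = lambda_bounds[OF c(1) adm]
  have le: "lambda1 (v z) \<le> lambda2 (v z)" for z using b(3)[of z] c by auto
  have b': "- (2 * V) \<le> - lambda2 (v z)" "- lambda1 (v z) \<le> 2 * V" "c \<le> - lambda1 (v z) - - lambda2 (v z)" for z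
    using b[of z] by auto
  have m: "(\<lambda>z. lambda1 (v z)) \<in> borel_measurable borel" "(\<lambda>z. lambda2 (v z)) \<in> borel_measurable borel"
    "(\<lambda>z. - lambda1 (v z)) \<in> borel_measurable borel" "(\<lambda>z. - lambda2 (v z)) \<in> borel_measurable borel"
    by measurable
  have V: "2 * V > 0" using c by simp
  show ?A
  proof (rule kinetic_familyI[OF m(1,2) b(1,2) c(1,2) b(3) _ V])
    show "weak_subsolution (\<lambda>z. kin_ent k (lambda1 (v z)) (lambda2 (v z))) (\<lambda>z. 1 * kin_flux k (lambda1 (v z)) (lambda2 (v z)))" for k
      unfolding mult_1
      by (rule entropy_imp_weak_subsolution[OF u entropy_pair_upper eq])
        (intro bmeas_kin[OF m(1,2) b(1,2) le] kin_ent_nonneg le)+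
  qed simp
  show ?B
  proof (rule kinetic_familyI[OF m(4,3) b'(1,2) c(1,2) b'(3) _ V])
    have le': "- lambda2 (v z) \<le> - lambda1 (v z)" for z using le[of z] by simp
    note bk = bmeas_kin[OF m(4,3) b'(1,2) le']
    show "weak_subsolution (\<lambda>z. kin_ent k (- lambda2 (v z)) (- lambda1 (v z))) (\<lambda>z. - 1 * kin_flux k (- lambda2 (v z)) (- lambda1 (v z)))" for k
      using entropy_imp_weak_subsolution[OF u entropy_pair_lower eq bk(1) _ kin_ent_nonneg[OF le']]
        bmeas_mult[OF bmeas_const[of "-1"] bk(2)] by simp
  qed simp
qed

section \<open>Traces\<close>

lemma AE_obtain_null:
  assumes "AE x in M. P x"
  obtains N where "N \<in> null_sets M" "\<And>x. x \<in> space M \<Longrightarrow> x \<notin> N \<Longrightarrow> P x"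
  using assms unfolding eventually_ae_filter by blast

text \<open>
  Shearing along the curve preserves null sets, and almost all sections of a null set are null.
\<close>

lemma AE_shear:
  fixes N :: "(real \<times> real) set"
  assumes N: "N \<in> null_sets lborel" and h [measurable]: "h \<in> borel_measurable borel"
  shows "AE t in lborel. AE y in lborel. (t, h t + y) \<notin> N"
    and "AE y in lborel. AE t in lborel. (t, h t + y) \<notin> N"
proof -
  have N': "N \<in> sets borel" using N by (auto simp: null_sets_def)
  then have m [measurable]: "(\<lambda>z. indicator N z :: ennreal) \<in> borel_measurable (borel \<Otimes>\<^sub>M borel)"
    by (simp add: borel_prod)
  have ms: "(\<lambda>y. indicator N (t, h t + y) :: ennreal) \<in> borel_measurable lborel"
    "(\<lambda>t. indicator N (t, h t + y) :: ennreal) \<in> borel_measurable lborel" for t y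
    by (rule measurable_compose[OF _ m], measurable)+
  have 0: "(\<integral>\<^sup>+z. indicator N z \<partial>lborel) = 0"
    using N N' by (simp add: null_sets_def)
  have "(\<integral>\<^sup>+t. \<integral>\<^sup>+y. indicator N (t, h t + y) \<partial>lborel \<partial>lborel) = (\<integral>\<^sup>+t. \<integral>\<^sup>+x. indicator N (t, x) \<partial>lborel \<partial>lborel)"
    by (intro nn_integral_cong nn_integral_translate) measurable
  also have "\<dots> = 0" using 0 nn_integral_plane(1)[OF m] by simp
  finally have "AE t in lborel. (\<integral>\<^sup>+y. indicator N (t, h t + y) \<partial>lborel) = 0"
    by (subst (asm) nn_integral_0_iff_AE) auto
  then show "AE t in lborel. AE y in lborel. (t, h t + y) \<notin> N"
  proof eventually_elim
    case (elim t)
    then have "AE y in lborel. indicator N (t, h t + y) = (0::ennreal)"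
      by (subst (asm) nn_integral_0_iff_AE[OF ms(1)])
    then show ?case by eventually_elim (auto simp: indicator_def)
  qed
  have "(\<integral>\<^sup>+y. \<integral>\<^sup>+t. indicator N (t, h t + y) \<partial>lborel \<partial>lborel) = 0"
    using 0 nn_integral_shear[OF m h] by simp
  then have "AE y in lborel. (\<integral>\<^sup>+t. indicator N (t, h t + y) \<partial>lborel) = 0"
    by (subst (asm) nn_integral_0_iff_AE) auto
  then show "AE y in lborel. AE t in lborel. (t, h t + y) \<notin> N"
  proof eventually_elim
    case (elim y)
    then have "AE t in lborel. indicator N (t, h t + y) = (0::ennreal)"
      by (subst (asm) nn_integral_0_iff_AE[OF ms(2)])
    then show ?case by eventually_elim (auto simp: indicator_def)
  qed
qed

lemma AE_lborel_uminus:
  assumes "AE y in lborel. P (y :: real)"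
  shows "AE y in lborel. P (- y)"
proof -
  from assms obtain N where N: "N \<in> null_sets lborel" "\<And>y. y \<notin> N \<Longrightarrow> P y"
    by (rule AE_obtain_null) simp
  then have "N \<in> sets borel" "emeasure lborel N = 0" by (auto simp: null_sets_def)
  then have "emeasure lborel (uminus -` N \<inter> space lborel) = emeasure (distr lborel borel uminus) N"
    by (subst emeasure_distr) auto
  also have "\<dots> = 0" using \<open>emeasure lborel N = 0\<close> by (simp add: lborel_distr_uminus)
  finally have "uminus -` N \<in> null_sets lborel"
    using measurable_sets[of uminus borel borel N] \<open>N \<in> sets borel\<close> by (simp add: null_sets_def)
  then have "AE y in lborel. y \<notin> uminus -` N" by (rule AE_not_in)
  then show ?thesis by eventually_elim (auto intro: N(2))
qed

lemma AE_sign: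
  assumes "AE y in lborel. P (y :: real)" and "s = 1 \<or> s = - 1"
  shows "AE y in lborel. P (s * y)"
  using assms AE_lborel_uminus[OF assms(1)] by auto

lemma nn_integral_lebesgue_on:
  assumes S: "S \<in> sets borel"
  shows "(\<integral>\<^sup>+t. F t \<partial>lebesgue_on S) = (\<integral>\<^sup>+t. F t * indicator S t \<partial>lebesgue)"
  using S by (intro nn_integral_restrict_space) simp

lemma strong_traces_side:
  fixes e :: real
  assumes tr: "strong_traces u h T up um" and e: "e > 0"
  shows "\<exists>R>0. AE y in lborel. 0 < y \<and> y < R \<longrightarrow>
      (\<integral>\<^sup>+t. ennreal (norm (u (t, h t + 1 * y) - up t)) \<partial>lebesgue_on {0..T}) \<le> ennreal e" (is ?A)
    and "\<exists>R>0. AE y in lborel. 0 < y \<and> y < R \<longrightarrow>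
      (\<integral>\<^sup>+t. ennreal (norm (u (t, h t + - 1 * y) - um t)) \<partial>lebesgue_on {0..T}) \<le> ennreal e" (is ?B)
proof -
  define I where "I y = (\<integral>\<^sup>+t. ennreal (norm (u (t, h t + y) - up t) + norm (u (t, h t - y) - um t))
                   \<partial>lebesgue_on {0..T})" for y
  have "(\<lambda>k. esssup (lebesgue_on {0<..<1 / real k}) I) \<longlonglongrightarrow> 0"
    using tr unfolding strong_traces_def I_def by blast
  then have "eventually (\<lambda>k. esssup (lebesgue_on {0<..<1 / real k}) I < ennreal e) sequentially"
  proof (rule order_tendstoD(2))
    show "0 < ennreal e" using e by simp
  qed
  then obtain n where n: "\<forall>k\<ge>n. esssup (lebesgue_on {0<..<1 / real k}) I < ennreal e"
    unfolding eventually_sequentially by blast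
  define k where "k = Suc n"
  have k: "k > 0" "esssup (lebesgue_on {0<..<1 / real k}) I < ennreal e"
    using n[rule_format, of "Suc n"] by (simp_all add: k_def)
  have "AE y in lebesgue_on {0<..<1 / real k}. I y \<le> esssup (lebesgue_on {0<..<1 / real k}) I"
    by (rule esssup_AE)
  then have "AE y in lborel. y \<in> {0<..<1 / real k} \<longrightarrow> I y \<le> esssup (lebesgue_on {0<..<1 / real k}) I"
    by (simp add: AE_lebesgue_on_iff)
  then have I: "AE y in lborel. 0 < y \<and> y < 1 / real k \<longrightarrow> I y \<le> ennreal e"
    by eventually_elim (use k(2) in \<open>auto dest: order.strict_implies_order order_trans\<close>)
  have "(\<integral>\<^sup>+t. ennreal (norm (u (t, h t + 1 * y) - up t)) \<partial>lebesgue_on {0..T}) \<le> I y"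
    and "(\<integral>\<^sup>+t. ennreal (norm (u (t, h t + - 1 * y) - um t)) \<partial>lebesgue_on {0..T}) \<le> I y" for y
    unfolding I_def by (intro nn_integral_mono ennreal_leI; simp)+
  with I k(1) show ?A ?B
    by (auto intro!: exI[of _ "1 / real k"] elim!: eventually_mono intro: order_trans)
qed

definition trace_gap :: "real \<Rightarrow> (real \<times> real \<Rightarrow> real \<times> real) \<Rightarrow> (real \<Rightarrow> real) \<Rightarrow> (real \<Rightarrow> real \<times> real) \<Rightarrow> real \<Rightarrow> ennreal"
  where "trace_gap T v hh w y = (\<integral>\<^sup>+t. indicator {0..T} t * ennreal (norm (v (t, hh t + y) - w t)) \<partial>lborel)"

text \<open>
  The trace can be replaced by a Borel function with admissible values everywhere. Its values are
  admissible almost everywhere because the admissible states form a closed set: the distance of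
  \<open>w t\<close> to this set is at most the distance to a value of \<open>v\<close>, and the latter
  tends to \<open>0\<close> in the mean.
\<close>

lemma trace_representative:
  fixes v :: "real \<times> real \<Rightarrow> real \<times> real"
  assumes eq: "AE z in lborel. z \<in> spacetime \<longrightarrow> u z = v z"
    and v [measurable]: "v \<in> borel_measurable borel" and v_adm: "\<And>z. v z \<in> admissible c V"
    and c: "0 < c" "c \<le> V" and T: "T > 0"
    and hh [measurable]: "hh \<in> borel_measurable borel" and hh_eq: "\<And>t. t \<in> {0..T} \<Longrightarrow> hh t = h t"
    and s: "s = 1 \<or> s = - 1"
    and up: "up \<in> borel_measurable (lebesgue_on {0..T})"
    and conv: "\<And>e. e > 0 \<Longrightarrow> \<exists>R>0. AE y in lborel. 0 < y \<and> y < R \<longrightarrow>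
      (\<integral>\<^sup>+t. ennreal (norm (u (t, h t + s * y) - up t)) \<partial>lebesgue_on {0..T}) \<le> ennreal e"
  obtains vp where "vp \<in> borel_measurable borel" "\<And>t. vp t \<in> admissible c V"
    "AE t in lborel. t \<in> {0..T} \<longrightarrow> up t = vp t"
    "\<forall>e>0. \<exists>R>0. AE y in lborel. 0 < y \<and> y < R \<longrightarrow>
      trace_gap T v hh vp (s * y) \<le> ennreal e"
proof -
  obtain w where w [measurable]: "w \<in> borel_measurable borel" and w_eq: "AE t in lborel. t \<in> {0..T} \<longrightarrow> up t = w t"
    by (rule ex_borel_representative[OF _ up]) (simp, rule that)
  obtain N0 where N0: "N0 \<in> null_sets lborel" "\<And>z. z \<notin> N0 \<Longrightarrow> z \<in> spacetime \<Longrightarrow> u z = v z"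
    using AE_obtain_null[OF eq] by (metis UNIV_I space_borel space_lborel)
  have vm [measurable]: "(\<lambda>t. v (t, hh t + y)) \<in> borel_measurable borel" for y
  proof (rule measurable_compose[OF _ v])
    have "(\<lambda>t. (t, hh t + y)) \<in> borel \<rightarrow>\<^sub>M borel \<Otimes>\<^sub>M borel" by measurable
    then show "(\<lambda>t. (t, hh t + y)) \<in> borel_measurable borel" by (simp add: borel_prod)
  qed
  have conv_w: "\<exists>R>0. AE y in lborel. 0 < y \<and> y < R \<longrightarrow>
      trace_gap T v hh w (s * y) \<le> ennreal e"
    if e: "e > 0" for e
  proof -
    obtain R where R: "R > 0" "AE y in lborel. 0 < y \<and> y < R \<longrightarrow>
      (\<integral>\<^sup>+t. ennreal (norm (u (t, h t + s * y) - up t)) \<partial>lebesgue_on {0..T}) \<le> ennreal e"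
      using conv[OF e] by blast
    have "AE y in lborel. AE t in lborel. (t, hh t + s * y) \<notin> N0"
      by (rule AE_sign[OF AE_shear(2)[OF N0(1) hh] s])
    with R(2) have "AE y in lborel. 0 < y \<and> y < R \<longrightarrow>
      trace_gap T v hh w (s * y) \<le> ennreal e"
    proof eventually_elim
      case (elim y)
      have "AE t in lborel. t \<noteq> (0::real)" by (rule AE_lborel_singleton)
      with elim(2) w_eq have "AE t in lborel. indicator {0..T} t * ennreal (norm (v (t, hh t + s * y) - w t))
          \<le> ennreal (norm (u (t, h t + s * y) - up t)) * indicator {0..T} t"
      proof eventually_elim
        case (elim t)
        then show ?case
          using N0(2)[of "(t, hh t + s * y)"] hh_eq[of t]
          by (cases "t \<in> {0..T}") (auto simp: spacetime_def)
      qed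
      then have ae: "AE t in lebesgue. indicator {0..T} t * ennreal (norm (v (t, hh t + s * y) - w t))
          \<le> ennreal (norm (u (t, h t + s * y) - up t)) * indicator {0..T} t"
        by (simp add: AE_completion_iff)
      have "trace_gap T v hh w (s * y)
        = (\<integral>\<^sup>+t. indicator {0..T} t * ennreal (norm (v (t, hh t + s * y) - w t)) \<partial>lebesgue)"
        unfolding trace_gap_def by (rule nn_integral_completion[symmetric])
      also have "\<dots> \<le> (\<integral>\<^sup>+t. ennreal (norm (u (t, h t + s * y) - up t)) * indicator {0..T} t \<partial>lebesgue)"
        by (rule nn_integral_mono_AE[OF ae])
      also have "\<dots> = (\<integral>\<^sup>+t. ennreal (norm (u (t, h t + s * y) - up t)) \<partial>lebesgue_on {0..T})"
        by (rule nn_integral_lebesgue_on[symmetric]) simp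
      finally show ?case using elim(1) by (auto intro: order_trans)
    qed
    with R(1) show ?thesis by blast
  qed
  have ne: "admissible c V \<noteq> {}" using v_adm by blast
  have "(\<integral>\<^sup>+t. indicator {0..T} t * ennreal (infdist (w t) (admissible c V)) \<partial>lborel) \<le> 0 + ennreal e" if e: "e > 0" for e
  proof -
    obtain R where R: "R > 0" "AE y in lborel. 0 < y \<and> y < R \<longrightarrow>
      trace_gap T v hh w (s * y) \<le> ennreal e"
      using conv_w[OF e] by blast
    have "\<exists>y. 0 < y \<and> y < R \<and>
      trace_gap T v hh w (s * y) \<le> ennreal e"
    proof (rule ccontr)
      assume "\<not> ?thesis"
      with R(2) have "AE y in lborel. y \<notin> {0<..<R}" by (auto elim!: eventually_mono)
      then have "emeasure lborel {0<..<R} = 0" by (subst (asm) AE_iff_measurable[of "{0<..<R}"]) auto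
      with R(1) show False by simp
    qed
    then obtain y where y: "trace_gap T v hh w (s * y) \<le> ennreal e"
      by blast
    have "infdist (w t) (admissible c V) \<le> norm (v (t, hh t + s * y) - w t)" for t
      using infdist_le[OF v_adm[of "(t, hh t + s * y)"], of "w t"]
      by (simp only: dist_norm norm_minus_commute[of "w t"])
    then have "(\<integral>\<^sup>+t. indicator {0..T} t * ennreal (infdist (w t) (admissible c V)) \<partial>lborel)
       \<le> trace_gap T v hh w (s * y)"
      unfolding trace_gap_def by (intro nn_integral_mono mult_left_mono ennreal_leI) auto
    with y show ?thesis by simp
  qed
  then have "(\<integral>\<^sup>+t. indicator {0..T} t * ennreal (infdist (w t) (admissible c V)) \<partial>lborel) \<le> 0"
    by (rule ennreal_le_epsilon)
  then have 0: "(\<integral>\<^sup>+t. indicator {0..T} t * ennreal (infdist (w t) (admissible c V)) \<partial>lborel) = 0"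
    by simp
  have [measurable]: "(\<lambda>t. infdist (w t) (admissible c V)) \<in> borel_measurable borel"
    by (rule measurable_compose[OF w]) (auto intro!: borel_measurable_continuous_onI continuous_intros)
  have adm0: "AE t in lborel. t \<in> {0..T} \<longrightarrow> w t \<in> admissible c V"
    using 0
  proof (subst (asm) nn_integral_0_iff_AE)
    assume "AE t in lborel. indicator {0..T} t * ennreal (infdist (w t) (admissible c V)) = 0"
    then show ?thesis
    proof eventually_elim
      case (elim t)
      show ?case
      proof
        assume "t \<in> {0..T}"
        with elim have "infdist (w t) (admissible c V) = 0"
          using infdist_nonneg[of "w t" "admissible c V"] by (simp add: ennreal_eq_0_iff)
        then show "w t \<in> admissible c V"
          by (simp add: in_closed_iff_infdist_zero[OF closed_admissible ne])
      qed
    qed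
  qed measurable
  have adm: "AE t in lborel. t \<in> {0..T} \<longrightarrow> up t \<in> admissible c V"
    using adm0 w_eq by eventually_elim auto
  have I: "{0..T} \<in> sets borel" by simp
  obtain vp where vp: "vp \<in> borel_measurable borel" "AE t in lborel. t \<in> {0..T} \<longrightarrow> up t = vp t"
    "\<And>t. vp t \<in> admissible c V"
    by (rule ex_admissible_representative[OF I up adm c]) (rule that)
  have vp_w: "AE t in lborel. t \<in> {0..T} \<longrightarrow> vp t = w t"
    using vp(2) w_eq by eventually_elim auto
  show thesis
  proof (rule that[OF vp(1,3,2)], intro allI impI)
    fix e :: real assume e: "e > 0"
    have "trace_gap T v hh vp (s * y)
       = trace_gap T v hh w (s * y)" for y
      unfolding trace_gap_def by (rule nn_integral_cong_AE) (use vp_w in eventually_elim, auto simp: indicator_def)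
    then show "\<exists>R>0. AE y in lborel. 0 < y \<and> y < R \<longrightarrow>
      trace_gap T v hh vp (s * y) \<le> ennreal e"
      using conv_w[OF e] by simp
  qed
qed

section \<open>Convergence of the essential suprema\<close>

lemma tendsto_0_ennrealI:
  fixes X :: "nat \<Rightarrow> ennreal"
  assumes "\<And>e. e > 0 \<Longrightarrow> eventually (\<lambda>n. X n \<le> ennreal e) sequentially"
  shows "X \<longlonglongrightarrow> 0"
proof (rule order_tendstoI)
  fix a :: ennreal assume "0 < a"
  obtain r where r: "r > 0" "ennreal r < a"
  proof (cases a)
    case (real b)
    with \<open>0 < a\<close> show thesis by (intro that[of "b / 2"]) (auto simp: ennreal_less_iff)
  next
    case top
    then show thesis by (intro that[of 1]) auto
  qed
  show "eventually (\<lambda>n. X n < a) sequentially"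
    using assms[OF r(1)] by eventually_elim (use r(2) in auto)
qed simp

text \<open>
  The bounds near the curve fail at some times, but the measure of these times tends to \<open>0\<close>
  with the distance from the curve; for bounded integrands this is as good as convergence almost
  everywhere.
\<close>

definition mostly :: "real \<Rightarrow> real \<Rightarrow> (real \<Rightarrow> bool) \<Rightarrow> bool" where
  "mostly T \<delta> P \<longleftrightarrow> (\<exists>Bad\<in>sets borel. emeasure lborel Bad \<le> ennreal \<delta> \<and>
     (AE t in lborel. t \<in> {0..T} - Bad \<longrightarrow> P t))"

lemma mostly_mono:
  assumes P: "mostly T \<delta> P" and imp: "AE t in lborel. t \<in> {0..T} \<longrightarrow> P t \<longrightarrow> Q t" and "\<delta> \<le> \<delta>'"
  shows "mostly T \<delta>' Q"
proof -
  obtain Bad where Bad: "Bad \<in> sets borel" "emeasure lborel Bad \<le> ennreal \<delta>"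
    "AE t in lborel. t \<in> {0..T} - Bad \<longrightarrow> P t"
    using P unfolding mostly_def by blast
  moreover have "AE t in lborel. t \<in> {0..T} - Bad \<longrightarrow> Q t"
    using Bad(3) imp by eventually_elim blast
  ultimately show ?thesis
    unfolding mostly_def using order_trans[OF Bad(2) ennreal_leI[OF assms(3)]] by blast
qed

lemma mostly_conj:
  assumes P: "mostly T a P" and Q: "mostly T b Q" and ab: "0 \<le> a" "0 \<le> b"
  shows "mostly T (a + b) (\<lambda>t. P t \<and> Q t)"
proof -
  obtain A where A: "A \<in> sets borel" "emeasure lborel A \<le> ennreal a"
    "AE t in lborel. t \<in> {0..T} - A \<longrightarrow> P t"
    using P unfolding mostly_def by blast
  obtain B where B: "B \<in> sets borel" "emeasure lborel B \<le> ennreal b"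
    "AE t in lborel. t \<in> {0..T} - B \<longrightarrow> Q t"
    using Q unfolding mostly_def by blast
  have "emeasure lborel (A \<union> B) \<le> emeasure lborel A + emeasure lborel B"
    using A B by (intro emeasure_subadditive) auto
  also have "\<dots> \<le> ennreal a + ennreal b" by (intro add_mono A B)
  also have "\<dots> = ennreal (a + b)" using ab by simp
  finally have "emeasure lborel (A \<union> B) \<le> ennreal (a + b)" .
  moreover have "AE t in lborel. t \<in> {0..T} - (A \<union> B) \<longrightarrow> P t \<and> Q t"
    using A(3) B(3) by eventually_elim blast
  ultimately show ?thesis
    unfolding mostly_def using A(1) B(1) by blast
qed

text \<open>
  Convergence in measure together with a uniform bound. The integrands will be essential suprema, whose
  measurability in \<open>t\<close> is unclear; they enter only through a measurable majorant.
\<close>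

lemma nn_integral_tendsto_0_mostly:
  fixes S :: "nat \<Rightarrow> real \<Rightarrow> ennreal"
  assumes T: "T > 0" and B: "0 \<le> B"
    and bd: "\<And>n. AE t in lborel. t \<in> {0..T} \<longrightarrow> S n t \<le> ennreal B"
    and small: "\<And>\<delta>. \<delta> > 0 \<Longrightarrow> eventually (\<lambda>n. mostly T \<delta> (\<lambda>t. S n t \<le> ennreal \<delta>)) sequentially"
  shows "(\<lambda>n. \<integral>\<^sup>+t. S n t \<partial>lebesgue_on {0..T}) \<longlonglongrightarrow> 0"
proof (rule tendsto_0_ennrealI)
  fix e :: real assume e: "e > 0"
  define \<delta> where "\<delta> = e / (T + B + 1)"
  have del: "\<delta> > 0" using e T B by (simp add: \<delta>_def)
  have "\<delta> * (T + B + 1) = e" using T B by (simp add: \<delta>_def)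
  then have le: "\<delta> * T + B * \<delta> \<le> e" using del by (simp add: algebra_simps)
  show "eventually (\<lambda>n. (\<integral>\<^sup>+t. S n t \<partial>lebesgue_on {0..T}) \<le> ennreal e) sequentially"
    using small[OF del]
  proof eventually_elim
    case (elim n)
    then obtain Bad where Bad [measurable]: "Bad \<in> sets borel" and Bad_le: "emeasure lborel Bad \<le> ennreal \<delta>"
      and S: "AE t in lborel. t \<in> {0..T} - Bad \<longrightarrow> S n t \<le> ennreal \<delta>" unfolding mostly_def by blast
    let ?F = "\<lambda>t. ennreal \<delta> * indicator {0..T} t + ennreal B * indicator Bad t"
    have "AE t in lborel. S n t * indicator {0..T} t \<le> ?F t"
      using bd[of n] S
    proof eventually_elim
      case (elim t)
      then show ?case by (cases "t \<in> {0..T}"; cases "t \<in> Bad") (auto intro: order_trans add_increasing)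
    qed
    then have ae: "AE t in lebesgue. S n t * indicator {0..T} t \<le> ?F t" by (simp add: AE_completion_iff)
    have "(\<integral>\<^sup>+t. S n t \<partial>lebesgue_on {0..T}) = (\<integral>\<^sup>+t. S n t * indicator {0..T} t \<partial>lebesgue)"
      by (rule nn_integral_lebesgue_on) simp
    also have "\<dots> \<le> (\<integral>\<^sup>+t. ?F t \<partial>lebesgue)" by (rule nn_integral_mono_AE[OF ae])
    also have "\<dots> = (\<integral>\<^sup>+t. ?F t \<partial>lborel)" by (rule nn_integral_completion)
    also have "\<dots> = ennreal \<delta> * ennreal T + ennreal B * emeasure lborel Bad"
      using T by (subst nn_integral_add) (simp_all add: nn_integral_cmult)
    also have "\<dots> \<le> ennreal \<delta> * ennreal T + ennreal B * ennreal \<delta>"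
      using Bad_le by (intro add_mono mult_left_mono) auto
    also have "\<dots> = ennreal (\<delta> * T + B * \<delta>)"
      using T B del by (simp add: ennreal_mult[symmetric] ennreal_plus[symmetric] del: ennreal_plus)
    also have "\<dots> \<le> ennreal e" using le by (rule ennreal_leI)
    finally show ?case .
  qed
qed

text \<open>
  The essential supremum of a non-measurable function is infinite; a function that agrees almost
  everywhere with a Borel function is Lebesgue measurable, so this does not occur.
\<close>

lemma esssup_le_representative:
  fixes \<psi> \<psi>' :: "real \<Rightarrow> real"
  assumes I: "I \<in> sets borel" and eq: "AE y in lborel. y \<in> I \<longrightarrow> \<psi> y = \<psi>' y"
    and m [measurable]: "\<psi>' \<in> borel_measurable borel" and le: "AE y in lborel. y \<in> I \<longrightarrow> \<psi>' y \<le> b"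
  shows "esssup (lebesgue_on I) (\<lambda>y. ennreal (\<psi> y)) \<le> ennreal b"
proof (rule esssup_I)
  note [measurable] = I
  have "AE y in lborel. indicator I y *\<^sub>R \<psi>' y = indicator I y *\<^sub>R \<psi> y"
    using eq by eventually_elim (auto simp: indicator_def)
  then have "AE y in lebesgue. indicator I y *\<^sub>R \<psi>' y = indicator I y *\<^sub>R \<psi> y" by (simp add: AE_completion_iff)
  moreover have "(\<lambda>y. indicator I y *\<^sub>R \<psi>' y) \<in> borel_measurable lebesgue"
    by (rule measurable_completion) measurable
  ultimately have "(\<lambda>y. indicator I y *\<^sub>R \<psi> y) \<in> borel_measurable lebesgue"
    by (rule borel_measurable_AE[rotated])
  then have "\<psi> \<in> borel_measurable (lebesgue_on I)"
    using I by (subst borel_measurable_restrict_space_iff) auto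
  then show "(\<lambda>y. ennreal (\<psi> y)) \<in> borel_measurable (lebesgue_on I)" by measurable
  show "AE y in lebesgue_on I. ennreal (\<psi> y) \<le> ennreal b"
    unfolding AE_lebesgue_on_iff[OF I] using eq le by eventually_elim (auto intro: ennreal_leI)
qed

lemma integral_esssup_tendsto_0:
  fixes \<psi> \<psi>' :: "real \<Rightarrow> real \<Rightarrow> real"
  assumes T: "T > 0" and I: "\<And>n. I n \<in> sets borel"
    and eq: "AE t in lborel. t \<in> {0..T} \<longrightarrow> (AE y in lborel. \<psi> t y = \<psi>' t y)"
    and m: "\<And>t. \<psi>' t \<in> borel_measurable borel" and bd: "\<And>t y. \<psi>' t y \<le> B" and B: "0 \<le> B"
    and small: "\<And>\<delta>. \<delta> > 0 \<Longrightarrow>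
      eventually (\<lambda>n. mostly T \<delta> (\<lambda>t. AE y in lborel. y \<in> I n \<longrightarrow> \<psi>' t y \<le> \<delta>)) sequentially"
  shows "(\<lambda>n. \<integral>\<^sup>+t. esssup (lebesgue_on (I n)) (\<lambda>y. ennreal (\<psi> t y)) \<partial>lebesgue_on {0..T}) \<longlonglongrightarrow> 0"
proof (rule nn_integral_tendsto_0_mostly[OF T B])
  have ess: "AE t in lborel. t \<in> {0..T} \<longrightarrow> (AE y in lborel. y \<in> I n \<longrightarrow> \<psi>' t y \<le> b) \<longrightarrow>
      esssup (lebesgue_on (I n)) (\<lambda>y. ennreal (\<psi> t y)) \<le> ennreal b" for n b
    using eq
  proof eventually_elim
    case (elim t)
    show ?case
    proof (intro impI esssup_le_representative[OF I _ m])
      assume "t \<in> {0..T}"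
      with elim have "AE y in lborel. \<psi> t y = \<psi>' t y" by blast
      then show "AE y in lborel. y \<in> I n \<longrightarrow> \<psi> t y = \<psi>' t y" by eventually_elim simp
    qed
  qed
  show "AE t in lborel. t \<in> {0..T} \<longrightarrow> esssup (lebesgue_on (I n)) (\<lambda>y. ennreal (\<psi> t y)) \<le> ennreal B" for n
    using ess[of n B] by eventually_elim (use bd in simp)
  fix \<delta> :: real assume "\<delta> > 0"
  from small[OF this]
  show "eventually (\<lambda>n. mostly T \<delta> (\<lambda>t. esssup (lebesgue_on (I n)) (\<lambda>y. ennreal (\<psi> t y)) \<le> ennreal \<delta>)) sequentially"
  proof eventually_elim
    case (elim n)
    show ?case by (rule mostly_mono[OF elim ess order_refl])
  qed
qed

section \<open>Solutions with traces along a curve\<close>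

text \<open>
  \<open>v\<close> is a Borel representative of \<open>u\<close>, and \<open>hh\<close> extends the
  curve \<open>h\<close> from \<open>{0..T}\<close> to a Lipschitz function on the whole line.
\<close>

locale traced_solution =
  fixes u v :: "real \<times> real \<Rightarrow> real \<times> real" and h hh :: "real \<Rightarrow> real" and T c V L :: real
  assumes eq: "AE z in lborel. z \<in> spacetime \<longrightarrow> u z = v z"
    and v_meas: "v \<in> borel_measurable borel" and v_adm: "\<And>z. v z \<in> admissible c V"
    and T: "T > 0"
    and L: "0 \<le> L" "\<And>s t. \<bar>hh s - hh t\<bar> \<le> L * \<bar>s - t\<bar>"
    and hh_meas: "hh \<in> borel_measurable borel"
    and hh_eq: "\<And>t. t \<in> {0..T} \<Longrightarrow> hh t = h t"
begin

lemma section_measurable: "(\<lambda>y. v (t, a + s * y)) \<in> borel_measurable borel"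
proof (rule measurable_compose[OF _ v_meas])
  have "(\<lambda>y. (t, a + s * y)) \<in> borel \<rightarrow>\<^sub>M borel \<Otimes>\<^sub>M borel" by measurable
  then show "(\<lambda>y. (t, a + s * y)) \<in> borel_measurable borel" by (simp add: borel_prod)
qed

lemma section_eq:
  assumes s: "s = 1 \<or> s = - 1"
  shows "AE t in lborel. t \<in> {0..T} \<longrightarrow> (AE y in lborel. u (t, h t + s * y) = v (t, hh t + s * y))"
proof -
  obtain N0 where N0: "N0 \<in> null_sets lborel" "\<And>z. z \<notin> N0 \<Longrightarrow> z \<in> spacetime \<Longrightarrow> u z = v z"
    using AE_obtain_null[OF eq] by (metis UNIV_I space_borel space_lborel)
  have "AE t in lborel. t \<noteq> (0::real)" by (rule AE_lborel_singleton)
  with AE_shear(1)[OF N0(1) hh_meas] show ?thesis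
  proof eventually_elim
    case (elim t)
    show ?case
    proof
      assume t: "t \<in> {0..T}"
      from AE_sign[OF elim(1) s] show "AE y in lborel. u (t, h t + s * y) = v (t, hh t + s * y)"
      proof eventually_elim
        case (elim y)
        then show ?case
          using N0(2)[of "(t, hh t + s * y)"] hh_eq[OF t] t \<open>t \<noteq> 0\<close> by (auto simp: spacetime_def)
      qed
    qed
  qed
qed

text \<open>
  \<open>w\<close> is the strong trace on the right (\<open>s = 1\<close>) or on the left
  (\<open>s = - 1\<close>) of the curve.
\<close>

definition is_trace :: "real \<Rightarrow> (real \<Rightarrow> real \<times> real) \<Rightarrow> bool" where
  "is_trace s w \<longleftrightarrow> (s = 1 \<or> s = - 1) \<and> w \<in> borel_measurable borel \<and> (\<forall>t. w t \<in> admissible c V) \<and>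
    (\<forall>e>0. \<exists>R>0. AE y in lborel. 0 < y \<and> y < R \<longrightarrow>
      trace_gap T v hh w (s * y) \<le> ennreal e)"

definition one_sided_control :: "(real \<times> real \<Rightarrow> real) \<Rightarrow> real \<Rightarrow> (real \<Rightarrow> real \<times> real) \<Rightarrow> bool" where
  "one_sided_control g s w \<longleftrightarrow> (\<forall>\<epsilon> \<delta>. \<epsilon> > 0 \<longrightarrow> \<delta> > 0 \<longrightarrow> (\<exists>R0>0. \<forall>R. 0 < R \<and> R < R0 \<longrightarrow>
     mostly T \<delta> (\<lambda>t. AE y in lborel. \<epsilon> * R < y \<and> y < R \<longrightarrow> g (v (t, hh t + s * y)) \<le> g (w t) + \<delta>)))"

definition two_sided_control :: "(real \<times> real \<Rightarrow> real) \<Rightarrow> (real \<Rightarrow> real) \<Rightarrow> bool" where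
  "two_sided_control g K \<longleftrightarrow> (\<forall>\<delta>>0. \<exists>R0>0. \<forall>R. 0 < R \<and> R < R0 \<longrightarrow>
     mostly T \<delta> (\<lambda>t. AE y in lborel. \<bar>y\<bar> < R \<longrightarrow> g (v (t, hh t + y)) \<le> K t + \<delta>))"

lemma trace_excess:
  assumes w: "is_trace s w"
    and lip: "\<forall>x\<in>admissible c V. \<forall>x'\<in>admissible c V. \<bar>g x - g x'\<bar> \<le> C * norm (x - x')"
    and C: "C > 0" and e: "e > 0" and K: "\<And>t. g (w t) \<le> K t"
  shows "\<exists>R>0. AE y in lborel. 0 < s * y \<and> \<bar>y\<bar> < R \<longrightarrow>
      excess T (\<lambda>z. g (v z)) hh K y \<le> ennreal e"
proof -
  have s: "s = 1 \<or> s = - 1" and [measurable]: "w \<in> borel_measurable borel" and w_adm: "\<And>t. w t \<in> admissible c V"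
    using w unfolding is_trace_def by blast+
  note [measurable] = v_meas hh_meas
  have eC: "e / C > 0" using e C by simp
  obtain R where R: "R > 0" "AE y in lborel. 0 < y \<and> y < R \<longrightarrow>
      trace_gap T v hh w (s * y) \<le> ennreal (e / C)"
    using w eC unfolding is_trace_def by blast
  have "AE y in lborel. 0 < s * y \<and> \<bar>y\<bar> < R \<longrightarrow>
      excess T (\<lambda>z. g (v z)) hh K y \<le> ennreal e"
    using AE_sign[OF R(2) s]
  proof eventually_elim
    case (elim y)
    show ?case
    proof
      assume y: "0 < s * y \<and> \<bar>y\<bar> < R"
      have sy: "s * (s * y) = y" "s * y < R" using s y by auto
      have le: "trace_gap T v hh w y \<le> ennreal (e / C)"
        using elim y sy by simp
      have [measurable]: "(\<lambda>t. v (t, hh t + y)) \<in> borel_measurable borel"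
      proof (rule measurable_compose[OF _ v_meas])
        have "(\<lambda>t. (t, hh t + y)) \<in> borel \<rightarrow>\<^sub>M borel \<Otimes>\<^sub>M borel" by measurable
        then show "(\<lambda>t. (t, hh t + y)) \<in> borel_measurable borel" by (simp add: borel_prod)
      qed
      have "excess T (\<lambda>z. g (v z)) hh K y
        \<le> (\<integral>\<^sup>+t. ennreal C * (indicator {0..T} t * ennreal (norm (v (t, hh t + y) - w t))) \<partial>lborel)"
        unfolding excess_def
      proof (rule nn_integral_mono)
        fix t
        have "max (g (v (t, hh t + y)) - K t) 0 \<le> \<bar>g (v (t, hh t + y)) - g (w t)\<bar>"
          using K[of t] by linarith
        also have "\<dots> \<le> C * norm (v (t, hh t + y) - w t)"
          by (intro lip[rule_format] v_adm w_adm)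
        finally have "ennreal (max (g (v (t, hh t + y)) - K t) 0) \<le> ennreal C * ennreal (norm (v (t, hh t + y) - w t))"
          using C by (simp add: ennreal_mult[symmetric] ennreal_leI)
        then show "indicator {0..T} t * ennreal (max (g (v (t, hh t + y)) - K t) 0)
           \<le> ennreal C * (indicator {0..T} t * ennreal (norm (v (t, hh t + y) - w t)))"
          by (auto simp: indicator_def)
      qed
      also have "\<dots> = ennreal C * trace_gap T v hh w y"
        unfolding trace_gap_def by (rule nn_integral_cmult) measurable
      also have "\<dots> \<le> ennreal C * ennreal (e / C)" by (intro mult_left_mono le) simp
      also have "\<dots> = ennreal e" using C e by (simp add: ennreal_mult[symmetric])
      finally show "excess T (\<lambda>z. g (v z)) hh K y \<le> ennreal e" .
    qed
  qed
  with R(1) show ?thesis by blast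
qed

text \<open>
  \<open>control_along_curve\<close> with the exceptional null set absorbed: by \<open>AE_shear\<close>
  almost every time sees it in a null set of positions.
\<close>

lemma kinetic_control:
  assumes KF: "kinetic_family \<eta> q (\<lambda>z. g (v z)) M \<kappa> d0 sg"
    and K: "K \<in> borel_measurable borel" "\<And>t. \<bar>K t\<bar> \<le> M" and J: "J \<in> sets borel"
    and trace: "\<And>e. e > 0 \<Longrightarrow> \<exists>R>0. AE y in lborel. y \<in> J \<and> \<bar>y\<bar> < R \<longrightarrow>
      excess T (\<lambda>z. g (v z)) hh K y \<le> ennreal e"
    and eps: "\<epsilon> > 0" and del: "\<delta> > 0"
  shows "\<exists>R0>0. \<forall>R. 0 < R \<and> R < R0 \<longrightarrow> mostly T \<delta> (\<lambda>t. AE y in lborel.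
      \<bar>y\<bar> < R \<and> (\<forall>y'. \<bar>y' - y\<bar> \<le> \<epsilon> * R \<longrightarrow> y' \<in> J) \<longrightarrow> g (v (t, hh t + y)) \<le> K t + \<delta>)"
proof -
  interpret kinetic_family \<eta> q "\<lambda>z. g (v z)" M \<kappa> d0 sg by (rule KF)
  obtain R0 where R0: "R0 > 0" and *: "\<And>R. 0 < R \<Longrightarrow> R < R0 \<Longrightarrow> \<exists>Bad\<in>sets borel. emeasure lborel Bad \<le> ennreal \<delta> \<and>
      (\<forall>t\<in>{0..T} - Bad. \<forall>y. \<bar>y\<bar> < R \<and> (\<forall>y'. \<bar>y' - y\<bar> \<le> \<epsilon> * R \<longrightarrow> y' \<in> J) \<and> (t, hh t + y) \<notin> exceptional
          \<longrightarrow> g (v (t, hh t + y)) \<le> K t + \<delta>)"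
    using control_along_curve[OF T L K J trace eps del] by blast
  show ?thesis
  proof (intro exI[of _ R0] conjI R0 allI impI)
    fix R assume R: "0 < R \<and> R < R0"
    obtain Bad where Bad: "Bad \<in> sets borel" "emeasure lborel Bad \<le> ennreal \<delta>"
      and b: "\<And>t y. t \<in> {0..T} - Bad \<Longrightarrow> \<bar>y\<bar> < R \<and> (\<forall>y'. \<bar>y' - y\<bar> \<le> \<epsilon> * R \<longrightarrow> y' \<in> J) \<Longrightarrow>
        (t, hh t + y) \<notin> exceptional \<Longrightarrow> g (v (t, hh t + y)) \<le> K t + \<delta>"
      using *[OF R[THEN conjunct1] R[THEN conjunct2]] by blast
    have "AE t in lborel. t \<in> {0..T} - Bad \<longrightarrow> (AE y in lborel.
      \<bar>y\<bar> < R \<and> (\<forall>y'. \<bar>y' - y\<bar> \<le> \<epsilon> * R \<longrightarrow> y' \<in> J) \<longrightarrow> g (v (t, hh t + y)) \<le> K t + \<delta>)"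
      using AE_shear(1)[OF exceptional_null hh_meas]
    proof eventually_elim
      case (elim t)
      show ?case
      proof
        assume t: "t \<in> {0..T} - Bad"
        from elim show "AE y in lborel.
          \<bar>y\<bar> < R \<and> (\<forall>y'. \<bar>y' - y\<bar> \<le> \<epsilon> * R \<longrightarrow> y' \<in> J) \<longrightarrow> g (v (t, hh t + y)) \<le> K t + \<delta>"
        proof eventually_elim
          case (elim y)
          show ?case using b[OF t _ elim] by (rule impI)
        qed
      qed
    qed
    with Bad show "mostly T \<delta> (\<lambda>t. AE y in lborel.
      \<bar>y\<bar> < R \<and> (\<forall>y'. \<bar>y' - y\<bar> \<le> \<epsilon> * R \<longrightarrow> y' \<in> J) \<longrightarrow> g (v (t, hh t + y)) \<le> K t + \<delta>)"
      unfolding mostly_def by blast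
  qed
qed

text \<open>
  For \<open>\<epsilon> * R < y < R\<close> the ball of radius
  \<open>\<epsilon> / 2 * R\<close> around \<open>s * y\<close> stays on the side \<open>s\<close>
  of the curve, so the trace on this side suffices.
\<close>

lemma kinetic_one_sided_control:
  assumes KF: "kinetic_family \<eta> q (\<lambda>z. g (v z)) M \<kappa> d0 sg"
    and lip: "\<forall>x\<in>admissible c V. \<forall>x'\<in>admissible c V. \<bar>g x - g x'\<bar> \<le> C * norm (x - x')"
    and C: "C > 0" and g [measurable]: "g \<in> borel_measurable borel"
    and g_le: "\<And>x. x \<in> admissible c V \<Longrightarrow> \<bar>g x\<bar> \<le> M" and w: "is_trace s w"
  shows "one_sided_control g s w"
  unfolding one_sided_control_def
proof (intro allI impI)
  fix \<epsilon> \<delta> :: real assume eps: "\<epsilon> > 0" and del: "\<delta> > 0"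
  have s: "s = 1 \<or> s = - 1" and [measurable]: "w \<in> borel_measurable borel" and w_adm: "\<And>t. w t \<in> admissible c V"
    using w unfolding is_trace_def by blast+
  have e2: "\<epsilon> / 2 > 0" using eps by simp
  have "\<exists>R0>0. \<forall>R. 0 < R \<and> R < R0 \<longrightarrow> mostly T \<delta> (\<lambda>t. AE y in lborel.
      \<bar>y\<bar> < R \<and> (\<forall>y'. \<bar>y' - y\<bar> \<le> \<epsilon> / 2 * R \<longrightarrow> y' \<in> {y. 0 < s * y}) \<longrightarrow> g (v (t, hh t + y)) \<le> g (w t) + \<delta>)"
  proof (rule kinetic_control[OF KF _ _ _ _ e2 del])
    show "\<bar>g (w t)\<bar> \<le> M" for t by (rule g_le[OF w_adm])
    show "\<exists>R>0. AE y in lborel. y \<in> {y. 0 < s * y} \<and> \<bar>y\<bar> < R \<longrightarrow>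
      excess T (\<lambda>z. g (v z)) hh (\<lambda>t. g (w t)) y \<le> ennreal e"
      if "e > 0" for e
      unfolding mem_Collect_eq by (rule trace_excess[OF w lip C that order_refl])
  qed measurable
  then obtain R0 where R0: "R0 > 0" and b: "\<And>R. 0 < R \<Longrightarrow> R < R0 \<Longrightarrow> mostly T \<delta> (\<lambda>t. AE y in lborel.
      \<bar>y\<bar> < R \<and> (\<forall>y'. \<bar>y' - y\<bar> \<le> \<epsilon> / 2 * R \<longrightarrow> y' \<in> {y. 0 < s * y}) \<longrightarrow> g (v (t, hh t + y)) \<le> g (w t) + \<delta>)"
    by blast
  show "\<exists>R0>0. \<forall>R. 0 < R \<and> R < R0 \<longrightarrow>
     mostly T \<delta> (\<lambda>t. AE y in lborel. \<epsilon> * R < y \<and> y < R \<longrightarrow> g (v (t, hh t + s * y)) \<le> g (w t) + \<delta>)"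
  proof (intro exI[of _ R0] conjI R0 allI impI)
    fix R assume R: "0 < R \<and> R < R0"
    show "mostly T \<delta> (\<lambda>t. AE y in lborel. \<epsilon> * R < y \<and> y < R \<longrightarrow> g (v (t, hh t + s * y)) \<le> g (w t) + \<delta>)"
    proof (rule mostly_mono[OF b[of R] AE_I2 order_refl], use R in simp, use R in simp, intro impI)
      fix t
      assume "AE y in lborel. \<bar>y\<bar> < R \<and> (\<forall>y'. \<bar>y' - y\<bar> \<le> \<epsilon> / 2 * R \<longrightarrow> y' \<in> {y. 0 < s * y})
          \<longrightarrow> g (v (t, hh t + y)) \<le> g (w t) + \<delta>"
      from AE_sign[OF this s] show "AE y in lborel. \<epsilon> * R < y \<and> y < R \<longrightarrow> g (v (t, hh t + s * y)) \<le> g (w t) + \<delta>"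
      proof eventually_elim
        case (elim y)
        show ?case
        proof
          assume y: "\<epsilon> * R < y \<and> y < R"
          have eR: "0 < \<epsilon> * R" using eps R by simp
          have "\<bar>s * y\<bar> < R" using s y eR by auto
          moreover have "0 < s * y'" if "\<bar>y' - s * y\<bar> \<le> \<epsilon> / 2 * R" for y'
          proof -
            have "\<epsilon> / 2 * R = (\<epsilon> * R) / 2" by simp
            with that have "- (\<epsilon> * R / 2) \<le> y' - s * y" "y' - s * y \<le> \<epsilon> * R / 2"
              by (simp_all only: abs_le_iff) linarith
            with s y[THEN conjunct1] eR show ?thesis by auto
          qed
          ultimately show "g (v (t, hh t + s * y)) \<le> g (w t) + \<delta>" using elim by blast
        qed
      qed
    qed
  qed
qed

text \<open>
  The maximum of the two traces is an upper level on both sides, so the squares may cross the curve.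
\<close>

lemma kinetic_two_sided_control:
  assumes KF: "kinetic_family \<eta> q (\<lambda>z. g (v z)) M \<kappa> d0 sg"
    and lip: "\<forall>x\<in>admissible c V. \<forall>x'\<in>admissible c V. \<bar>g x - g x'\<bar> \<le> C * norm (x - x')"
    and C: "C > 0" and g [measurable]: "g \<in> borel_measurable borel"
    and g_le: "\<And>x. x \<in> admissible c V \<Longrightarrow> \<bar>g x\<bar> \<le> M"
    and vp: "is_trace 1 vp" and vm: "is_trace (- 1) vm"
  shows "two_sided_control g (\<lambda>t. max (g (vp t)) (g (vm t)))"
  unfolding two_sided_control_def
proof (intro allI impI)
  fix \<delta> :: real assume del: "\<delta> > 0"
  have [measurable]: "vp \<in> borel_measurable borel" "vm \<in> borel_measurable borel"
    and adm: "\<And>t. vp t \<in> admissible c V" "\<And>t. vm t \<in> admissible c V"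
    using vp vm unfolding is_trace_def by blast+
  define K where "K t = max (g (vp t)) (g (vm t))" for t
  have "\<exists>R0>0. \<forall>R. 0 < R \<and> R < R0 \<longrightarrow> mostly T \<delta> (\<lambda>t. AE y in lborel.
      \<bar>y\<bar> < R \<and> (\<forall>y'. \<bar>y' - y\<bar> \<le> 1 * R \<longrightarrow> y' \<in> UNIV) \<longrightarrow> g (v (t, hh t + y)) \<le> K t + \<delta>)"
  proof (rule kinetic_control[OF KF _ _ _ _ zero_less_one del])
    show "K \<in> borel_measurable borel" unfolding K_def by measurable
    show "\<bar>K t\<bar> \<le> M" for t using g_le[OF adm(1)[of t]] g_le[OF adm(2)[of t]] by (simp add: K_def)
    fix e :: real assume e: "e > 0"
    let ?P = "\<lambda>y. excess T (\<lambda>z. g (v z)) hh K y \<le> ennreal e"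
    obtain R1 where R1: "R1 > 0" "AE y in lborel. 0 < 1 * y \<and> \<bar>y\<bar> < R1 \<longrightarrow> ?P y"
      using trace_excess[OF vp lip C e, of K] by (auto simp: K_def)
    obtain R2 where R2: "R2 > 0" "AE y in lborel. 0 < - 1 * y \<and> \<bar>y\<bar> < R2 \<longrightarrow> ?P y"
      using trace_excess[OF vm lip C e, of K] by (auto simp: K_def)
    have "AE y in lborel. y \<noteq> (0::real)" by (rule AE_lborel_singleton)
    with R1(2) R2(2) have "AE y in lborel. y \<in> UNIV \<and> \<bar>y\<bar> < min R1 R2 \<longrightarrow> ?P y"
    proof eventually_elim
      case (elim y)
      then show ?case by (cases "y < 0") auto
    qed
    then show "\<exists>R>0. AE y in lborel. y \<in> UNIV \<and> \<bar>y\<bar> < R \<longrightarrow> ?P y"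
      using R1(1) R2(1) by (intro exI[of _ "min R1 R2"]) simp
  qed simp
  then show "\<exists>R0>0. \<forall>R. 0 < R \<and> R < R0 \<longrightarrow> mostly T \<delta> (\<lambda>t. AE y in lborel.
      \<bar>y\<bar> < R \<longrightarrow> g (v (t, hh t + y)) \<le> max (g (vp t)) (g (vm t)) + \<delta>)"
    by (simp add: K_def)
qed

lemma one_sided_control_add:
  assumes f: "one_sided_control f s w" and g: "one_sided_control g s w"
  shows "one_sided_control (\<lambda>x. f x + g x) s w"
  unfolding one_sided_control_def
proof (intro allI impI)
  fix \<epsilon> \<delta> :: real assume eps: "\<epsilon> > 0" and del: "\<delta> > 0"
  then have d2: "\<delta> / 2 > 0" by simp
  obtain R1 where R1: "R1 > 0" and b1: "\<And>R. 0 < R \<Longrightarrow> R < R1 \<Longrightarrow> mostly T (\<delta> / 2) (\<lambda>t. AE y in lborel.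
      \<epsilon> * R < y \<and> y < R \<longrightarrow> f (v (t, hh t + s * y)) \<le> f (w t) + \<delta> / 2)"
    using f[unfolded one_sided_control_def, rule_format, OF eps d2] by blast
  obtain R2 where R2: "R2 > 0" and b2: "\<And>R. 0 < R \<Longrightarrow> R < R2 \<Longrightarrow> mostly T (\<delta> / 2) (\<lambda>t. AE y in lborel.
      \<epsilon> * R < y \<and> y < R \<longrightarrow> g (v (t, hh t + s * y)) \<le> g (w t) + \<delta> / 2)"
    using g[unfolded one_sided_control_def, rule_format, OF eps d2] by blast
  show "\<exists>R0>0. \<forall>R. 0 < R \<and> R < R0 \<longrightarrow> mostly T \<delta> (\<lambda>t. AE y in lborel.
      \<epsilon> * R < y \<and> y < R \<longrightarrow> f (v (t, hh t + s * y)) + g (v (t, hh t + s * y)) \<le> f (w t) + g (w t) + \<delta>)"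
  proof (intro exI[of _ "min R1 R2"] conjI allI impI)
    show "0 < min R1 R2" using R1 R2 by simp
    fix R assume "0 < R \<and> R < min R1 R2"
    then have R: "0 < R" "R < R1" "R < R2" by auto
    have "mostly T (\<delta> / 2 + \<delta> / 2) (\<lambda>t. (AE y in lborel.
      \<epsilon> * R < y \<and> y < R \<longrightarrow> f (v (t, hh t + s * y)) \<le> f (w t) + \<delta> / 2) \<and> (AE y in lborel.
      \<epsilon> * R < y \<and> y < R \<longrightarrow> g (v (t, hh t + s * y)) \<le> g (w t) + \<delta> / 2))"
      by (rule mostly_conj[OF b1[OF R(1,2)] b2[OF R(1,3)]]) (use del in auto)
    then show "mostly T \<delta> (\<lambda>t. AE y in lborel.
      \<epsilon> * R < y \<and> y < R \<longrightarrow> f (v (t, hh t + s * y)) + g (v (t, hh t + s * y)) \<le> f (w t) + g (w t) + \<delta>)"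
    proof (rule mostly_mono[OF _ AE_I2], intro impI, elim conjE)
      fix t
      assume "AE y in lborel. \<epsilon> * R < y \<and> y < R \<longrightarrow> f (v (t, hh t + s * y)) \<le> f (w t) + \<delta> / 2"
        and "AE y in lborel. \<epsilon> * R < y \<and> y < R \<longrightarrow> g (v (t, hh t + s * y)) \<le> g (w t) + \<delta> / 2"
      then show "AE y in lborel.
        \<epsilon> * R < y \<and> y < R \<longrightarrow> f (v (t, hh t + s * y)) + g (v (t, hh t + s * y)) \<le> f (w t) + g (w t) + \<delta>"
        by eventually_elim auto
    qed simp
  qed
qed

lemma two_sided_limit:
  assumes up: "AE t in lborel. t \<in> {0..T} \<longrightarrow> up t = vp t" and um: "AE t in lborel. t \<in> {0..T} \<longrightarrow> um t = vm t"
    and vp: "is_trace 1 vp" and vm: "is_trace (- 1) vm"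
    and ctrl: "two_sided_control g (\<lambda>t. max (g (vp t)) (g (vm t)))"
    and g [measurable]: "g \<in> borel_measurable borel" and g_le: "\<And>x. x \<in> admissible c V \<Longrightarrow> \<bar>g x\<bar> \<le> M"
  shows "(\<lambda>n. \<integral>\<^sup>+t. esssup (lebesgue_on {- (1 / real n)<..<1 / real n})
            (\<lambda>y. ennreal (pos_part (g (u (t, h t + y)) - max (g (up t)) (g (um t)))))
          \<partial>lebesgue_on {0..T}) \<longlonglongrightarrow> 0"
proof (rule integral_esssup_tendsto_0[OF T])
  define \<psi>' where "\<psi>' t y = pos_part (g (v (t, hh t + y)) - max (g (vp t)) (g (vm t)))" for t y
  show "\<psi>' t \<in> borel_measurable borel" for t
  proof -
    have [measurable]: "(\<lambda>y. v (t, hh t + y)) \<in> borel_measurable borel"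
      using section_measurable[of t "hh t" 1] by simp
    show ?thesis unfolding \<psi>'_def pos_part_def by measurable
  qed
  show "0 \<le> 2 * M" using g_le[OF v_adm[of undefined]] by linarith
  have adm: "vp t \<in> admissible c V" "vm t \<in> admissible c V" for t
    using vp vm unfolding is_trace_def by blast+
  show "\<psi>' t y \<le> 2 * M" for t y
    using g_le[OF v_adm[of "(t, hh t + y)"]] g_le[OF adm(1)[of t]] g_le[OF adm(2)[of t]]
    unfolding \<psi>'_def pos_part_def by linarith
  show "AE t in lborel. t \<in> {0..T} \<longrightarrow>
      (AE y in lborel. pos_part (g (u (t, h t + y)) - max (g (up t)) (g (um t))) = \<psi>' t y)"
    using section_eq[of 1, simplified] up um
  proof eventually_elim
    case (elim t)
    show ?case
    proof
      assume t: "t \<in> {0..T}"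
      with elim(1) have "AE y in lborel. u (t, h t + y) = v (t, hh t + y)" by simp
      then show "AE y in lborel. pos_part (g (u (t, h t + y)) - max (g (up t)) (g (um t))) = \<psi>' t y"
        by eventually_elim (use elim(2,3) t in \<open>simp add: \<psi>'_def\<close>)
    qed
  qed
  fix \<delta> :: real assume del: "\<delta> > 0"
  obtain R0 where R0: "R0 > 0" and b: "\<And>R. 0 < R \<Longrightarrow> R < R0 \<Longrightarrow> mostly T \<delta> (\<lambda>t. AE y in lborel.
      \<bar>y\<bar> < R \<longrightarrow> g (v (t, hh t + y)) \<le> max (g (vp t)) (g (vm t)) + \<delta>)"
    using ctrl[unfolded two_sided_control_def, rule_format, OF del] by blast
  show "\<forall>\<^sub>F n in sequentially. mostly T \<delta> (\<lambda>t. AE y in lborel. y \<in> {- (1 / real n)<..<1 / real n} \<longrightarrow> \<psi>' t y \<le> \<delta>)"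
    using order_tendstoD(2)[OF lim_1_over_n R0] eventually_gt_at_top[of 0]
  proof eventually_elim
    case (elim n)
    show ?case
    proof (rule mostly_mono[OF b[of "1 / real n"] AE_I2 order_refl], use elim in simp, use elim in simp, intro impI)
      fix t
      assume "AE y in lborel. \<bar>y\<bar> < 1 / real n \<longrightarrow> g (v (t, hh t + y)) \<le> max (g (vp t)) (g (vm t)) + \<delta>"
      then show "AE y in lborel. y \<in> {- (1 / real n)<..<1 / real n} \<longrightarrow> \<psi>' t y \<le> \<delta>"
        by eventually_elim (use del in \<open>auto simp: \<psi>'_def pos_part_def\<close>)
    qed
  qed
qed simp

lemma one_sided_limit:
  fixes r :: "nat \<Rightarrow> real"
  assumes up: "AE t in lborel. t \<in> {0..T} \<longrightarrow> up t = vp t" and um: "AE t in lborel. t \<in> {0..T} \<longrightarrow> um t = vm t"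
    and vp: "is_trace 1 vp" and vm: "is_trace (- 1) vm"
    and ctrl: "one_sided_control g 1 vp" "one_sided_control g (- 1) vm"
    and g [measurable]: "g \<in> borel_measurable borel" and g_le: "\<And>x. x \<in> admissible c V \<Longrightarrow> \<bar>g x\<bar> \<le> M"
    and r: "filterlim r (at_right 0) sequentially" and eps: "0 < \<epsilon>"
  shows "(\<lambda>n. \<integral>\<^sup>+t. esssup (lebesgue_on {\<epsilon> * r n<..<r n})
             (\<lambda>y. ennreal (pos_part (g (u (t, h t + y)) - g (up t)) + pos_part (g (u (t, h t - y)) - g (um t))))
           \<partial>lebesgue_on {0..T}) \<longlonglongrightarrow> 0"
proof (rule integral_esssup_tendsto_0[OF T])
  define \<psi>' where "\<psi>' t y = pos_part (g (v (t, hh t + y)) - g (vp t)) + pos_part (g (v (t, hh t - y)) - g (vm t))" for t y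
  show "\<psi>' t \<in> borel_measurable borel" for t
  proof -
    have [measurable]: "(\<lambda>y. v (t, hh t + y)) \<in> borel_measurable borel" "(\<lambda>y. v (t, hh t - y)) \<in> borel_measurable borel"
      using section_measurable[of t "hh t" 1] section_measurable[of t "hh t" "- 1"] by simp_all
    show ?thesis unfolding \<psi>'_def pos_part_def by measurable
  qed
  show "0 \<le> 4 * M" using g_le[OF v_adm[of undefined]] by linarith
  have adm: "vp t \<in> admissible c V" "vm t \<in> admissible c V" for t
    using vp vm unfolding is_trace_def by blast+
  show "\<psi>' t y \<le> 4 * M" for t y
    using g_le[OF v_adm[of "(t, hh t + y)"]] g_le[OF v_adm[of "(t, hh t - y)"]] g_le[OF adm(1)[of t]] g_le[OF adm(2)[of t]]
    unfolding \<psi>'_def pos_part_def by linarith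
  show "AE t in lborel. t \<in> {0..T} \<longrightarrow> (AE y in lborel.
      pos_part (g (u (t, h t + y)) - g (up t)) + pos_part (g (u (t, h t - y)) - g (um t)) = \<psi>' t y)"
    using section_eq[of 1, simplified] section_eq[of "- 1", simplified] up um
  proof eventually_elim
    case (elim t)
    show ?case
    proof
      assume t: "t \<in> {0..T}"
      with elim(1,2) have "AE y in lborel. u (t, h t + y) = v (t, hh t + y)" "AE y in lborel. u (t, h t - y) = v (t, hh t - y)"
        by simp_all
      then show "AE y in lborel.
        pos_part (g (u (t, h t + y)) - g (up t)) + pos_part (g (u (t, h t - y)) - g (um t)) = \<psi>' t y"
        by eventually_elim (use elim(3,4) t in \<open>simp add: \<psi>'_def\<close>)
    qed
  qed
  fix \<delta> :: real assume del: "\<delta> > 0"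
  then have d2: "\<delta> / 2 > 0" by simp
  obtain R1 where R1: "R1 > 0" and b1: "\<And>R. 0 < R \<Longrightarrow> R < R1 \<Longrightarrow> mostly T (\<delta> / 2) (\<lambda>t. AE y in lborel.
      \<epsilon> * R < y \<and> y < R \<longrightarrow> g (v (t, hh t + 1 * y)) \<le> g (vp t) + \<delta> / 2)"
    using ctrl(1)[unfolded one_sided_control_def, rule_format, OF eps d2] by blast
  obtain R2 where R2: "R2 > 0" and b2: "\<And>R. 0 < R \<Longrightarrow> R < R2 \<Longrightarrow> mostly T (\<delta> / 2) (\<lambda>t. AE y in lborel.
      \<epsilon> * R < y \<and> y < R \<longrightarrow> g (v (t, hh t + - 1 * y)) \<le> g (vm t) + \<delta> / 2)"
    using ctrl(2)[unfolded one_sided_control_def, rule_format, OF eps d2] by blast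
  have "eventually (\<lambda>x. 0 < x \<and> x < min R1 R2) (at_right (0::real))"
    using R1 R2 unfolding eventually_at_right_field by (intro exI[of _ "min R1 R2"]) simp
  then have "eventually (\<lambda>n. 0 < r n \<and> r n < min R1 R2) sequentially"
    using r unfolding filterlim_iff by blast
  then show "\<forall>\<^sub>F n in sequentially. mostly T \<delta> (\<lambda>t. AE y in lborel. y \<in> {\<epsilon> * r n<..<r n} \<longrightarrow> \<psi>' t y \<le> \<delta>)"
  proof eventually_elim
    case (elim n)
    then have rn: "0 < r n" "r n < R1" "r n < R2" by auto
    have "mostly T (\<delta> / 2 + \<delta> / 2) (\<lambda>t. (AE y in lborel.
      \<epsilon> * r n < y \<and> y < r n \<longrightarrow> g (v (t, hh t + 1 * y)) \<le> g (vp t) + \<delta> / 2) \<and> (AE y in lborel.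
      \<epsilon> * r n < y \<and> y < r n \<longrightarrow> g (v (t, hh t + - 1 * y)) \<le> g (vm t) + \<delta> / 2))"
      by (rule mostly_conj[OF b1[OF rn(1,2)] b2[OF rn(1,3)]]) (use del in auto)
    then show ?case
    proof (rule mostly_mono[OF _ AE_I2], intro impI, elim conjE)
      fix t
      assume "AE y in lborel. \<epsilon> * r n < y \<and> y < r n \<longrightarrow> g (v (t, hh t + 1 * y)) \<le> g (vp t) + \<delta> / 2"
        and "AE y in lborel. \<epsilon> * r n < y \<and> y < r n \<longrightarrow> g (v (t, hh t + - 1 * y)) \<le> g (vm t) + \<delta> / 2"
      then show "AE y in lborel. y \<in> {\<epsilon> * r n<..<r n} \<longrightarrow> \<psi>' t y \<le> \<delta>"
        by eventually_elim (use del in \<open>auto simp: \<psi>'_def pos_part_def\<close>)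
    qed simp
  qed
qed simp

end

section \<open>The Riemann invariants and the density near a curve\<close>

text \<open>
  Both \<open>lambda2\<close> and \<open>- lambda1\<close> belong to kinetic families;
  \<open>fst\<close> is their sum, so it inherits the one-sided controls. Across the curve the sum of
  the two separate maxima may exceed \<open>max \<rho>\<^sup>+ \<rho>\<^sup>-\<close>, so no two-sided
  bound for \<open>\<rho>\<close> follows.
\<close>

theorem theorem1p2:
  fixes u :: "real \<times> real \<Rightarrow> real \<times> real"
    and h :: "real \<Rightarrow> real" and T :: real
    and u\<^sub>p u\<^sub>m :: "real \<Rightarrow> real \<times> real"
  assumes "bounded_entropy_solution u"
    and "essinf (lebesgue_on spacetime) (\<lambda>z. fst (u z)) > 0"
    and "T > 0"
    and "\<exists>L. L-lipschitz_on {0..T} h"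
    and "strong_traces u h T u\<^sub>p u\<^sub>m"
  shows "(\<forall>g\<^sub>1 \<in> {lambda2, \<lambda>w. - lambda1 w}.
            (\<lambda>n. \<integral>\<^sup>+t. esssup (lebesgue_on {- (1 / real n)<..<1 / real n})
                     (\<lambda>y. ennreal (pos_part (g\<^sub>1 (u (t, h t + y)) - max (g\<^sub>1 (u\<^sub>p t)) (g\<^sub>1 (u\<^sub>m t)))))
                   \<partial>lebesgue_on {0..T})
              \<longlonglongrightarrow> 0) \<and>
         (\<forall>(r :: nat \<Rightarrow> real) (\<epsilon> :: real).
            filterlim r (at_right 0) sequentially \<longrightarrow> 0 < \<epsilon> \<longrightarrow> \<epsilon> < 1 \<longrightarrow>
            (\<forall>g\<^sub>2 \<in> {fst, lambda2, \<lambda>w. - lambda1 w}.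
              (\<lambda>n. \<integral>\<^sup>+t. esssup (lebesgue_on {\<epsilon> * r n<..<r n})
                       (\<lambda>y. ennreal (pos_part (g\<^sub>2 (u (t, h t + y)) - g\<^sub>2 (u\<^sub>p t))
                                   + pos_part (g\<^sub>2 (u (t, h t - y)) - g\<^sub>2 (u\<^sub>m t))))
                     \<partial>lebesgue_on {0..T})
                \<longlonglongrightarrow> 0))"
proof -
  obtain c V where cV: "0 < c" "c \<le> 1" "c \<le> V" and adm: "AE z in lborel. z \<in> spacetime \<longrightarrow> u z \<in> admissible c V"
    by (rule solution_admissible[OF assms(1,2)]) (rule that)
  have u_meas: "u \<in> borel_measurable (lebesgue_on spacetime)"
    using assms(1) unfolding bounded_entropy_solution_def by blast
  obtain v where v: "v \<in> borel_measurable borel" "AE z in lborel. z \<in> spacetime \<longrightarrow> u z = v z"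
    "\<And>z. v z \<in> admissible c V"
    by (rule ex_admissible_representative[OF spacetime_borel u_meas adm cV(1,3)]) (rule that)
  obtain L where L: "L-lipschitz_on {0..T} h" using assms(4) by blast
  define hh where "hh t = h (max 0 (min T t))" for t
  have hh_eq: "hh t = h t" if "t \<in> {0..T}" for t using that by (simp add: hh_def)
  have L0: "0 \<le> L" by (rule lipschitz_on_nonneg[OF L])
  have hh_lip: "\<bar>hh s - hh t\<bar> \<le> L * \<bar>s - t\<bar>" for s t
  proof -
    have "\<bar>hh s - hh t\<bar> \<le> L * \<bar>max 0 (min T s) - max 0 (min T t)\<bar>"
      using lipschitz_onD[OF L, of "max 0 (min T s)" "max 0 (min T t)"] assms(3)
      by (simp add: hh_def dist_real_def)
    also have "\<dots> \<le> L * \<bar>s - t\<bar>" by (intro mult_left_mono L0) linarith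
    finally show ?thesis .
  qed
  have "continuous_on UNIV hh"
  proof -
    have "continuous_on {0..T} h" by (rule lipschitz_on_continuous_on[OF L])
    then show ?thesis
      unfolding hh_def[abs_def]
      by (rule continuous_on_compose2) (use assms(3) in \<open>auto intro!: continuous_intros\<close>)
  qed
  then have hh_meas: "hh \<in> borel_measurable borel" by (rule borel_measurable_continuous_onI)
  have tr_meas: "u\<^sub>p \<in> borel_measurable (lebesgue_on {0..T})" "u\<^sub>m \<in> borel_measurable (lebesgue_on {0..T})"
    using assms(5) unfolding strong_traces_def Linfty_def by blast+
  obtain vp where vp: "vp \<in> borel_measurable borel" "\<And>t. vp t \<in> admissible c V"
    "AE t in lborel. t \<in> {0..T} \<longrightarrow> u\<^sub>p t = vp t"
    "\<forall>e>0. \<exists>R>0. AE y in lborel. 0 < y \<and> y < R \<longrightarrow>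
      trace_gap T v hh vp (1 * y) \<le> ennreal e"
    by (rule trace_representative[OF v(2,1,3) cV(1,3) assms(3) hh_meas hh_eq disjI1[OF refl] tr_meas(1)
          strong_traces_side(1)[OF assms(5)]], assumption, assumption, rule that)
  obtain vm where vm: "vm \<in> borel_measurable borel" "\<And>t. vm t \<in> admissible c V"
    "AE t in lborel. t \<in> {0..T} \<longrightarrow> u\<^sub>m t = vm t"
    "\<forall>e>0. \<exists>R>0. AE y in lborel. 0 < y \<and> y < R \<longrightarrow>
      trace_gap T v hh vm (- 1 * y) \<le> ennreal e"
    by (rule trace_representative[OF v(2,1,3) cV(1,3) assms(3) hh_meas hh_eq disjI2[OF refl] tr_meas(2)
          strong_traces_side(2)[OF assms(5)]], assumption, assumption, rule that)
  interpret traced_solution u v h hh T c V L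
    by unfold_locales (fact v assms(3) L0 hh_lip hh_meas hh_eq)+
  have tr: "is_trace 1 vp" "is_trace (- 1) vm"
    using vp(1,2,4) vm(1,2,4) unfolding is_trace_def by blast+
  let ?C = "(1 + V) / c + 1"
  have C: "0 < ?C" using cV by (simp add: add_pos_pos)
  have lip: "\<forall>w\<in>admissible c V. \<forall>w'\<in>admissible c V. \<bar>lambda2 w - lambda2 w'\<bar> \<le> ?C * norm (w - w')"
    "\<forall>w\<in>admissible c V. \<forall>w'\<in>admissible c V. \<bar>- lambda1 w - - lambda1 w'\<bar> \<le> ?C * norm (w - w')"
    using lambda_lipschitz[OF cV(1)] by (auto simp: abs_minus_commute)
  have bd: "\<bar>lambda2 w\<bar> \<le> 2 * V" "\<bar>- lambda1 w\<bar> \<le> 2 * V" "\<bar>fst w\<bar> \<le> 2 * V" if "w \<in> admissible c V" for w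
    using lambda_bounds[OF cV(1) that] cV that by (auto simp: admissible_def)
  have m: "lambda2 \<in> borel_measurable borel" "(\<lambda>w. - lambda1 w) \<in> borel_measurable borel"
    by measurable
  note KF = solution_kinetic_family[OF assms(1) v(2,1,3) cV]
  have two2: "two_sided_control lambda2 (\<lambda>t. max (lambda2 (vp t)) (lambda2 (vm t)))"
    by (rule kinetic_two_sided_control[OF KF(1) lip(1) C m(1) bd(1) tr])
  have two1: "two_sided_control (\<lambda>w. - lambda1 w) (\<lambda>t. max (- lambda1 (vp t)) (- lambda1 (vm t)))"
    by (rule kinetic_two_sided_control[OF KF(2) lip(2) C m(2) bd(2) tr])
  have one2: "one_sided_control lambda2 s w" if "is_trace s w" for s w
    by (rule kinetic_one_sided_control[OF KF(1) lip(1) C m(1) bd(1) that])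
  have one1: "one_sided_control (\<lambda>w. - lambda1 w) s w" if "is_trace s w" for s w
    by (rule kinetic_one_sided_control[OF KF(2) lip(2) C m(2) bd(2) that])
  have "(\<lambda>w. lambda2 w + - lambda1 w) = fst" using lambda_diff by auto
  then have one0: "one_sided_control fst s w" if "is_trace s w" for s w
    using one_sided_control_add[OF one2[OF that] one1[OF that]] by simp
  show ?thesis
  proof (intro conjI ballI allI impI)
    fix g1 assume "g1 \<in> {lambda2, \<lambda>w. - lambda1 w}"
    then consider "g1 = lambda2" | "g1 = (\<lambda>w. - lambda1 w)" by blast
    then show "(\<lambda>n. \<integral>\<^sup>+t. esssup (lebesgue_on {- (1 / real n)<..<1 / real n})
                     (\<lambda>y. ennreal (pos_part (g1 (u (t, h t + y)) - max (g1 (u\<^sub>p t)) (g1 (u\<^sub>m t)))))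
                   \<partial>lebesgue_on {0..T}) \<longlonglongrightarrow> 0"
    proof cases
      case 1
      show ?thesis unfolding 1 by (rule two_sided_limit[OF vp(3) vm(3) tr two2 m(1) bd(1)])
    next
      case 2
      show ?thesis unfolding 2 by (rule two_sided_limit[OF vp(3) vm(3) tr two1 m(2) bd(2)])
    qed
  next
    fix r :: "nat \<Rightarrow> real" and \<epsilon> :: real and g2 :: "real \<times> real \<Rightarrow> real"
    assume r: "filterlim r (at_right 0) sequentially" and eps: "0 < \<epsilon>" "\<epsilon> < 1"
      and "g2 \<in> {fst, lambda2, \<lambda>w. - lambda1 w}"
    then consider "g2 = fst" | "g2 = lambda2" | "g2 = (\<lambda>w. - lambda1 w)" by blast
    then show "(\<lambda>n. \<integral>\<^sup>+t. esssup (lebesgue_on {\<epsilon> * r n<..<r n})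
                       (\<lambda>y. ennreal (pos_part (g2 (u (t, h t + y)) - g2 (u\<^sub>p t))
                                   + pos_part (g2 (u (t, h t - y)) - g2 (u\<^sub>m t))))
                     \<partial>lebesgue_on {0..T}) \<longlonglongrightarrow> 0"
    proof cases
      case 1
      show ?thesis unfolding 1 by (rule one_sided_limit[OF vp(3) vm(3) tr one0[OF tr(1)] one0[OF tr(2)] borel_fst_snd(1) bd(3) r eps(1)])
    next
      case 2
      show ?thesis unfolding 2 by (rule one_sided_limit[OF vp(3) vm(3) tr one2[OF tr(1)] one2[OF tr(2)] m(1) bd(1) r eps(1)])
    next
      case 3
      show ?thesis unfolding 3 by (rule one_sided_limit[OF vp(3) vm(3) tr one1[OF tr(1)] one1[OF tr(2)] m(2) bd(2) r eps(1)])
    qed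
  qed
qed

end
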